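(* Work over $\mathbb{C}$. Let $n\in\{3,4,5\}$ and let $\mathcal{P}$ be a portrait on $n$ points that is a disjoint union of cycles. Then the moduli space $\mathcal{M}_2^1[\mathcal{P}]$ of degree two rational maps on $\mathbb{P}^1$ with portrait $\mathcal{P}$ is either empty or a smooth rational surface.
   Context: Everything is over $\mathbb{C}$. A portrait is a pair $\mathcal{P}=(\mathcal{V},\Psi)$ with $\mathcal{V}$ a finite set and $\Psi:\mathcal{V}\to\mathcal{V}$ a function; for a portrait on $n$ points identify $\mathcal{V}$ with $\{1,\dots,n\}$. It is a disjoint union of cycles if $\Psi$ is a permutation. $\mathrm{Rat}_2^1\subset\mathbb{P}^5$ is the open subvariety (nonvanishing resultant) parametrizing degree two endomorphisms $f([U:V])=[a_0U^2+a_1UV+a_2V^2:a_3U^2+a_4UV+a_5V^2]$ of $\mathbb{P}^1$. Put $$\mathrm{End}_2^1[\mathcal{P}]=\{(f,p_1,\dots,p_n)\mid f(p_i)=p_{\Psi(i)}\text{ for all }i,\ p_i\neq p_j\text{ for }i\neq j\}\subset \mathrm{Rat}_2^1\times(\mathbb{P}^1)^n.$$ The group $\mathrm{Aut}(\mathbb{P}^1)$ acts by $\varphi*(f,p_1,\dots,p_n)=(\varphi^{-1}f\varphi,\varphi^{-1}(p_1),\dots,\varphi^{-1}(p_n))$, and $\mathcal{M}_2^1[\mathcal{P}]$ is the geometric quotient $\mathrm{End}_2^1[\mathcal{P}]/\!/\mathrm{Aut}(\mathbb{P}^1)$. *)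

theory Defs
  imports
    "HOL-Analysis.Abstract_Topology"
    "HOL-Library.Extended_Nat"
    "HOL-Library.Function_Algebras"
    "Subresultants.Resultant_Prelim"
begin

section \<open>Spaces with functions\<close>

text \<open>
  Varieties over the complex numbers are treated as in the books of Kempf and Springer: a
  variety is a topological space with a sheaf of complex-valued functions, locally isomorphic
  to an affine variety. A function in \<open>regular X U\<close> is a total function whose
  values outside \<open>U\<close> are irrelevant.
\<close>

record 'a fspace =
  zariski :: "'a topology"
  regular :: "'a set \<Rightarrow> ('a \<Rightarrow> complex) set"

abbreviation points :: "'a fspace \<Rightarrow> 'a set"
  where "points X \<equiv> topspace (zariski X)"

definition space_with_functions :: "'a fspace \<Rightarrow> bool" where
  "space_with_functions X \<longleftrightarrow>
     (\<forall>U. \<forall>f \<in> regular X U. openin (zariski X) U) \<and>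
     (\<forall>U. \<forall>f \<in> regular X U. \<forall>g. (\<forall>x\<in>U. g x = f x) \<longrightarrow> g \<in> regular X U) \<and>
     (\<forall>U c. openin (zariski X) U \<longrightarrow> (\<lambda>_. c) \<in> regular X U) \<and>
     (\<forall>U. \<forall>f \<in> regular X U. \<forall>g \<in> regular X U.
        (\<lambda>x. f x + g x) \<in> regular X U \<and> (\<lambda>x. f x * g x) \<in> regular X U) \<and>
     (\<forall>U. \<forall>f \<in> regular X U. \<forall>V. openin (zariski X) V \<and> V \<subseteq> U \<longrightarrow> f \<in> regular X V) \<and>
     (\<forall>U f. openin (zariski X) U \<and>
        (\<forall>x\<in>U. \<exists>V. x \<in> V \<and> V \<subseteq> U \<and> f \<in> regular X V) \<longrightarrow> f \<in> regular X U) \<and>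
     (\<forall>U. \<forall>f \<in> regular X U. (\<lambda>x. inverse (f x)) \<in> regular X {x\<in>U. f x \<noteq> 0})"

definition morphism :: "'a fspace \<Rightarrow> 'b fspace \<Rightarrow> ('a \<Rightarrow> 'b) \<Rightarrow> bool" where
  "morphism X Y \<phi> \<longleftrightarrow> continuous_map (zariski X) (zariski Y) \<phi> \<and>
     (\<forall>U. \<forall>f \<in> regular Y U. (\<lambda>x. f (\<phi> x)) \<in> regular X {x \<in> points X. \<phi> x \<in> U})"

definition isomorphism :: "'a fspace \<Rightarrow> 'b fspace \<Rightarrow> ('a \<Rightarrow> 'b) \<Rightarrow> ('b \<Rightarrow> 'a) \<Rightarrow> bool" where
  "isomorphism X Y \<phi> \<psi> \<longleftrightarrow> morphism X Y \<phi> \<and> morphism Y X \<psi> \<and>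
     (\<forall>x\<in>points X. \<psi> (\<phi> x) = x) \<and> (\<forall>y\<in>points Y. \<phi> (\<psi> y) = y)"

definition isomorphic :: "'a fspace \<Rightarrow> 'b fspace \<Rightarrow> bool" where
  "isomorphic X Y \<longleftrightarrow> (\<exists>\<phi> \<psi>. isomorphism X Y \<phi> \<psi>)"

text \<open>The structure induced on a subset: functions that locally extend to the ambient space.\<close>

definition induced_space :: "'a fspace \<Rightarrow> 'a set \<Rightarrow> 'a fspace" where
  "induced_space X S = \<lparr>
     zariski = subtopology (zariski X) S,
     regular = (\<lambda>U. {f. openin (subtopology (zariski X) S) U \<and>
       (\<forall>x\<in>U. \<exists>V. \<exists>g \<in> regular X V. x \<in> V \<and> (\<forall>y \<in> U \<inter> V. f y = g y))}) \<rparr>"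

text \<open>
  The quotient by an equivalence relation: quotient topology, and as regular functions those
  whose pullback is regular. If the relation is the orbit relation of a group action, then its
  points are the orbits and its regular functions are the invariant regular functions, so this
  is the only candidate for a geometric quotient; the geometric quotient exists as a variety
  iff this space is a variety.
\<close>

definition quotient_space :: "'a fspace \<Rightarrow> ('a \<times> 'a) set \<Rightarrow> 'a set fspace" where
  "quotient_space X R = (let T = topology (\<lambda>U. U \<subseteq> points X // R \<and> openin (zariski X) (\<Union>U)) in \<lparr>
     zariski = T,
     regular = (\<lambda>U. {f. openin T U \<and> (\<lambda>x. f (R `` {x})) \<in> regular X (\<Union>U)}) \<rparr>)"

lemma istopology_quotient:
  assumes "equiv (points X) R"
  shows "istopology (\<lambda>U. U \<subseteq> points X // R \<and> openin (zariski X) (\<Union>U))"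
  unfolding istopology_def
proof (intro conjI allI impI; (elim conjE)?)
  fix S T assume ST: "S \<subseteq> points X // R" "T \<subseteq> points X // R"
    and op: "openin (zariski X) (\<Union>S)" "openin (zariski X) (\<Union>T)"
  have "\<Union>(S \<inter> T) = \<Union>S \<inter> \<Union>T"
    using ST quotient_disj[OF assms] by blast
  then show "openin (zariski X) (\<Union>(S \<inter> T))" using op by auto
next
  fix K assume "\<forall>k\<in>K. k \<subseteq> points X // R \<and> openin (zariski X) (\<Union>k)"
  then have "openin (zariski X) (\<Union>k\<in>K. \<Union>k)" by blast
  moreover have "(\<Union>k\<in>K. \<Union>k) = \<Union>(\<Union>K)" by blast
  ultimately show "openin (zariski X) (\<Union>(\<Union>K))" by simp
qed blast+

text \<open>
  The product in the category of spaces with functions. \<open>tensor_functions I X U\<close> is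
  the image of the tensor product of the rings \<open>regular (X i) (U i)\<close> in the functions
  on the product of the sets \<open>U i\<close>. The nonvanishing loci of these functions form a basis
  of the topology (finer than the product topology), and regular functions are locally
  quotients of two of them.
\<close>

definition tensor_functions ::
    "'i set \<Rightarrow> ('i \<Rightarrow> 'a fspace) \<Rightarrow> ('i \<Rightarrow> 'a set) \<Rightarrow> (('i \<Rightarrow> 'a) \<Rightarrow> complex) set" where
  "tensor_functions I X U = {\<lambda>x. \<Sum>k<m. \<Prod>i\<in>I. g k i (x i) | (m::nat) g.
     \<forall>k<m. \<forall>i\<in>I. g k i \<in> regular (X i) (U i)}"

definition product_space :: "'i set \<Rightarrow> ('i \<Rightarrow> 'a fspace) \<Rightarrow> ('i \<Rightarrow> 'a) fspace" where
  "product_space I X = (let T = topology_generated_by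
      {{x \<in> Pi\<^sub>E I U. t x \<noteq> 0} | U t.
         (\<forall>i\<in>I. openin (zariski (X i)) (U i)) \<and> t \<in> tensor_functions I X U} in \<lparr>
     zariski = T,
     regular = (\<lambda>W. {f. openin T W \<and>
       (\<forall>x\<in>W. \<exists>U. (\<forall>i\<in>I. openin (zariski (X i)) (U i)) \<and> x \<in> Pi\<^sub>E I U \<and>
         (\<exists>s \<in> tensor_functions I X U. \<exists>t \<in> tensor_functions I X U. t x \<noteq> 0 \<and>
           (\<forall>y \<in> W \<inter> Pi\<^sub>E I U. t y \<noteq> 0 \<longrightarrow> f y = s y / t y)))}) \<rparr>)"

section \<open>Affine and projective space\<close>

inductive_set polynomial_functions :: "((nat \<Rightarrow> complex) \<Rightarrow> complex) set" where
  const: "(\<lambda>_. c) \<in> polynomial_functions"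
| coord: "(\<lambda>x. x i) \<in> polynomial_functions"
| add: "p \<in> polynomial_functions \<Longrightarrow> q \<in> polynomial_functions \<Longrightarrow>
    (\<lambda>x. p x + q x) \<in> polynomial_functions"
| mult: "p \<in> polynomial_functions \<Longrightarrow> q \<in> polynomial_functions \<Longrightarrow>
    (\<lambda>x. p x * q x) \<in> polynomial_functions"

text \<open>A vector with \<open>N\<close> coordinates is a sequence that vanishes from index \<open>N\<close> on.\<close>

definition vectors :: "nat \<Rightarrow> (nat \<Rightarrow> complex) set" where
  "vectors N = {x. \<forall>i\<ge>N. x i = 0}"

definition affine_space :: "nat \<Rightarrow> (nat \<Rightarrow> complex) fspace" where
  "affine_space N = (let T = topology_generated_by
      {{x \<in> vectors N. p x \<noteq> 0} | p. p \<in> polynomial_functions} in \<lparr>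
     zariski = T,
     regular = (\<lambda>U. {f. openin T U \<and>
       (\<forall>x\<in>U. \<exists>V. openin T V \<and> x \<in> V \<and> V \<subseteq> U \<and>
         (\<exists>p \<in> polynomial_functions. \<exists>q \<in> polynomial_functions.
            \<forall>y\<in>V. q y \<noteq> 0 \<and> f y = p y / q y))}) \<rparr>)"

text \<open>
  Projective space is the quotient of the punctured affine space by scaling; a point is
  the set of all its vectors of homogeneous coordinates. Pulled back to the punctured affine
  space, its closed sets are the closed cones and its regular functions are the regular
  functions that are homogeneous of degree 0.
\<close>

definition proportional :: "nat \<Rightarrow> ((nat \<Rightarrow> complex) \<times> (nat \<Rightarrow> complex)) set" where
  "proportional N = {(v, w). v \<in> vectors N - {\<lambda>_. 0} \<and> w \<in> vectors N - {\<lambda>_. 0} \<and>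
     (\<exists>c. c \<noteq> 0 \<and> w = (\<lambda>i. c * v i))}"

definition projective_space :: "nat \<Rightarrow> (nat \<Rightarrow> complex) set fspace" where
  "projective_space N = quotient_space
     (induced_space (affine_space (Suc N)) (vectors (Suc N) - {\<lambda>_. 0})) (proportional (Suc N))"

section \<open>Varieties\<close>

definition affine_variety :: "'a fspace \<Rightarrow> bool" where
  "affine_variety X \<longleftrightarrow> (\<exists>N Z. closedin (zariski (affine_space N)) Z \<and>
     isomorphic X (induced_space (affine_space N) Z))"

definition separated :: "'a fspace \<Rightarrow> bool" where
  "separated X \<longleftrightarrow> (let X2 = product_space {0, 1::nat} (\<lambda>_. X) in
     closedin (zariski X2) {x \<in> points X2. x 0 = x 1})"

definition irreducible_in :: "'a topology \<Rightarrow> 'a set \<Rightarrow> bool" where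
  "irreducible_in T S \<longleftrightarrow> S \<noteq> {} \<and> S \<subseteq> topspace T \<and>
     (\<forall>C D. closedin T C \<and> closedin T D \<and> S \<subseteq> C \<union> D \<longrightarrow> S \<subseteq> C \<or> S \<subseteq> D)"

text \<open>Varieties are irreducible, as in Hartshorne.\<close>

definition variety :: "'a fspace \<Rightarrow> bool" where
  "variety X \<longleftrightarrow> space_with_functions X \<and> separated X \<and>
     irreducible_in (zariski X) (points X) \<and>
     (\<exists>\<U>. finite \<U> \<and> \<Union>\<U> = points X \<and>
        (\<forall>U\<in>\<U>. openin (zariski X) U \<and> affine_variety (induced_space X U)))"

definition dimension :: "'a fspace \<Rightarrow> enat" where
  "dimension X = Sup {enat n | n. \<exists>Z::nat \<Rightarrow> 'a set.
     (\<forall>i\<le>n. closedin (zariski X) (Z i) \<and> irreducible_in (zariski X) (Z i)) \<and>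
     (\<forall>i<n. Z i \<subset> Z (Suc i))}"

definition regular_at :: "'a fspace \<Rightarrow> 'a \<Rightarrow> ('a \<Rightarrow> complex) set" where
  "regular_at X x = {f. \<exists>U. x \<in> U \<and> f \<in> regular X U}"

text \<open>
  The Zariski tangent space at \<open>x\<close>: the derivations of the local ring at \<open>x\<close> with values in
  the residue field. A derivation is represented by a function of representatives of germs,
  extended by 0 to functions that are not regular at \<open>x\<close>.
\<close>

definition tangent_space :: "'a fspace \<Rightarrow> 'a \<Rightarrow> (('a \<Rightarrow> complex) \<Rightarrow> complex) set" where
  "tangent_space X x = {D.
     (\<forall>f. f \<notin> regular_at X x \<longrightarrow> D f = 0) \<and>
     (\<forall>f \<in> regular_at X x. \<forall>g \<in> regular_at X x.
        (\<exists>U. openin (zariski X) U \<and> x \<in> U \<and> (\<forall>y\<in>U. f y = g y)) \<longrightarrow> D f = D g) \<and>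
     (\<forall>f \<in> regular_at X x. \<forall>g \<in> regular_at X x. D (\<lambda>y. f y + g y) = D f + D g) \<and>
     (\<forall>c. \<forall>f \<in> regular_at X x. D (\<lambda>y. c * f y) = c * D f) \<and>
     (\<forall>f \<in> regular_at X x. \<forall>g \<in> regular_at X x.
        D (\<lambda>y. f y * g y) = f x * D g + g x * D f)}"

definition tangent_dim :: "'a fspace \<Rightarrow> 'a \<Rightarrow> nat" where
  "tangent_dim X x = vector_space.dim (\<lambda>(c::complex) D f. c * D f) (tangent_space X x)"

text \<open>As varieties are irreducible, the local dimension is the same at all points.\<close>

definition smooth :: "'a fspace \<Rightarrow> bool" where
  "smooth X \<longleftrightarrow> (\<forall>x\<in>points X. enat (tangent_dim X x) = dimension X)"

definition birational :: "'a fspace \<Rightarrow> 'b fspace \<Rightarrow> bool" where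
  "birational X Y \<longleftrightarrow> (\<exists>U V. openin (zariski X) U \<and> U \<noteq> {} \<and> openin (zariski Y) V \<and> V \<noteq> {} \<and>
     isomorphic (induced_space X U) (induced_space Y V))"

definition rational :: "'a fspace \<Rightarrow> bool" where
  "rational X \<longleftrightarrow> (\<exists>N. birational X (projective_space N))"

definition smooth_rational_surface :: "'a fspace \<Rightarrow> bool" where
  "smooth_rational_surface X \<longleftrightarrow> variety X \<and> dimension X = 2 \<and> smooth X \<and> rational X"

section \<open>Quadratic rational maps with a portrait\<close>

definition quadratic_pair :: "(nat \<Rightarrow> complex) \<Rightarrow> (nat \<Rightarrow> complex) \<Rightarrow> nat \<Rightarrow> complex" where
  "quadratic_pair a v = (\<lambda>i.
     if i = 0 then a 0 * (v 0)\<^sup>2 + a 1 * v 0 * v 1 + a 2 * (v 1)\<^sup>2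
     else if i = 1 then a 3 * (v 0)\<^sup>2 + a 4 * v 0 * v 1 + a 5 * (v 1)\<^sup>2
     else 0)"

text \<open>
  The resultant of two binary forms of degree 2 is the determinant of the 4 by 4 Sylvester
  matrix, also when leading coefficients vanish.
\<close>

definition form_resultant :: "(nat \<Rightarrow> complex) \<Rightarrow> complex" where
  "form_resultant a = resultant_sub 2 2 [:a 2, a 1, a 0:] [:a 5, a 4, a 3:]"

definition Rat2 :: "(nat \<Rightarrow> complex) set set" where
  "Rat2 = {q \<in> points (projective_space 5). \<forall>a\<in>q. form_resultant a \<noteq> 0}"

text \<open>
  For \<open>q\<close> in \<open>Rat2\<close> and a point \<open>z\<close> of the projective line, letting both vectors of
  homogeneous coordinates vary gives exactly all homogeneous coordinates of the image.
\<close>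

definition rat_map :: "(nat \<Rightarrow> complex) set \<Rightarrow> (nat \<Rightarrow> complex) set \<Rightarrow> (nat \<Rightarrow> complex) set" where
  "rat_map q z = {quadratic_pair a v | a v. a \<in> q \<and> v \<in> z}"

definition portrait :: "nat \<Rightarrow> (nat \<Rightarrow> nat) \<Rightarrow> bool" where
  "portrait n \<Psi> \<longleftrightarrow> \<Psi> ` {1..n} \<subseteq> {1..n}"

definition disjoint_union_of_cycles :: "nat \<Rightarrow> (nat \<Rightarrow> nat) \<Rightarrow> bool" where
  "disjoint_union_of_cycles n \<Psi> \<longleftrightarrow> bij_betw \<Psi> {1..n} {1..n}"

text \<open>A tuple \<open>(f, p\<^sub>1, \<dots>, p\<^sub>n)\<close> is a function \<open>x\<close> with \<open>x 0 = f\<close> and \<open>x i = p\<^sub>i\<close>;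
  the set of these tuples carries its reduced structure as a locally closed subset.\<close>

definition End_ambient :: "nat \<Rightarrow> (nat \<Rightarrow> (nat \<Rightarrow> complex) set) fspace" where
  "End_ambient n =
     product_space {0..n} (\<lambda>i. if i = 0 then projective_space 5 else projective_space 1)"

definition End_portrait :: "nat \<Rightarrow> (nat \<Rightarrow> nat) \<Rightarrow> (nat \<Rightarrow> (nat \<Rightarrow> complex) set) fspace" where
  "End_portrait n \<Psi> = induced_space (End_ambient n) {x \<in> points (End_ambient n).
     x 0 \<in> Rat2 \<and> (\<forall>i\<in>{1..n}. rat_map (x 0) (x i) = x (\<Psi> i)) \<and> inj_on x {1..n}}"

text \<open>
  \<open>(x, y)\<close> is in the orbit relation iff \<open>y = \<phi> * x\<close> for an automorphism \<open>\<phi>\<close> of the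
  projective line, with inverse \<open>\<psi>\<close>. An element of \<open>Rat2\<close> is determined by its map.
\<close>

definition orbit_relation ::
    "nat \<Rightarrow> (nat \<Rightarrow> nat) \<Rightarrow>
     ((nat \<Rightarrow> (nat \<Rightarrow> complex) set) \<times> (nat \<Rightarrow> (nat \<Rightarrow> complex) set)) set" where
  "orbit_relation n \<Psi> = {(x, y). x \<in> points (End_portrait n \<Psi>) \<and> y \<in> points (End_portrait n \<Psi>) \<and>
     (\<exists>\<phi> \<psi>. isomorphism (projective_space 1) (projective_space 1) \<phi> \<psi> \<and>
        (\<forall>z \<in> points (projective_space 1). rat_map (y 0) z = \<psi> (rat_map (x 0) (\<phi> z))) \<and>
        (\<forall>i\<in>{1..n}. y i = \<psi> (x i)))}"

definition moduli_space :: "nat \<Rightarrow> (nat \<Rightarrow> nat) \<Rightarrow> (nat \<Rightarrow> (nat \<Rightarrow> complex) set) set fspace" where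
  "moduli_space n \<Psi> = quotient_space (End_portrait n \<Psi>) (orbit_relation n \<Psi>)"

end

theory Submission
  imports Defs "HOL-Computational_Algebra.Fundamental_Theorem_Algebra"
begin

text \<open>The moduli space is isomorphic to a principal open subset of the affine plane, the locus
  where one polynomial in two variables does not vanish. Such a subset is empty or a smooth
  rational surface.

  For the isomorphism, use that a unique automorphism of the projective line moves the first three
  marked points to infinity, zero and one. What remains of the marked points is the position \<open>t 4\<close>
  of the fourth and \<open>t 5\<close> of the fifth point. A quadratic map is determined by its values at
  infinity, zero and one as vectors, and the portrait fixes the directions of these vectors; so the
  map is given by three nonzero scalars \<open>l 1\<close>, \<open>l 2\<close>, \<open>l 3\<close> up to a common factor. The condition that
  a further marked point goes where the portrait sends it is one linear equation in these scalars
  with coefficients that do not vanish. For three points the two quotients of the scalars are free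
  parameters. For four points the parameters are \<open>t 4\<close> and \<open>l 2 / l 1\<close>, and the equation gives \<open>l 3\<close>.
  For five points the parameters are \<open>t 4\<close> and \<open>t 5\<close>, and the scalars are the cross product of the
  two equations; the cross product cannot vanish, because a quadratic map is determined by its
  values at five points. Conversely, parameters give a map with marked points as soon as the
  resultant and the brackets of the marked points do not vanish, and the product of these is the
  polynomial in question.

  The lemmas \<open>normal_form\<close> and \<open>normal_form_unique\<close> say that every orbit contains exactly one normal
  form. Uniqueness rests on \<open>automorphism_fixing_three_points\<close>: in the sense of regular functions an
  automorphism that fixes infinity is a polynomial with a polynomial inverse, hence of degree one.
  The parameters are rational functions of homogeneous coordinates, so they are regular on the
  space of maps with marked points; by \<open>isomorphism_moduli_space\<close> they descend to an isomorphism on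
  the quotient.

  The geometry of the principal open subset is collected in \<open>smooth_rational_surface_plane_open\<close>. Its
  dimension is two because a proper inclusion of nonzero prime ideals forces the coordinates to be constant,
  the partial derivatives are a basis of each tangent space, the graph of \<open>1 / h\<close> shows that it is
  affine, and the standard chart embeds it in the projective plane.\<close>

section \<open>The category of spaces with functions\<close>

lemma
  assumes "space_with_functions X"
  shows regular_open: "f \<in> regular X U \<Longrightarrow> openin (zariski X) U"
    and regular_cong: "f \<in> regular X U \<Longrightarrow> (\<And>x. x \<in> U \<Longrightarrow> g x = f x) \<Longrightarrow> g \<in> regular X U"
    and regular_const: "openin (zariski X) U \<Longrightarrow> (\<lambda>_. c) \<in> regular X U"
    and regular_add: "f \<in> regular X U \<Longrightarrow> g \<in> regular X U \<Longrightarrow> (\<lambda>x. f x + g x) \<in> regular X U"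
    and regular_mult: "f \<in> regular X U \<Longrightarrow> g \<in> regular X U \<Longrightarrow> (\<lambda>x. f x * g x) \<in> regular X U"
    and regular_restrict: "f \<in> regular X U \<Longrightarrow> openin (zariski X) V \<Longrightarrow> V \<subseteq> U \<Longrightarrow> f \<in> regular X V"
    and regular_local: "openin (zariski X) U \<Longrightarrow>
      (\<And>x. x \<in> U \<Longrightarrow> \<exists>V. x \<in> V \<and> V \<subseteq> U \<and> f \<in> regular X V) \<Longrightarrow> f \<in> regular X U"
    and regular_inverse: "f \<in> regular X U \<Longrightarrow> (\<lambda>x. inverse (f x)) \<in> regular X {x\<in>U. f x \<noteq> 0}"
proof -
  note ax = assms[unfolded space_with_functions_def]
  show "f \<in> regular X U \<Longrightarrow> openin (zariski X) U"
    using ax[THEN conjunct1] by blast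
  note ax = ax[THEN conjunct2]
  show "f \<in> regular X U \<Longrightarrow> (\<And>x. x \<in> U \<Longrightarrow> g x = f x) \<Longrightarrow> g \<in> regular X U"
    using ax[THEN conjunct1] by simp
  note ax = ax[THEN conjunct2]
  show "openin (zariski X) U \<Longrightarrow> (\<lambda>_. c) \<in> regular X U"
    using ax[THEN conjunct1] by simp
  note ax = ax[THEN conjunct2]
  show "f \<in> regular X U \<Longrightarrow> g \<in> regular X U \<Longrightarrow> (\<lambda>x. f x + g x) \<in> regular X U"
    and "f \<in> regular X U \<Longrightarrow> g \<in> regular X U \<Longrightarrow> (\<lambda>x. f x * g x) \<in> regular X U"
    using ax[THEN conjunct1] by simp_all
  note ax = ax[THEN conjunct2]
  show "f \<in> regular X U \<Longrightarrow> openin (zariski X) V \<Longrightarrow> V \<subseteq> U \<Longrightarrow> f \<in> regular X V"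
    using ax[THEN conjunct1] by simp
  note ax = ax[THEN conjunct2]
  show "openin (zariski X) U \<Longrightarrow>
      (\<And>x. x \<in> U \<Longrightarrow> \<exists>V. x \<in> V \<and> V \<subseteq> U \<and> f \<in> regular X V) \<Longrightarrow> f \<in> regular X U"
    using ax[THEN conjunct1] by simp
  note ax = ax[THEN conjunct2]
  show "f \<in> regular X U \<Longrightarrow> (\<lambda>x. inverse (f x)) \<in> regular X {x\<in>U. f x \<noteq> 0}"
    using ax by simp
qed

lemma regular_subset:
  "space_with_functions X \<Longrightarrow> f \<in> regular X U \<Longrightarrow> U \<subseteq> points X"
  using regular_open openin_subset by blast

lemma space_with_functionsI:
  assumes "\<And>U f. f \<in> regular X U \<Longrightarrow> openin (zariski X) U"
    and "\<And>U f g. f \<in> regular X U \<Longrightarrow> (\<And>x. x \<in> U \<Longrightarrow> g x = f x) \<Longrightarrow> g \<in> regular X U"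
    and "\<And>U c. openin (zariski X) U \<Longrightarrow> (\<lambda>_. c) \<in> regular X U"
    and "\<And>U f g. f \<in> regular X U \<Longrightarrow> g \<in> regular X U \<Longrightarrow> (\<lambda>x. f x + g x) \<in> regular X U"
    and "\<And>U f g. f \<in> regular X U \<Longrightarrow> g \<in> regular X U \<Longrightarrow> (\<lambda>x. f x * g x) \<in> regular X U"
    and "\<And>U V f. f \<in> regular X U \<Longrightarrow> openin (zariski X) V \<Longrightarrow> V \<subseteq> U \<Longrightarrow> f \<in> regular X V"
    and "\<And>U f. openin (zariski X) U \<Longrightarrow>
        (\<And>x. x\<in>U \<Longrightarrow> \<exists>V. x \<in> V \<and> V \<subseteq> U \<and> f \<in> regular X V) \<Longrightarrow> f \<in> regular X U"
    and "\<And>U f. f \<in> regular X U \<Longrightarrow> (\<lambda>x. inverse (f x)) \<in> regular X {x\<in>U. f x \<noteq> 0}"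
  shows "space_with_functions X"
  unfolding space_with_functions_def
  by (intro conjI allI ballI impI; (elim conjE)?) (rule assms; simp)+

lemma regular_nonzero_open:
  "space_with_functions X \<Longrightarrow> f \<in> regular X U \<Longrightarrow> openin (zariski X) {x\<in>U. f x \<noteq> 0}"
  using regular_inverse regular_open by blast

lemma regular_uminus:
  assumes "space_with_functions X" "f \<in> regular X U" shows "(\<lambda>x. - f x) \<in> regular X U"
  using regular_mult[OF assms(1) regular_const[OF assms(1) regular_open[OF assms], of "-1"] assms(2)]
  by simp

lemma regular_diff:
  assumes "space_with_functions X" "f \<in> regular X U" "g \<in> regular X U"
  shows "(\<lambda>x. f x - g x) \<in> regular X U"
  using regular_add[OF assms(1,2) regular_uminus[OF assms(1,3)]] by simp

lemma regular_divide:
  assumes "space_with_functions X" "f \<in> regular X U" "g \<in> regular X U" "\<And>x. x \<in> U \<Longrightarrow> g x \<noteq> 0"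
  shows "(\<lambda>x. f x / g x) \<in> regular X U"
proof -
  have "{x \<in> U. g x \<noteq> 0} = U" using assms(4) by blast
  then show ?thesis
    using regular_mult[OF assms(1,2)] regular_inverse[OF assms(1,3)] by (simp add: divide_inverse)
qed

lemma regular_power:
  assumes "space_with_functions X" "f \<in> regular X U" shows "(\<lambda>x. f x ^ n) \<in> regular X U"
proof (induction n)
  case 0 show ?case using regular_const[OF assms(1) regular_open[OF assms]] by simp
next
  case (Suc n) then show ?case using regular_mult[OF assms] by simp
qed

lemma regular_sum:
  assumes "space_with_functions X" "openin (zariski X) U" "\<And>k. k \<in> K \<Longrightarrow> f k \<in> regular X U"
  shows "(\<lambda>x. \<Sum>k\<in>K. f k x) \<in> regular X U"
  using assms(3)
  by (induction K rule: infinite_finite_induct)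
     (simp_all add: regular_const[OF assms(1,2)] regular_add[OF assms(1)])

lemma regular_prod:
  assumes "space_with_functions X" "openin (zariski X) U" "\<And>k. k \<in> K \<Longrightarrow> f k \<in> regular X U"
  shows "(\<lambda>x. \<Prod>k\<in>K. f k x) \<in> regular X U"
  using assms(3)
  by (induction K rule: infinite_finite_induct)
     (simp_all add: regular_const[OF assms(1,2)] regular_mult[OF assms(1)])

lemma regular_polynomial:
  assumes "space_with_functions X" "openin (zariski X) U" "p \<in> polynomial_functions"
    and "\<And>i. (\<lambda>x. u x i) \<in> regular X U"
  shows "(\<lambda>x. p (u x)) \<in> regular X U"
  using assms(3) 
  by induction (simp_all add: regular_const[OF assms(1,2)] regular_add[OF assms(1)]
      regular_mult[OF assms(1)] assms(4))

subsection \<open>Morphisms\<close>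

lemma morphism_maps: "morphism X Y f \<Longrightarrow> x \<in> points X \<Longrightarrow> f x \<in> points Y"
  by (auto simp: morphism_def continuous_map_def Pi_iff)

lemma morphism_preimage_open:
  "morphism X Y f \<Longrightarrow> openin (zariski Y) U \<Longrightarrow> openin (zariski X) {x \<in> points X. f x \<in> U}"
  by (simp add: morphism_def continuous_map_def)

lemma morphism_pullback:
  "morphism X Y f \<Longrightarrow> g \<in> regular Y U \<Longrightarrow> (\<lambda>x. g (f x)) \<in> regular X {x \<in> points X. f x \<in> U}"
  unfolding morphism_def by (drule conjunct2, drule spec, drule bspec, assumption)

lemma morphismI:
  assumes "\<And>x. x \<in> points X \<Longrightarrow> f x \<in> points Y"
    and "\<And>U. openin (zariski Y) U \<Longrightarrow> openin (zariski X) {x \<in> points X. f x \<in> U}"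
    and "\<And>U g. g \<in> regular Y U \<Longrightarrow> (\<lambda>x. g (f x)) \<in> regular X {x \<in> points X. f x \<in> U}"
  shows "morphism X Y f"
  unfolding morphism_def continuous_map_def
  by (intro conjI allI ballI impI Pi_I) (rule assms, assumption)+

lemma morphism_id: "morphism X X (\<lambda>x. x)" if "space_with_functions X"
proof (rule morphismI)
  fix U assume U: "openin (zariski X) U"
  have *: "{x \<in> points X. x \<in> U} = U" using openin_subset[OF U] by blast
  show "openin (zariski X) {x \<in> points X. x \<in> U}" unfolding * by (rule U)
next
  fix U g assume g: "g \<in> regular X U"
  have *: "{x \<in> points X. x \<in> U} = U" using openin_subset[OF regular_open[OF that g]] by blast
  show "(\<lambda>x. g x) \<in> regular X {x \<in> points X. x \<in> U}" unfolding * by (rule g)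
qed

lemma morphism_compose:
  assumes f: "morphism X Y f" and g: "morphism Y Z g"
  shows "morphism X Z (\<lambda>x. g (f x))"
proof (rule morphismI)
  show "g (f x) \<in> points Z" if "x \<in> points X" for x
    by (intro morphism_maps[OF g] morphism_maps[OF f] that)
  have *: "{x \<in> points X. f x \<in> {y \<in> points Y. g y \<in> U}} = {x \<in> points X. g (f x) \<in> U}" for U
    using morphism_maps[OF f] by blast
  show "openin (zariski X) {x \<in> points X. g (f x) \<in> U}" if "openin (zariski Z) U" for U
    using morphism_preimage_open[OF f morphism_preimage_open[OF g that]] by (simp only: *)
  show "(\<lambda>x. k (g (f x))) \<in> regular X {x \<in> points X. g (f x) \<in> U}" if "k \<in> regular Z U" for U k
    using morphism_pullback[OF f morphism_pullback[OF g that]] by (simp only: *)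
qed

lemma isomorphism_sym: "isomorphism X Y f g \<Longrightarrow> isomorphism Y X g f"
  unfolding isomorphism_def by blast

lemma isomorphismD:
  assumes "isomorphism X Y f g"
  shows "morphism X Y f" "morphism Y X g"
    and "x \<in> points X \<Longrightarrow> g (f x) = x" "y \<in> points Y \<Longrightarrow> f (g y) = y"
  using assms by (simp_all add: isomorphism_def)

lemma isomorphism_compose:
  assumes 1: "isomorphism X Y f g" and 2: "isomorphism Y Z f' g'"
  shows "isomorphism X Z (\<lambda>x. f' (f x)) (\<lambda>z. g (g' z))"
  unfolding isomorphism_def
proof (intro conjI ballI)
  show "morphism X Z (\<lambda>x. f' (f x))"
    by (rule morphism_compose[OF isomorphismD(1)[OF 1] isomorphismD(1)[OF 2]])
  show "morphism Z X (\<lambda>z. g (g' z))"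
    by (rule morphism_compose[OF isomorphismD(2)[OF 2] isomorphismD(2)[OF 1]])
  show "g (g' (f' (f x))) = x" if "x \<in> points X" for x
    using isomorphismD(3)[OF 2 morphism_maps[OF isomorphismD(1)[OF 1] that]]
      isomorphismD(3)[OF 1 that] by simp
  show "f' (f (g (g' z))) = z" if "z \<in> points Z" for z
    using isomorphismD(4)[OF 1 morphism_maps[OF isomorphismD(2)[OF 2] that]]
      isomorphismD(4)[OF 2 that] by simp
qed

lemma isomorphism_id: "space_with_functions X \<Longrightarrow> isomorphism X X (\<lambda>x. x) (\<lambda>x. x)"
  unfolding isomorphism_def using morphism_id by auto

subsection \<open>Subspaces\<close>

lemma points_induced_space [simp]: "points (induced_space X S) = points X \<inter> S"
  by (simp add: induced_space_def)

lemma zariski_induced_space: "zariski (induced_space X S) = subtopology (zariski X) S"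
  by (simp add: induced_space_def)

lemma regular_induced_space:
  "f \<in> regular (induced_space X S) U \<longleftrightarrow> openin (subtopology (zariski X) S) U \<and>
     (\<forall>x\<in>U. \<exists>V. \<exists>g \<in> regular X V. x \<in> V \<and> (\<forall>y \<in> U \<inter> V. f y = g y))"
  by (simp add: induced_space_def)

lemma regular_induced_spaceD:
  assumes "f \<in> regular (induced_space X S) U" "x \<in> U"
  shows "\<exists>V g. g \<in> regular X V \<and> x \<in> V \<and> (\<forall>y. y \<in> U \<and> y \<in> V \<longrightarrow> f y = g y)"
proof -
  obtain V where "\<exists>g\<in>regular X V. x \<in> V \<and> (\<forall>y\<in>U \<inter> V. f y = g y)"
    using assms(1)[unfolded regular_induced_space, THEN conjunct2, THEN bspec[OF _ assms(2)]] ..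
  then obtain g where "g \<in> regular X V" "x \<in> V" "\<forall>y\<in>U \<inter> V. f y = g y" by (elim bexE conjE) (rule that)
  then show ?thesis by (intro exI[of _ V] exI[of _ g]) simp
qed

lemma regular_induced_spaceI:
  assumes "openin (subtopology (zariski X) S) U"
    and "\<And>x. x \<in> U \<Longrightarrow> \<exists>V g. g \<in> regular X V \<and> x \<in> V \<and> (\<forall>y. y \<in> U \<and> y \<in> V \<longrightarrow> f y = g y)"
  shows "f \<in> regular (induced_space X S) U"
  unfolding regular_induced_space
proof (rule conjI[OF assms(1)], rule ballI)
  fix x assume "x \<in> U"
  then obtain V g where "g \<in> regular X V" "x \<in> V" "\<forall>y. y \<in> U \<and> y \<in> V \<longrightarrow> f y = g y"
    using assms(2) by blast
  then show "\<exists>V. \<exists>g\<in>regular X V. x \<in> V \<and> (\<forall>y\<in>U \<inter> V. f y = g y)"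
    by (intro exI[of _ V] bexI[of _ g]) simp_all
qed

lemma regular_induced_open:
  "f \<in> regular (induced_space X S) U \<Longrightarrow> openin (subtopology (zariski X) S) U"
  unfolding regular_induced_space by (rule conjunct1)

text \<open>The operations on a function that extends locally are carried out on its local extensions,
  after shrinking two neighbourhoods to a common one.\<close>

lemma space_with_functions_induced:
  assumes X: "space_with_functions X"
  shows "space_with_functions (induced_space X S)"
proof (rule space_with_functionsI)
  let ?Y = "induced_space X S"
  have binop: "(\<lambda>x. b (f x) (g x)) \<in> regular ?Y U"
    if f: "f \<in> regular ?Y U" and g: "g \<in> regular ?Y U"
      and b: "\<And>V f g. f \<in> regular X V \<Longrightarrow> g \<in> regular X V \<Longrightarrow> (\<lambda>x. b (f x) (g x)) \<in> regular X V"
    for f g U and b :: "complex \<Rightarrow> complex \<Rightarrow> complex"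
  proof (rule regular_induced_spaceI[OF regular_induced_open[OF f]])
    fix x assume x: "x \<in> U"
    obtain V f' where V: "f' \<in> regular X V" "x \<in> V" "\<forall>y. y \<in> U \<and> y \<in> V \<longrightarrow> f y = f' y"
      using regular_induced_spaceD[OF f x] by (elim exE conjE) (rule that)
    obtain W g' where W: "g' \<in> regular X W" "x \<in> W" "\<forall>y. y \<in> U \<and> y \<in> W \<longrightarrow> g y = g' y"
      using regular_induced_spaceD[OF g x] by (elim exE conjE) (rule that)
    have o: "openin (zariski X) (V \<inter> W)"
      using regular_open[OF X V(1)] regular_open[OF X W(1)] by (rule openin_Int)
    have "(\<lambda>x. b (f' x) (g' x)) \<in> regular X (V \<inter> W)"
      by (rule b[OF regular_restrict[OF X V(1) o] regular_restrict[OF X W(1) o]]) simp_all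
    then show "\<exists>V g'. g' \<in> regular X V \<and> x \<in> V \<and> (\<forall>y. y \<in> U \<and> y \<in> V \<longrightarrow> b (f y) (g y) = g' y)"
      using V W by (intro exI[of _ "V \<inter> W"] exI[of _ "\<lambda>x. b (f' x) (g' x)"]) simp
  qed
  show "openin (zariski ?Y) U" if "f \<in> regular ?Y U" for U f
    unfolding zariski_induced_space by (rule regular_induced_open[OF that])
  show "g \<in> regular ?Y U" if f: "f \<in> regular ?Y U" and eq: "\<And>x. x \<in> U \<Longrightarrow> g x = f x" for U f g
  proof (rule regular_induced_spaceI[OF regular_induced_open[OF f]])
    fix x assume x: "x \<in> U"
    obtain V f' where V: "f' \<in> regular X V" "x \<in> V" "\<forall>y. y \<in> U \<and> y \<in> V \<longrightarrow> f y = f' y"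
      using regular_induced_spaceD[OF f x] by (elim exE conjE) (rule that)
    then show "\<exists>V g'. g' \<in> regular X V \<and> x \<in> V \<and> (\<forall>y. y \<in> U \<and> y \<in> V \<longrightarrow> g y = g' y)"
      using eq by (intro exI[of _ V] exI[of _ f']) simp
  qed
  show "(\<lambda>_. c) \<in> regular ?Y U" if U: "openin (zariski ?Y) U" for U c
  proof (rule regular_induced_spaceI)
    show "openin (subtopology (zariski X) S) U" using U unfolding zariski_induced_space .
    fix x assume "x \<in> U"
    then have "x \<in> points X" using openin_subset[OF U] by auto
    then show "\<exists>V g'. g' \<in> regular X V \<and> x \<in> V \<and> (\<forall>y. y \<in> U \<and> y \<in> V \<longrightarrow> c = g' y)"
      using regular_const[OF X openin_topspace] by (intro exI[of _ "points X"] exI[of _ "\<lambda>_. c"]) simp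
  qed
  show "(\<lambda>x. f x + g x) \<in> regular ?Y U" if "f \<in> regular ?Y U" "g \<in> regular ?Y U" for U f g
    by (rule binop[where b="(+)", OF that]) (rule regular_add[OF X])
  show "(\<lambda>x. f x * g x) \<in> regular ?Y U" if "f \<in> regular ?Y U" "g \<in> regular ?Y U" for U f g
    by (rule binop[where b="(*)", OF that]) (rule regular_mult[OF X])
  show "f \<in> regular ?Y V" if f: "f \<in> regular ?Y U" and V: "openin (zariski ?Y) V" "V \<subseteq> U" for U V f
  proof (rule regular_induced_spaceI)
    show "openin (subtopology (zariski X) S) V" using V(1) unfolding zariski_induced_space .
    fix x assume "x \<in> V"
    then have x: "x \<in> U" using V(2) by blast
    obtain W f' where W: "f' \<in> regular X W" "x \<in> W" "\<forall>y. y \<in> U \<and> y \<in> W \<longrightarrow> f y = f' y"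
      using regular_induced_spaceD[OF f x] by (elim exE conjE) (rule that)
    then show "\<exists>W g'. g' \<in> regular X W \<and> x \<in> W \<and> (\<forall>y. y \<in> V \<and> y \<in> W \<longrightarrow> f y = g' y)"
      using V(2) by (intro exI[of _ W] exI[of _ f']) auto
  qed
  show "f \<in> regular ?Y U" if U: "openin (zariski ?Y) U"
    and loc: "\<And>x. x \<in> U \<Longrightarrow> \<exists>V. x \<in> V \<and> V \<subseteq> U \<and> f \<in> regular ?Y V" for U f
  proof (rule regular_induced_spaceI)
    show "openin (subtopology (zariski X) S) U" using U unfolding zariski_induced_space .
    fix x assume x: "x \<in> U"
    obtain V where V: "x \<in> V" "V \<subseteq> U" "f \<in> regular ?Y V" using loc[OF x] by blast
    obtain W g where W: "g \<in> regular X W" "x \<in> W" "\<forall>y. y \<in> V \<and> y \<in> W \<longrightarrow> f y = g y"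
      using regular_induced_spaceD[OF V(3,1)] by (elim exE conjE) (rule that)
    obtain T where T: "openin (zariski X) T" "V = T \<inter> S"
      using regular_induced_open[OF V(3)] unfolding openin_subtopology by blast
    have o: "openin (zariski X) (W \<inter> T)" using regular_open[OF X W(1)] T(1) by (rule openin_Int)
    have US: "U \<subseteq> S" using openin_subset[OF U] by simp
    have "g \<in> regular X (W \<inter> T)" by (rule regular_restrict[OF X W(1) o]) simp
    then show "\<exists>V g'. g' \<in> regular X V \<and> x \<in> V \<and> (\<forall>y. y \<in> U \<and> y \<in> V \<longrightarrow> f y = g' y)"
      using W T V(1) US by (intro exI[of _ "W \<inter> T"] exI[of _ g]) auto
  qed
  show "(\<lambda>x. inverse (f x)) \<in> regular ?Y {x \<in> U. f x \<noteq> 0}" if f: "f \<in> regular ?Y U" for U f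
  proof (rule regular_induced_spaceI)
    have key: "\<exists>V g. g \<in> regular X V \<and> x \<in> V \<and> (\<forall>y\<in>V. g y \<noteq> 0) \<and> (\<forall>y. y \<in> U \<and> y \<in> V \<longrightarrow> f y = g y)"
      if x: "x \<in> U" "f x \<noteq> 0" for x
    proof -
      obtain V g where V: "g \<in> regular X V" "x \<in> V" "\<forall>y. y \<in> U \<and> y \<in> V \<longrightarrow> f y = g y"
        using regular_induced_spaceD[OF f x(1)] by (elim exE conjE) (rule that)
      have "g \<in> regular X {y\<in>V. g y \<noteq> 0}"
        by (rule regular_restrict[OF X V(1) regular_nonzero_open[OF X V(1)]]) simp
      then show ?thesis using V x by (intro exI[of _ "{y\<in>V. g y \<noteq> 0}"] exI[of _ g]) simp
    qed
    note U = regular_induced_open[OF f]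
    have "\<exists>T. openin (subtopology (zariski X) S) T \<and> x \<in> T \<and> T \<subseteq> {x \<in> U. f x \<noteq> 0}"
      if x: "x \<in> {x \<in> U. f x \<noteq> 0}" for x
    proof -
      obtain V g where V: "g \<in> regular X V" "x \<in> V" "\<forall>y\<in>V. g y \<noteq> 0" "\<forall>y. y \<in> U \<and> y \<in> V \<longrightarrow> f y = g y"
        using key x by blast
      have "openin (subtopology (zariski X) S) (U \<inter> (V \<inter> S))"
        using U regular_open[OF X V(1)] by (intro openin_Int openin_subtopology_Int)
      moreover have "x \<in> S" using x openin_subset[OF U] by auto
      ultimately show ?thesis using V x by (intro exI[of _ "U \<inter> (V \<inter> S)"]) auto
    qed
    then show "openin (subtopology (zariski X) S) {x \<in> U. f x \<noteq> 0}"
      by (subst openin_subopen) simp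
    fix x assume "x \<in> {x \<in> U. f x \<noteq> 0}"
    then obtain V g where V: "g \<in> regular X V" "x \<in> V" "\<forall>y\<in>V. g y \<noteq> 0" "\<forall>y. y \<in> U \<and> y \<in> V \<longrightarrow> f y = g y"
      using key by blast
    have "{y \<in> V. g y \<noteq> 0} = V" using V(3) by blast
    then have "(\<lambda>x. inverse (g x)) \<in> regular X V" using regular_inverse[OF X V(1)] by simp
    then show "\<exists>V g'. g' \<in> regular X V \<and> x \<in> V \<and>
        (\<forall>y. y \<in> {x \<in> U. f x \<noteq> 0} \<and> y \<in> V \<longrightarrow> inverse (f y) = g' y)"
      using V by (intro exI[of _ V] exI[of _ "\<lambda>x. inverse (g x)"]) simp
  qed
qed

lemma morphism_inclusion:
  assumes X: "space_with_functions X" shows "morphism (induced_space X S) X (\<lambda>x. x)"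
proof (rule morphismI)
  have o: "openin (subtopology (zariski X) S) {x \<in> points (induced_space X S). x \<in> U}"
    if "openin (zariski X) U" for U
  proof -
    have "{x \<in> points (induced_space X S). x \<in> U} = U \<inter> S"
      using openin_subset[OF that] by auto
    then show ?thesis using that by (auto simp: openin_subtopology)
  qed
  then show "openin (zariski (induced_space X S)) {x \<in> points (induced_space X S). x \<in> U}"
    if "openin (zariski X) U" for U using that by (simp add: zariski_induced_space)
  show "(\<lambda>x. g x) \<in> regular (induced_space X S) {x \<in> points (induced_space X S). x \<in> U}"
    if "g \<in> regular X U" for U g
    by (rule regular_induced_spaceI[OF o[OF regular_open[OF X that]]])
       (intro exI[of _ U] exI[of _ g], simp add: that)
qed simp

lemma morphism_into_induced_space:
  assumes Z: "space_with_functions Z" and f: "morphism Z X f" and S: "\<And>z. z \<in> points Z \<Longrightarrow> f z \<in> S"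
  shows "morphism Z (induced_space X S) f"
proof (rule morphismI)
  show "f z \<in> points (induced_space X S)" if "z \<in> points Z" for z
    using that S morphism_maps[OF f] by simp
  show o: "openin (zariski Z) {z \<in> points Z. f z \<in> U}" if U: "openin (zariski (induced_space X S)) U" for U
  proof -
    obtain T where T: "openin (zariski X) T" "U = T \<inter> S"
      using U unfolding zariski_induced_space openin_subtopology by blast
    have "{z \<in> points Z. f z \<in> U} = {z \<in> points Z. f z \<in> T}" using T S by auto
    then show ?thesis using morphism_preimage_open[OF f T(1)] by simp
  qed
  show "(\<lambda>z. g (f z)) \<in> regular Z {z \<in> points Z. f z \<in> U}" if g: "g \<in> regular (induced_space X S) U" for U g
  proof (rule regular_local[OF Z])
    have "openin (zariski (induced_space X S)) U"
      using regular_induced_open[OF g] by (simp add: zariski_induced_space)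
    then show oU: "openin (zariski Z) {z \<in> points Z. f z \<in> U}" by (rule o)
    fix z assume z: "z \<in> {z \<in> points Z. f z \<in> U}"
    then have fz: "f z \<in> U" by simp
    obtain V k where V: "k \<in> regular X V" "f z \<in> V" "\<forall>y. y \<in> U \<and> y \<in> V \<longrightarrow> g y = k y"
      using regular_induced_spaceD[OF g fz] by (elim exE conjE) (rule that)
    let ?W = "{z \<in> points Z. f z \<in> U} \<inter> {z \<in> points Z. f z \<in> V}"
    have k: "(\<lambda>z. k (f z)) \<in> regular Z {z \<in> points Z. f z \<in> V}" by (rule morphism_pullback[OF f V(1)])
    have oW: "openin (zariski Z) ?W" using oU regular_open[OF Z k] by (rule openin_Int)
    have "(\<lambda>z. k (f z)) \<in> regular Z ?W" by (rule regular_restrict[OF Z k oW Int_lower2])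
    then have gW: "(\<lambda>z. g (f z)) \<in> regular Z ?W"
    proof (rule regular_cong[OF Z])
      fix x assume "x \<in> ?W"
      then have "f x \<in> U \<and> f x \<in> V" by simp
      then show "g (f x) = k (f x)" by (rule V(3)[rule_format])
    qed
    have zW: "z \<in> ?W" using z V(2) by simp
    show "\<exists>W. z \<in> W \<and> W \<subseteq> {z \<in> points Z. f z \<in> U} \<and> (\<lambda>z. g (f z)) \<in> regular Z W"
      by (intro exI[of _ ?W] conjI zW Int_lower1 gW)
  qed
qed

text \<open>Affine charts and birational maps are defined on subspaces; this compares a space with the
  subspace of all of its points, so that the whole space can serve as a chart.\<close>

lemma isomorphism_induced_points:
  assumes "space_with_functions X"
  shows "isomorphism (induced_space X (points X)) X (\<lambda>x. x) (\<lambda>x. x)"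
  unfolding isomorphism_def
  by (intro conjI morphism_inclusion[OF assms] ballI refl
      morphism_into_induced_space[OF assms morphism_id[OF assms]])

lemma regular_induced_points:
  assumes "space_with_functions X" "f \<in> regular X (points X)"
  shows "f \<in> regular (induced_space X S) (points (induced_space X S))"
proof -
  have "{x \<in> points (induced_space X S). x \<in> points X} = points (induced_space X S)" by auto
  then show ?thesis using morphism_pullback[OF morphism_inclusion[OF assms(1)] assms(2), of S] by simp
qed

subsection \<open>Quotients\<close>

lemma openin_quotient_space:
  assumes "equiv (points X) R"
  shows "openin (zariski (quotient_space X R)) U \<longleftrightarrow>
    U \<subseteq> points X // R \<and> openin (zariski X) (\<Union>U)"
  using istopology_quotient[OF assms] by (simp add: quotient_space_def Let_def topology_inverse')

lemma points_quotient_space: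
  assumes "equiv (points X) R"
  shows "points (quotient_space X R) = points X // R"
proof -
  have "openin (zariski (quotient_space X R)) (points X // R)"
    using Union_quotient[OF assms] by (simp add: openin_quotient_space[OF assms])
  moreover have "U \<subseteq> points X // R" if "openin (zariski (quotient_space X R)) U" for U
    using that openin_quotient_space[OF assms] by blast
  ultimately show ?thesis by (meson openin_subset openin_topspace subset_antisym)
qed

lemma regular_quotient_space:
  "f \<in> regular (quotient_space X R) U \<longleftrightarrow>
    openin (zariski (quotient_space X R)) U \<and> (\<lambda>x. f (R `` {x})) \<in> regular X (\<Union>U)"
  by (simp add: quotient_space_def Let_def)

lemma preimage_quotient_map:
  assumes "equiv A R" "U \<subseteq> A // R"
  shows "{x \<in> A. R `` {x} \<in> U} = \<Union>U"
proof (rule equalityI; rule subsetI)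
  fix x assume "x \<in> \<Union>U"
  then obtain C where C: "C \<in> U" "x \<in> C" by blast
  then obtain y where y: "y \<in> A" "C = R `` {y}" using assms(2) by (meson quotientE subsetD)
  have "(y, x) \<in> R" using C y by simp
  then have "R `` {x} = C" "x \<in> A"
    using y equiv_class_eq_iff[OF assms(1), of y x] by simp_all
  then show "x \<in> {x \<in> A. R `` {x} \<in> U}" using C by simp
next
  fix x assume "x \<in> {x \<in> A. R `` {x} \<in> U}"
  then show "x \<in> \<Union>U" using equiv_class_self[OF assms(1)] by blast
qed

lemma regular_quotient_spaceD:
  assumes "f \<in> regular (quotient_space X R) U"
  shows "openin (zariski (quotient_space X R)) U" "(\<lambda>x. f (R `` {x})) \<in> regular X (\<Union>U)"
  using conjunct1[OF assms[unfolded regular_quotient_space]]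
    conjunct2[OF assms[unfolded regular_quotient_space]] .

lemma space_with_functions_quotient:
  assumes X: "space_with_functions X" and R: "equiv (points X) R"
  shows "space_with_functions (quotient_space X R)"
proof (rule space_with_functionsI)
  let ?Q = "quotient_space X R"
  have sub: "U \<subseteq> points X // R" and Un: "openin (zariski X) (\<Union>U)" if "openin (zariski ?Q) U" for U
    using that openin_quotient_space[OF R] by blast+
  have cls: "R `` {x} \<in> U" if "openin (zariski ?Q) U" "x \<in> \<Union>U" for x U
    using preimage_quotient_map[OF R sub[OF that(1)]] that(2) by blast
  note op = regular_quotient_spaceD(1) and pull = regular_quotient_spaceD(2)
  show "openin (zariski ?Q) U" if "f \<in> regular ?Q U" for U f
    by (rule op[OF that])
  show "g \<in> regular ?Q U" if f: "f \<in> regular ?Q U" and "\<And>x. x \<in> U \<Longrightarrow> g x = f x" for U f g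
    unfolding regular_quotient_space
    by (rule conjI[OF op[OF f] regular_cong[OF X pull[OF f]]]) (use that cls[OF op[OF f]] in simp)
  show "(\<lambda>_. c) \<in> regular ?Q U" if "openin (zariski ?Q) U" for U c
    unfolding regular_quotient_space by (rule conjI[OF that regular_const[OF X Un[OF that]]])
  show "(\<lambda>x. f x + g x) \<in> regular ?Q U" if "f \<in> regular ?Q U" "g \<in> regular ?Q U" for U f g
    unfolding regular_quotient_space
    by (rule conjI[OF op[OF that(1)] regular_add[OF X pull[OF that(1)] pull[OF that(2)]]])
  show "(\<lambda>x. f x * g x) \<in> regular ?Q U" if "f \<in> regular ?Q U" "g \<in> regular ?Q U" for U f g
    unfolding regular_quotient_space
    by (rule conjI[OF op[OF that(1)] regular_mult[OF X pull[OF that(1)] pull[OF that(2)]]])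
  show "f \<in> regular ?Q V" if "f \<in> regular ?Q U" "openin (zariski ?Q) V" "V \<subseteq> U" for U V f
    unfolding regular_quotient_space
    by (rule conjI[OF that(2) regular_restrict[OF X pull[OF that(1)] Un[OF that(2)]]])
       (use that(3) in blast)
  show "f \<in> regular ?Q U" if U: "openin (zariski ?Q) U"
    and loc: "\<And>x. x \<in> U \<Longrightarrow> \<exists>V. x \<in> V \<and> V \<subseteq> U \<and> f \<in> regular ?Q V" for U f
    unfolding regular_quotient_space
  proof (rule conjI[OF U regular_local[OF X Un[OF U]]])
    fix x assume "x \<in> \<Union>U"
    then obtain C where C: "x \<in> C" "C \<in> U" by blast
    obtain V where V: "C \<in> V" "V \<subseteq> U" "f \<in> regular ?Q V" using loc[OF C(2)] by (elim exE conjE) (rule that)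
    have "x \<in> \<Union>V" "\<Union>V \<subseteq> \<Union>U" using C V(1,2) by blast+
    then show "\<exists>V. x \<in> V \<and> V \<subseteq> \<Union>U \<and> (\<lambda>x. f (R `` {x})) \<in> regular X V"
      by (intro exI[of _ "\<Union>V"] conjI pull[OF V(3)])
  qed
  show "(\<lambda>x. inverse (f x)) \<in> regular ?Q {x \<in> U. f x \<noteq> 0}" if f: "f \<in> regular ?Q U" for U f
  proof -
    have "{x \<in> U. f x \<noteq> 0} \<subseteq> points X // R" using sub[OF op[OF f]] by blast
    note eqs = preimage_quotient_map[OF R this] preimage_quotient_map[OF R sub[OF op[OF f]]]
    have eq: "\<Union>{x \<in> U. f x \<noteq> 0} = {x \<in> \<Union>U. f (R `` {x}) \<noteq> 0}"
      unfolding eqs[symmetric] by blast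
    have "openin (zariski ?Q) {x \<in> U. f x \<noteq> 0}"
      unfolding openin_quotient_space[OF R] eq
      by (rule conjI[OF _ regular_nonzero_open[OF X pull[OF f]]]) fact
    then show ?thesis unfolding regular_quotient_space eq
      by (rule conjI) (rule regular_inverse[OF X pull[OF f]])
  qed
qed

lemma morphism_quotient_map:
  assumes X: "space_with_functions X" and R: "equiv (points X) R"
  shows "morphism X (quotient_space X R) (\<lambda>x. R `` {x})"
proof (rule morphismI)
  have pre: "{x \<in> points X. R `` {x} \<in> U} = \<Union>U" if "openin (zariski (quotient_space X R)) U" for U
    by (rule preimage_quotient_map[OF R conjunct1]) (rule that[unfolded openin_quotient_space[OF R]])
  show "R `` {x} \<in> points (quotient_space X R)" if "x \<in> points X" for x
    using that by (simp add: points_quotient_space[OF R] quotientI)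
  show "openin (zariski X) {x \<in> points X. R `` {x} \<in> U}"
    if "openin (zariski (quotient_space X R)) U" for U
    unfolding pre[OF that] using that openin_quotient_space[OF R] by simp
  show "(\<lambda>x. g (R `` {x})) \<in> regular X {x \<in> points X. R `` {x} \<in> U}"
    if "g \<in> regular (quotient_space X R) U" for U g
  proof -
    have o: "openin (zariski (quotient_space X R)) U"
      using that unfolding regular_quotient_space by (rule conjunct1)
    show ?thesis unfolding pre[OF o]
      using that unfolding regular_quotient_space by (rule conjunct2)
  qed
qed

lemma morphism_from_quotient_space:
  assumes X: "space_with_functions X" and R: "equiv (points X) R" and f: "morphism X Y f"
    and eq: "\<And>x. x \<in> points X \<Longrightarrow> g (R `` {x}) = f x"
  shows "morphism (quotient_space X R) Y g"
proof (rule morphismI)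
  let ?Q = "quotient_space X R"
  have pre: "\<Union>{C \<in> points ?Q. g C \<in> U} = {x \<in> points X. f x \<in> U}" for U
  proof -
    have "\<Union>{C \<in> points ?Q. g C \<in> U} = {x \<in> points X. R `` {x} \<in> {C \<in> points ?Q. g C \<in> U}}"
      by (rule preimage_quotient_map[OF R, symmetric]) (use points_quotient_space[OF R] in blast)
    also have "\<dots> = {x \<in> points X. f x \<in> U}"
      unfolding points_quotient_space[OF R] using eq quotientI[of _ "points X" R] by auto
    finally show ?thesis .
  qed
  show "g C \<in> points Y" if C: "C \<in> points ?Q" for C
  proof -
    obtain x where "x \<in> points X" "C = R `` {x}"
      using C unfolding points_quotient_space[OF R] by (rule quotientE)
    then show ?thesis using eq morphism_maps[OF f, of x] by simp
  qed
  show o: "openin (zariski ?Q) {C \<in> points ?Q. g C \<in> U}" if "openin (zariski Y) U" for U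
    unfolding openin_quotient_space[OF R] pre
    using morphism_preimage_open[OF f that] points_quotient_space[OF R] by blast
  show "(\<lambda>C. k (g C)) \<in> regular ?Q {C \<in> points ?Q. g C \<in> U}" if k: "k \<in> regular Y U" for U k
  proof -
    have *: "(\<lambda>x. k (g (R `` {x}))) \<in> regular X {x \<in> points X. f x \<in> U}"
      by (rule regular_cong[OF X morphism_pullback[OF f k]]) (use eq in simp)
    have "openin (zariski ?Q) {C \<in> points ?Q. g C \<in> U}"
      unfolding openin_quotient_space[OF R] pre
      using regular_open[OF X *] points_quotient_space[OF R] by blast
    then show ?thesis unfolding regular_quotient_space pre by (rule conjI) (rule *)
  qed
qed

subsection \<open>Products\<close>

lemma tensor_functionsD:
  assumes "t \<in> tensor_functions I X U"
  shows "\<exists>(m::nat) g. t = (\<lambda>x. \<Sum>k<m. \<Prod>i\<in>I. g k i (x i)) \<and> (\<forall>k<m. \<forall>i\<in>I. g k i \<in> regular (X i) (U i))"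
  using assms unfolding tensor_functions_def by simp

lemma tensor_functionsI:
  fixes m :: nat
  assumes "\<And>k i. k < m \<Longrightarrow> i \<in> I \<Longrightarrow> g k i \<in> regular (X i) (U i)"
  shows "(\<lambda>x. \<Sum>k<m. \<Prod>i\<in>I. g k i (x i)) \<in> tensor_functions I X U"
  unfolding tensor_functions_def using assms by blast

lemma tensor_pure:
  assumes "\<And>i. i \<in> I \<Longrightarrow> g i \<in> regular (X i) (U i)"
  shows "(\<lambda>x. \<Prod>i\<in>I. g i (x i)) \<in> tensor_functions I X U"
  using tensor_functionsI[of 1 I "\<lambda>_. g" X U] assms by simp

lemma tensor_zero: "(\<lambda>_. 0) \<in> tensor_functions I X U"
  using tensor_functionsI[of 0 I undefined X U] by simp

lemma tensor_add:
  assumes s: "s \<in> tensor_functions I X U" and t: "t \<in> tensor_functions I X U"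
  shows "(\<lambda>x. s x + t x) \<in> tensor_functions I X U"
proof -
  obtain m :: nat and g where s': "s = (\<lambda>x. \<Sum>k<m. \<Prod>i\<in>I. g k i (x i))"
    and g_reg: "\<forall>k<m. \<forall>i\<in>I. g k i \<in> regular (X i) (U i)"
    using tensor_functionsD[OF s] by (elim exE conjE) (rule that)
    note g = g_reg[rule_format]
  obtain n :: nat and h where t': "t = (\<lambda>x. \<Sum>k<n. \<Prod>i\<in>I. h k i (x i))"
    and h_reg: "\<forall>k<n. \<forall>i\<in>I. h k i \<in> regular (X i) (U i)"
    using tensor_functionsD[OF t] by (elim exE conjE) (rule that)
    note h = h_reg[rule_format]
  define f where "f k = (if k < m then g k else h (k - m))" for k
  have eq: "s x + t x = (\<Sum>k<m+n. \<Prod>i\<in>I. f k i (x i))" for x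
  proof -
    have "(\<Sum>k<m+n. \<Prod>i\<in>I. f k i (x i)) = (\<Sum>k<m. \<Prod>i\<in>I. f k i (x i)) + (\<Sum>k<n. \<Prod>i\<in>I. f (m+k) i (x i))"
      by (induction n) (simp_all add: algebra_simps)
    then show ?thesis by (simp add: s' t' f_def)
  qed
  show ?thesis unfolding eq
    by (rule tensor_functionsI) (auto simp: f_def intro: g h)
qed

lemma tensor_mult:
  assumes X: "\<And>i. i \<in> I \<Longrightarrow> space_with_functions (X i)"
    and s: "s \<in> tensor_functions I X U" and t: "t \<in> tensor_functions I X U"
  shows "(\<lambda>x. s x * t x) \<in> tensor_functions I X U"
proof -
  obtain m :: nat and g where s': "s = (\<lambda>x. \<Sum>k<m. \<Prod>i\<in>I. g k i (x i))"
    and g_reg: "\<forall>k<m. \<forall>i\<in>I. g k i \<in> regular (X i) (U i)"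
    using tensor_functionsD[OF s] by (elim exE conjE) (rule that)
    note g = g_reg[rule_format]
  obtain n :: nat and h where t': "t = (\<lambda>x. \<Sum>k<n. \<Prod>i\<in>I. h k i (x i))"
    and h_reg: "\<forall>k<n. \<forall>i\<in>I. h k i \<in> regular (X i) (U i)"
    using tensor_functionsD[OF t] by (elim exE conjE) (rule that)
    note h = h_reg[rule_format]
  have pure: "(\<lambda>x. (\<Prod>i\<in>I. g j i (x i)) * t x) \<in> tensor_functions I X U" if j: "j < m" for j
  proof -
    have "(\<lambda>x. \<Sum>k<n. \<Prod>i\<in>I. (\<lambda>y. g j i y * h k i y) (x i)) \<in> tensor_functions I X U"
      by (rule tensor_functionsI) (rule regular_mult[OF X g[OF j] h])
    then show ?thesis by (simp add: t' sum_distrib_left prod.distrib)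
  qed
  have "(\<lambda>x. \<Sum>k<l. (\<Prod>i\<in>I. g k i (x i)) * t x) \<in> tensor_functions I X U" if "l \<le> m" for l
    using that
  proof (induction l)
    case 0 show ?case by (simp add: tensor_zero)
  next
    case (Suc l)
    then show ?case using tensor_add[OF Suc.IH pure] by simp
  qed
  from this[OF order_refl] show ?thesis by (simp add: s' sum_distrib_right)
qed

lemma tensor_restrict:
  assumes X: "\<And>i. i \<in> I \<Longrightarrow> space_with_functions (X i)"
    and t: "t \<in> tensor_functions I X U"
    and V: "\<And>i. i \<in> I \<Longrightarrow> openin (zariski (X i)) (V i)" "\<And>i. i \<in> I \<Longrightarrow> V i \<subseteq> U i"
  shows "t \<in> tensor_functions I X V"
proof -
  obtain m :: nat and g where t': "t = (\<lambda>x. \<Sum>k<m. \<Prod>i\<in>I. g k i (x i))"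
    and g_reg: "\<forall>k<m. \<forall>i\<in>I. g k i \<in> regular (X i) (U i)"
    using tensor_functionsD[OF t] by (elim exE conjE) (rule that)
    note g = g_reg[rule_format]
  show ?thesis unfolding t'
    by (rule tensor_functionsI) (rule regular_restrict[OF X g V])
qed

lemma tensor_coordinate:
  assumes I: "finite I" "j \<in> I" and X: "\<And>i. i \<in> I \<Longrightarrow> space_with_functions (X i)"
    and U: "\<And>i. i \<in> I \<Longrightarrow> openin (zariski (X i)) (U i)" and f: "f \<in> regular (X j) (U j)"
  shows "(\<lambda>x. f (x j)) \<in> tensor_functions I X U"
proof -
  have "(\<lambda>x. \<Prod>i\<in>I. (if i = j then f else (\<lambda>_. 1)) (x i)) \<in> tensor_functions I X U"
    by (rule tensor_pure) (use f regular_const[OF X U] in simp)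
  moreover have "(\<Prod>i\<in>I. (if i = j then f else (\<lambda>_. 1)) (x i)) = f (x j)" for x
  proof -
    have "(\<Prod>i\<in>I. (if i = j then f else (\<lambda>_. 1)) (x i)) = (\<Prod>i\<in>I. if i = j then f (x j) else 1)"
      by (rule prod.cong) auto
    then show ?thesis using I by simp
  qed
  ultimately show ?thesis by simp
qed

definition tensor_open :: "'i set \<Rightarrow> ('i \<Rightarrow> 'a fspace) \<Rightarrow> ('i \<Rightarrow> 'a set) \<Rightarrow> (('i \<Rightarrow> 'a) \<Rightarrow> complex) \<Rightarrow> bool"
  where "tensor_open I X U t \<longleftrightarrow> (\<forall>i\<in>I. openin (zariski (X i)) (U i)) \<and> t \<in> tensor_functions I X U"

lemma zariski_product_space:
  "zariski (product_space I X) =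
    topology_generated_by {{x \<in> Pi\<^sub>E I U. t x \<noteq> 0} | U t. tensor_open I X U t}"
  by (simp add: product_space_def Let_def tensor_open_def)

lemma regular_product_space:
  "f \<in> regular (product_space I X) W \<longleftrightarrow> openin (zariski (product_space I X)) W \<and>
       (\<forall>x\<in>W. \<exists>U. (\<forall>i\<in>I. openin (zariski (X i)) (U i)) \<and> x \<in> Pi\<^sub>E I U \<and>
         (\<exists>s \<in> tensor_functions I X U. \<exists>t \<in> tensor_functions I X U. t x \<noteq> 0 \<and>
           (\<forall>y \<in> W \<inter> Pi\<^sub>E I U. t y \<noteq> 0 \<longrightarrow> f y = s y / t y)))"
  by (simp add: product_space_def Let_def)

lemma openin_tensor_open:
  "tensor_open I X U t \<Longrightarrow> openin (zariski (product_space I X)) {x \<in> Pi\<^sub>E I U. t x \<noteq> 0}"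
  unfolding zariski_product_space by (rule topology_generated_by_Basis) blast

text \<open>The nonvanishing loci of tensor functions are closed under intersection, so they form a
  basis: this is what lets a regular function be restricted to a smaller open set, which need
  not contain an open box.\<close>

lemma product_space_basis:
  assumes X: "\<And>i. i \<in> I \<Longrightarrow> space_with_functions (X i)"
    and W: "openin (zariski (product_space I X)) W" and x: "x \<in> W"
  shows "\<exists>U t. tensor_open I X U t \<and> x \<in> Pi\<^sub>E I U \<and> t x \<noteq> 0 \<and> {y \<in> Pi\<^sub>E I U. t y \<noteq> 0} \<subseteq> W"
proof -
  have "generate_topology_on {{x \<in> Pi\<^sub>E I U. t x \<noteq> 0} | U t. tensor_open I X U t} W"
    using W unfolding zariski_product_space openin_topology_generated_by_iff .
  then have "\<forall>x\<in>W. \<exists>U t. tensor_open I X U t \<and> x \<in> Pi\<^sub>E I U \<and> t x \<noteq> 0 \<and> {y \<in> Pi\<^sub>E I U. t y \<noteq> 0} \<subseteq> W"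
  proof induction
    case Empty show ?case by simp
  next
    case (Int a b)
    show ?case
    proof
      fix x assume x: "x \<in> a \<inter> b"
      obtain U t where U: "tensor_open I X U t" "x \<in> Pi\<^sub>E I U" "t x \<noteq> 0" "{y \<in> Pi\<^sub>E I U. t y \<noteq> 0} \<subseteq> a"
        using bspec[OF Int.IH(1) IntD1[OF x]] by (elim exE conjE) (rule that)
      obtain V s where V: "tensor_open I X V s" "x \<in> Pi\<^sub>E I V" "s x \<noteq> 0" "{y \<in> Pi\<^sub>E I V. s y \<noteq> 0} \<subseteq> b"
        using bspec[OF Int.IH(2) IntD2[OF x]] by (elim exE conjE) (rule that)
      let ?W = "\<lambda>i. U i \<inter> V i"
      have W: "Pi\<^sub>E I ?W = Pi\<^sub>E I U \<inter> Pi\<^sub>E I V" by (auto simp: PiE_def Pi_def)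
      have o: "openin (zariski (X i)) (?W i)" if "i \<in> I" for i
        using U(1) V(1) that unfolding tensor_open_def by auto
      have "t \<in> tensor_functions I X ?W" "s \<in> tensor_functions I X ?W"
        using U(1) V(1) unfolding tensor_open_def by (auto intro: tensor_restrict[OF X _ o])
      then have "tensor_open I X ?W (\<lambda>x. t x * s x)"
        unfolding tensor_open_def using tensor_mult[OF X] o by simp
      then show "\<exists>U t. tensor_open I X U t \<and> x \<in> Pi\<^sub>E I U \<and> t x \<noteq> 0 \<and> {y \<in> Pi\<^sub>E I U. t y \<noteq> 0} \<subseteq> a \<inter> b"
        using U(2-4) V(2-4) by (intro exI[of _ ?W] exI[of _ "\<lambda>x. t x * s x"]) (auto simp: W)
    qed
  next
    case (UN K)
    show ?case
    proof
      fix x assume "x \<in> \<Union>K"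
      then obtain k where k: "k \<in> K" "x \<in> k" by blast
      obtain U t where U: "tensor_open I X U t" "x \<in> Pi\<^sub>E I U" "t x \<noteq> 0" "{y \<in> Pi\<^sub>E I U. t y \<noteq> 0} \<subseteq> k"
        using bspec[OF UN.IH[OF k(1)] k(2)] by (elim exE conjE) (rule that)
      have "{y \<in> Pi\<^sub>E I U. t y \<noteq> 0} \<subseteq> \<Union>K" using U(4) k(1) by blast
      with U(1-3) show "\<exists>U t. tensor_open I X U t \<and> x \<in> Pi\<^sub>E I U \<and> t x \<noteq> 0 \<and> {y \<in> Pi\<^sub>E I U. t y \<noteq> 0} \<subseteq> \<Union>K"
        by (intro exI[of _ U] exI[of _ t] conjI)
    qed
  next
    case (Basis s)
    then obtain U t where s: "s = {x \<in> Pi\<^sub>E I U. t x \<noteq> 0}" and U: "tensor_open I X U t" by blast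
    show ?case unfolding s by (rule ballI, intro exI[of _ U] exI[of _ t] conjI U order_refl) simp_all
  qed
  from bspec[OF this x] show ?thesis .
qed

context
  fixes I :: "'i set" and X :: "'i \<Rightarrow> 'a fspace"
  assumes I: "finite I" "I \<noteq> {}" and X: "\<And>i. i \<in> I \<Longrightarrow> space_with_functions (X i)"
begin

lemma tensor_open_basis:
  assumes "openin (zariski (product_space I X)) W" "x \<in> W"
  shows "\<exists>U t. tensor_open I X U t \<and> x \<in> Pi\<^sub>E I U \<and> t x \<noteq> 0 \<and> {y \<in> Pi\<^sub>E I U. t y \<noteq> 0} \<subseteq> W"
  by (rule product_space_basis[OF X assms])

lemma tensor_const:
  assumes U: "\<And>i. i \<in> I \<Longrightarrow> openin (zariski (X i)) (U i)"
  shows "(\<lambda>_. c) \<in> tensor_functions I X U"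
proof -
  obtain j where j: "j \<in> I" using I by blast
  show ?thesis
    by (rule tensor_coordinate[where f="\<lambda>_. c" and j=j])
       (use I(1) j X U regular_const[OF X[OF j] U[OF j]] in simp_all)
qed

lemma openin_box:
  assumes U: "\<And>i. i \<in> I \<Longrightarrow> openin (zariski (X i)) (U i)"
  shows "openin (zariski (product_space I X)) (Pi\<^sub>E I U)"
  using openin_tensor_open[of I X U "\<lambda>_. 1"] U tensor_const[OF U] by (simp add: tensor_open_def)

lemma points_product_space: "points (product_space I X) = Pi\<^sub>E I (\<lambda>i. points (X i))"
proof
  show "Pi\<^sub>E I (\<lambda>i. points (X i)) \<subseteq> points (product_space I X)"
    by (rule openin_subset[OF openin_box]) simp
  have "x \<in> Pi\<^sub>E I (\<lambda>i. points (X i))" if U: "tensor_open I X U t" "x \<in> Pi\<^sub>E I U" for x U t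
  proof -
    have "U i \<subseteq> points (X i)" if "i \<in> I" for i
      using U(1) that openin_subset unfolding tensor_open_def by blast
    then have "Pi\<^sub>E I U \<subseteq> Pi\<^sub>E I (\<lambda>i. points (X i))" by (rule PiE_mono)
    then show ?thesis using U(2) by blast
  qed
  then show "points (product_space I X) \<subseteq> Pi\<^sub>E I (\<lambda>i. points (X i))"
    unfolding zariski_product_space by (auto simp: topology_generated_by_topspace)
qed

lemma regular_product_spaceI:
  assumes W: "openin (zariski (product_space I X)) W"
    and loc: "\<And>x. x \<in> W \<Longrightarrow> \<exists>U s t. tensor_open I X U t \<and> s \<in> tensor_functions I X U \<and> x \<in> Pi\<^sub>E I U \<and>
      t x \<noteq> 0 \<and> (\<forall>y. y \<in> W \<and> y \<in> Pi\<^sub>E I U \<and> t y \<noteq> 0 \<longrightarrow> f y = s y / t y)"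
  shows "f \<in> regular (product_space I X) W"
  unfolding regular_product_space
proof (rule conjI[OF W], rule ballI)
  fix x assume "x \<in> W"
  from loc[OF this] obtain U s t where U: "tensor_open I X U t"
    and st: "s \<in> tensor_functions I X U" "x \<in> Pi\<^sub>E I U"
      "t x \<noteq> 0" "\<forall>y. y \<in> W \<and> y \<in> Pi\<^sub>E I U \<and> t y \<noteq> 0 \<longrightarrow> f y = s y / t y"
    by (elim exE conjE) (rule that)
  show "\<exists>U. (\<forall>i\<in>I. openin (zariski (X i)) (U i)) \<and> x \<in> Pi\<^sub>E I U \<and>
         (\<exists>s \<in> tensor_functions I X U. \<exists>t \<in> tensor_functions I X U. t x \<noteq> 0 \<and>
           (\<forall>y \<in> W \<inter> Pi\<^sub>E I U. t y \<noteq> 0 \<longrightarrow> f y = s y / t y))"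
    using U st unfolding tensor_open_def by (intro exI[of _ U] conjI bexI[of _ s] bexI[of _ t]) simp_all
qed

lemma regular_product_spaceD:
  assumes f: "f \<in> regular (product_space I X) W"
  shows "openin (zariski (product_space I X)) W"
    and "x \<in> W \<Longrightarrow> \<exists>U s t. tensor_open I X U t \<and> s \<in> tensor_functions I X U \<and> x \<in> Pi\<^sub>E I U \<and>
      t x \<noteq> 0 \<and> (\<forall>y. y \<in> W \<and> y \<in> Pi\<^sub>E I U \<and> t y \<noteq> 0 \<longrightarrow> f y = s y / t y)"
proof -
  show "openin (zariski (product_space I X)) W" using f unfolding regular_product_space by (rule conjunct1)
  assume x: "x \<in> W"
  obtain U s t where "\<forall>i\<in>I. openin (zariski (X i)) (U i)" "x \<in> Pi\<^sub>E I U"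
      "s \<in> tensor_functions I X U" "t \<in> tensor_functions I X U" "t x \<noteq> 0"
      "\<forall>y \<in> W \<inter> Pi\<^sub>E I U. t y \<noteq> 0 \<longrightarrow> f y = s y / t y"
    using f[unfolded regular_product_space, THEN conjunct2, THEN bspec[OF _ x]]
    by (elim exE conjE bexE) (rule that)
  then show "\<exists>U s t. tensor_open I X U t \<and> s \<in> tensor_functions I X U \<and> x \<in> Pi\<^sub>E I U \<and>
      t x \<noteq> 0 \<and> (\<forall>y. y \<in> W \<and> y \<in> Pi\<^sub>E I U \<and> t y \<noteq> 0 \<longrightarrow> f y = s y / t y)"
    unfolding tensor_open_def by (intro exI[of _ U] exI[of _ s] exI[of _ t]) simp
qed

text \<open>On a common box the sum and the product of two fractions of tensors are again fractions of
  tensors.\<close>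

lemma tensor_quotients_common_box:
  assumes f: "f \<in> regular (product_space I X) W" and g: "g \<in> regular (product_space I X) W" and x: "x \<in> W"
  shows "\<exists>U s t s' t'. (\<forall>i\<in>I. openin (zariski (X i)) (U i)) \<and> x \<in> Pi\<^sub>E I U \<and>
    s \<in> tensor_functions I X U \<and> t \<in> tensor_functions I X U \<and> s' \<in> tensor_functions I X U \<and>
    t' \<in> tensor_functions I X U \<and> t x \<noteq> 0 \<and> t' x \<noteq> 0 \<and>
    (\<forall>y. y \<in> W \<and> y \<in> Pi\<^sub>E I U \<and> t y \<noteq> 0 \<longrightarrow> f y = s y / t y) \<and>
    (\<forall>y. y \<in> W \<and> y \<in> Pi\<^sub>E I U \<and> t' y \<noteq> 0 \<longrightarrow> g y = s' y / t' y)"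
proof -
  obtain U s t where U: "tensor_open I X U t" "s \<in> tensor_functions I X U" "x \<in> Pi\<^sub>E I U"
      "t x \<noteq> 0" "\<forall>y. y \<in> W \<and> y \<in> Pi\<^sub>E I U \<and> t y \<noteq> 0 \<longrightarrow> f y = s y / t y"
    using regular_product_spaceD(2)[OF f x] by (elim exE conjE) (rule that)
  obtain V s' t' where V: "tensor_open I X V t'" "s' \<in> tensor_functions I X V" "x \<in> Pi\<^sub>E I V"
      "t' x \<noteq> 0" "\<forall>y. y \<in> W \<and> y \<in> Pi\<^sub>E I V \<and> t' y \<noteq> 0 \<longrightarrow> g y = s' y / t' y"
    using regular_product_spaceD(2)[OF g x] by (elim exE conjE) (rule that)
  let ?W = "\<lambda>i. U i \<inter> V i"
  have W: "Pi\<^sub>E I ?W = Pi\<^sub>E I U \<inter> Pi\<^sub>E I V" by (auto simp: PiE_def Pi_def)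
  have o: "openin (zariski (X i)) (?W i)" if "i \<in> I" for i
    using U(1) V(1) that unfolding tensor_open_def by auto
  have "t \<in> tensor_functions I X ?W" "t' \<in> tensor_functions I X ?W"
    "s \<in> tensor_functions I X ?W" "s' \<in> tensor_functions I X ?W"
    using U(1,2) V(1,2) unfolding tensor_open_def by (auto intro: tensor_restrict[OF X _ o])
  then show ?thesis using o U(3-5) V(3-5)
    by (intro exI[of _ ?W] exI[of _ s] exI[of _ t] exI[of _ s'] exI[of _ t']) (simp add: W)
qed

lemma space_with_functions_product: "space_with_functions (product_space I X)"
proof (rule space_with_functionsI)
  let ?P = "product_space I X"
  show op: "openin (zariski ?P) W" if "f \<in> regular ?P W" for W f
    by (rule regular_product_spaceD(1)[OF that])
  show "g \<in> regular ?P W" if f: "f \<in> regular ?P W" and eq: "\<And>x. x \<in> W \<Longrightarrow> g x = f x" for W f g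
  proof (rule regular_product_spaceI[OF op[OF f]])
    fix x assume x: "x \<in> W"
    obtain U s t where "tensor_open I X U t" "s \<in> tensor_functions I X U" "x \<in> Pi\<^sub>E I U"
        "t x \<noteq> 0" "\<forall>y. y \<in> W \<and> y \<in> Pi\<^sub>E I U \<and> t y \<noteq> 0 \<longrightarrow> f y = s y / t y"
      using regular_product_spaceD(2)[OF f x] by (elim exE conjE) (rule that)
    then show "\<exists>U s t. tensor_open I X U t \<and> s \<in> tensor_functions I X U \<and> x \<in> Pi\<^sub>E I U \<and>
      t x \<noteq> 0 \<and> (\<forall>y. y \<in> W \<and> y \<in> Pi\<^sub>E I U \<and> t y \<noteq> 0 \<longrightarrow> g y = s y / t y)"
      using eq by (intro exI[of _ U] exI[of _ s] exI[of _ t]) simp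
  qed
  show "(\<lambda>_. c) \<in> regular ?P W" if W: "openin (zariski ?P) W" for W c
  proof (rule regular_product_spaceI[OF W])
    fix x assume "x \<in> W"
    then have "x \<in> Pi\<^sub>E I (\<lambda>i. points (X i))" using openin_subset[OF W] points_product_space by blast
    moreover have "(\<lambda>_. 1) \<in> tensor_functions I X (\<lambda>i. points (X i))"
      "(\<lambda>_. c) \<in> tensor_functions I X (\<lambda>i. points (X i))"
      by (rule tensor_const, simp)+
    ultimately show "\<exists>U s t. tensor_open I X U t \<and> s \<in> tensor_functions I X U \<and> x \<in> Pi\<^sub>E I U \<and>
      t x \<noteq> 0 \<and> (\<forall>y. y \<in> W \<and> y \<in> Pi\<^sub>E I U \<and> t y \<noteq> 0 \<longrightarrow> c = s y / t y)"
      unfolding tensor_open_def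
      by (intro exI[of _ "\<lambda>i. points (X i)"] exI[of _ "\<lambda>_. c"] exI[of _ "\<lambda>_. 1"]) simp
  qed
  show "(\<lambda>x. f x + g x) \<in> regular ?P W" if f: "f \<in> regular ?P W" and g: "g \<in> regular ?P W" for W f g
  proof (rule regular_product_spaceI[OF op[OF f]])
    fix x assume x: "x \<in> W"
    obtain U s t s' t' where o: "\<forall>i\<in>I. openin (zariski (X i)) (U i)" and U: "x \<in> Pi\<^sub>E I U" and st:
      "s \<in> tensor_functions I X U" "t \<in> tensor_functions I X U" "s' \<in> tensor_functions I X U" "t' \<in> tensor_functions I X U"
      "t x \<noteq> 0" "t' x \<noteq> 0" and eq: "\<forall>y. y \<in> W \<and> y \<in> Pi\<^sub>E I U \<and> t y \<noteq> 0 \<longrightarrow> f y = s y / t y"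
      "\<forall>y. y \<in> W \<and> y \<in> Pi\<^sub>E I U \<and> t' y \<noteq> 0 \<longrightarrow> g y = s' y / t' y"
      using tensor_quotients_common_box[OF f g x] by (elim exE conjE) (rule that)
    have "(\<lambda>x. s x * t' x + s' x * t x) \<in> tensor_functions I X U"
      by (rule tensor_add[OF tensor_mult[OF X st(1,4)] tensor_mult[OF X st(3,2)]])
    moreover have "(\<lambda>x. t x * t' x) \<in> tensor_functions I X U" by (rule tensor_mult[OF X st(2,4)])
    ultimately show "\<exists>U s t. tensor_open I X U t \<and> s \<in> tensor_functions I X U \<and> x \<in> Pi\<^sub>E I U \<and>
      t x \<noteq> 0 \<and> (\<forall>y. y \<in> W \<and> y \<in> Pi\<^sub>E I U \<and> t y \<noteq> 0 \<longrightarrow> f y + g y = s y / t y)"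
      using U o st(5,6) eq unfolding tensor_open_def
      by (intro exI[of _ U] exI[of _ "\<lambda>x. s x * t' x + s' x * t x"] exI[of _ "\<lambda>x. t x * t' x"])
         (simp add: add_frac_eq)
  qed
  show "(\<lambda>x. f x * g x) \<in> regular ?P W" if f: "f \<in> regular ?P W" and g: "g \<in> regular ?P W" for W f g
  proof (rule regular_product_spaceI[OF op[OF f]])
    fix x assume x: "x \<in> W"
    obtain U s t s' t' where o: "\<forall>i\<in>I. openin (zariski (X i)) (U i)" and U: "x \<in> Pi\<^sub>E I U" and st:
      "s \<in> tensor_functions I X U" "t \<in> tensor_functions I X U" "s' \<in> tensor_functions I X U" "t' \<in> tensor_functions I X U"
      "t x \<noteq> 0" "t' x \<noteq> 0" and eq: "\<forall>y. y \<in> W \<and> y \<in> Pi\<^sub>E I U \<and> t y \<noteq> 0 \<longrightarrow> f y = s y / t y"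
      "\<forall>y. y \<in> W \<and> y \<in> Pi\<^sub>E I U \<and> t' y \<noteq> 0 \<longrightarrow> g y = s' y / t' y"
      using tensor_quotients_common_box[OF f g x] by (elim exE conjE) (rule that)
    have "(\<lambda>x. s x * s' x) \<in> tensor_functions I X U" by (rule tensor_mult[OF X st(1,3)])
    moreover have "(\<lambda>x. t x * t' x) \<in> tensor_functions I X U" by (rule tensor_mult[OF X st(2,4)])
    ultimately show "\<exists>U s t. tensor_open I X U t \<and> s \<in> tensor_functions I X U \<and> x \<in> Pi\<^sub>E I U \<and>
      t x \<noteq> 0 \<and> (\<forall>y. y \<in> W \<and> y \<in> Pi\<^sub>E I U \<and> t y \<noteq> 0 \<longrightarrow> f y * g y = s y / t y)"
      using U o st(5,6) eq unfolding tensor_open_def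
      by (intro exI[of _ U] exI[of _ "\<lambda>x. s x * s' x"] exI[of _ "\<lambda>x. t x * t' x"]) simp
  qed
  show "f \<in> regular ?P V" if f: "f \<in> regular ?P W" and V: "openin (zariski ?P) V" "V \<subseteq> W" for W V f
  proof (rule regular_product_spaceI[OF V(1)])
    fix x assume "x \<in> V"
    then have x: "x \<in> W" using V(2) by blast
    obtain U s t where "tensor_open I X U t" "s \<in> tensor_functions I X U" "x \<in> Pi\<^sub>E I U"
        "t x \<noteq> 0" "\<forall>y. y \<in> W \<and> y \<in> Pi\<^sub>E I U \<and> t y \<noteq> 0 \<longrightarrow> f y = s y / t y"
      using regular_product_spaceD(2)[OF f x] by (elim exE conjE) (rule that)
    then show "\<exists>U s t. tensor_open I X U t \<and> s \<in> tensor_functions I X U \<and> x \<in> Pi\<^sub>E I U \<and>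
      t x \<noteq> 0 \<and> (\<forall>y. y \<in> V \<and> y \<in> Pi\<^sub>E I U \<and> t y \<noteq> 0 \<longrightarrow> f y = s y / t y)"
      using subsetD[OF V(2)] by (intro exI[of _ U] exI[of _ s] exI[of _ t]) simp
  qed
  show "f \<in> regular ?P W" if W: "openin (zariski ?P) W"
    and loc: "\<And>x. x \<in> W \<Longrightarrow> \<exists>V. x \<in> V \<and> V \<subseteq> W \<and> f \<in> regular ?P V" for W f
  proof (rule regular_product_spaceI[OF W])
    fix x assume x: "x \<in> W"
    obtain V where V: "x \<in> V" "V \<subseteq> W" "f \<in> regular ?P V" using loc[OF x] by blast
    obtain A r where A: "tensor_open I X A r" "x \<in> Pi\<^sub>E I A" "r x \<noteq> 0" "{y \<in> Pi\<^sub>E I A. r y \<noteq> 0} \<subseteq> V"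
      using tensor_open_basis[OF op[OF V(3)] V(1)] by (elim exE conjE) (rule that)
    obtain U s t where U: "tensor_open I X U t" "s \<in> tensor_functions I X U" "x \<in> Pi\<^sub>E I U"
        "t x \<noteq> 0" "\<forall>y. y \<in> V \<and> y \<in> Pi\<^sub>E I U \<and> t y \<noteq> 0 \<longrightarrow> f y = s y / t y"
      using regular_product_spaceD(2)[OF V(3,1)] by (elim exE conjE) (rule that)
    let ?W = "\<lambda>i. U i \<inter> A i"
    have W: "Pi\<^sub>E I ?W = Pi\<^sub>E I U \<inter> Pi\<^sub>E I A" by (auto simp: PiE_def Pi_def)
    have o: "openin (zariski (X i)) (?W i)" if "i \<in> I" for i
      using U(1) A(1) that unfolding tensor_open_def by auto
    have "t \<in> tensor_functions I X ?W" "r \<in> tensor_functions I X ?W" "s \<in> tensor_functions I X ?W"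
      using U(1,2) A(1) unfolding tensor_open_def by (auto intro: tensor_restrict[OF X _ o])
    then have tens: "tensor_open I X ?W (\<lambda>x. t x * r x)" "(\<lambda>x. s x * r x) \<in> tensor_functions I X ?W"
      unfolding tensor_open_def using o by (simp_all add: tensor_mult[OF X])
    have "f y = (s y * r y) / (t y * r y)"
      if y: "y \<in> W \<and> y \<in> Pi\<^sub>E I ?W \<and> t y * r y \<noteq> 0" for y
    proof -
      have "y \<in> V" using A(4) y by (auto simp: W)
      then show ?thesis using U(5) y by (simp add: W)
    qed
    then show "\<exists>U s t. tensor_open I X U t \<and> s \<in> tensor_functions I X U \<and> x \<in> Pi\<^sub>E I U \<and>
        t x \<noteq> 0 \<and> (\<forall>y. y \<in> W \<and> y \<in> Pi\<^sub>E I U \<and> t y \<noteq> 0 \<longrightarrow> f y = s y / t y)"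
      using tens U(3,4) A(2,3)
      by (intro exI[of _ ?W] exI[of _ "\<lambda>x. s x * r x"] exI[of _ "\<lambda>x. t x * r x"]) (simp add: W)
  qed
  show "(\<lambda>x. inverse (f x)) \<in> regular ?P {x \<in> W. f x \<noteq> 0}" if f: "f \<in> regular ?P W" for W f
  proof (rule regular_product_spaceI)
    have key: "\<exists>U s t. tensor_open I X U (\<lambda>x. s x * t x) \<and> (\<lambda>x. t x * t x) \<in> tensor_functions I X U \<and> x \<in> Pi\<^sub>E I U \<and>
      s x * t x \<noteq> 0 \<and> (\<forall>y. y \<in> W \<and> y \<in> Pi\<^sub>E I U \<and> t y \<noteq> 0 \<longrightarrow> f y = s y / t y)"
      if x: "x \<in> {x \<in> W. f x \<noteq> 0}" for x
    proof -
      have xW: "x \<in> W" using x by simp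
      obtain U s t where U: "tensor_open I X U t" "s \<in> tensor_functions I X U" "x \<in> Pi\<^sub>E I U"
          "t x \<noteq> 0" "\<forall>y. y \<in> W \<and> y \<in> Pi\<^sub>E I U \<and> t y \<noteq> 0 \<longrightarrow> f y = s y / t y"
        using regular_product_spaceD(2)[OF f xW] by (elim exE conjE) (rule that)
      have "f x = s x / t x" using U(3,4) xW by (intro U(5)[rule_format]) simp
      then have "s x \<noteq> 0" using x by auto
      then show ?thesis using U unfolding tensor_open_def
        by (intro exI[of _ U] exI[of _ s] exI[of _ t]) (simp add: tensor_mult[OF X])
    qed
    show "openin (zariski ?P) {x \<in> W. f x \<noteq> 0}"
    proof (subst openin_subopen, rule ballI)
      fix x assume x: "x \<in> {x \<in> W. f x \<noteq> 0}"
      obtain U s t where U: "tensor_open I X U (\<lambda>x. s x * t x)" "x \<in> Pi\<^sub>E I U" "s x * t x \<noteq> 0"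
          "\<forall>y. y \<in> W \<and> y \<in> Pi\<^sub>E I U \<and> t y \<noteq> 0 \<longrightarrow> f y = s y / t y"
        using key[OF x] by (elim exE conjE) (rule that)
      have "openin (zariski ?P) (W \<inter> {x \<in> Pi\<^sub>E I U. s x * t x \<noteq> 0})"
        using op[OF f] openin_tensor_open[OF U(1)] by (rule openin_Int)
      then show "\<exists>T. openin (zariski ?P) T \<and> x \<in> T \<and> T \<subseteq> {x \<in> W. f x \<noteq> 0}"
        using U(2-4) x by (intro exI[of _ "W \<inter> {x \<in> Pi\<^sub>E I U. s x * t x \<noteq> 0}"]) auto
    qed
    fix x assume x: "x \<in> {x \<in> W. f x \<noteq> 0}"
    obtain U s t where U: "tensor_open I X U (\<lambda>x. s x * t x)" "(\<lambda>x. t x * t x) \<in> tensor_functions I X U"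
        "x \<in> Pi\<^sub>E I U" "s x * t x \<noteq> 0"
        "\<forall>y. y \<in> W \<and> y \<in> Pi\<^sub>E I U \<and> t y \<noteq> 0 \<longrightarrow> f y = s y / t y"
      using key[OF x] by (elim exE conjE) (rule that)
    show "\<exists>U s t. tensor_open I X U t \<and> s \<in> tensor_functions I X U \<and> x \<in> Pi\<^sub>E I U \<and>
        t x \<noteq> 0 \<and> (\<forall>y. y \<in> {x \<in> W. f x \<noteq> 0} \<and> y \<in> Pi\<^sub>E I U \<and> t y \<noteq> 0 \<longrightarrow> inverse (f y) = s y / t y)"
      using U by (intro exI[of _ U] exI[of _ "\<lambda>x. t x * t x"] exI[of _ "\<lambda>x. s x * t x"]) simp
  qed
qed

lemma morphism_projection:
  assumes j: "j \<in> I" shows "morphism (product_space I X) (X j) (\<lambda>x. x j)"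
proof (rule morphismI)
  show "x j \<in> points (X j)" if "x \<in> points (product_space I X)" for x
    using that j unfolding points_product_space by (rule PiE_mem)
  let ?U = "\<lambda>V i. if i = j then V else points (X i)"
  have box: "{x \<in> points (product_space I X). x j \<in> V} = Pi\<^sub>E I (?U V)" if "openin (zariski (X j)) V" for V
  proof -
    have "V \<subseteq> points (X j)" by (rule openin_subset[OF that])
    then show ?thesis unfolding points_product_space using j by (auto simp: PiE_def Pi_def split: if_splits)
  qed
  have op: "openin (zariski (X i)) (?U V i)" if "openin (zariski (X j)) V" "i \<in> I" for V i
    using that by simp
  show "openin (zariski (product_space I X)) {x \<in> points (product_space I X). x j \<in> V}"
    if "openin (zariski (X j)) V" for V
    unfolding box[OF that] by (rule openin_box) (rule op[OF that])
  show "(\<lambda>x. f (x j)) \<in> regular (product_space I X) {x \<in> points (product_space I X). x j \<in> V}"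
    if f: "f \<in> regular (X j) V" for V f
    unfolding box[OF regular_open[OF X[OF j] f]]
  proof (rule regular_product_spaceI)
    note oV = regular_open[OF X[OF j] f]
    show "openin (zariski (product_space I X)) (Pi\<^sub>E I (?U V))" by (rule openin_box) (rule op[OF oV])
    fix x assume x: "x \<in> Pi\<^sub>E I (?U V)"
    have 1: "tensor_open I X (?U V) (\<lambda>_. 1)"
      unfolding tensor_open_def using op[OF oV] tensor_const[of "?U V" 1] by simp
    have 2: "(\<lambda>x. f (x j)) \<in> tensor_functions I X (?U V)"
      by (rule tensor_coordinate[OF I(1) j X op[OF oV]]) (use f in simp_all)
    show "\<exists>U s t. tensor_open I X U t \<and> s \<in> tensor_functions I X U \<and> x \<in> Pi\<^sub>E I U \<and>
        t x \<noteq> 0 \<and> (\<forall>y. y \<in> Pi\<^sub>E I (?U V) \<and> y \<in> Pi\<^sub>E I U \<and> t y \<noteq> 0 \<longrightarrow> f (y j) = s y / t y)"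
      using 1 2 x by (intro exI[of _ "?U V"] exI[of _ "\<lambda>x. f (x j)"] exI[of _ "\<lambda>_. 1"]) simp
  qed
qed

text \<open>The pullback of a tensor is a sum of products of regular functions. Hence basic open sets pull
  back to open sets, and local fractions of tensors to local fractions of regular functions.\<close>

lemma morphism_into_product_space:
  assumes Z: "space_with_functions Z" and f: "\<And>i. i \<in> I \<Longrightarrow> morphism Z (X i) (\<lambda>z. f z i)"
    and ext: "\<And>z. z \<in> points Z \<Longrightarrow> f z \<in> extensional I"
  shows "morphism Z (product_space I X) f"
proof (rule morphismI)
  show "f z \<in> points (product_space I X)" if "z \<in> points Z" for z
    unfolding points_product_space PiE_def using ext[OF that] morphism_maps[OF f that] by simp
  let ?pre = "\<lambda>U. {z \<in> points Z. f z \<in> Pi\<^sub>E I U}"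
  have box: "openin (zariski Z) (?pre U)" if U: "\<And>i. i \<in> I \<Longrightarrow> openin (zariski (X i)) (U i)" for U
  proof -
    have "?pre U = points Z \<inter> (\<Inter>i\<in>I. {z \<in> points Z. f z i \<in> U i})"
      using ext by (auto simp: PiE_def)
    moreover have "openin (zariski Z) (\<Inter>i\<in>I. {z \<in> points Z. f z i \<in> U i})"
      by (rule openin_INT2[OF I]) (rule morphism_preimage_open[OF f U])
    ultimately show ?thesis by (simp only: openin_Int openin_topspace)
  qed
  have tens: "(\<lambda>z. t (f z)) \<in> regular Z (?pre U)"
    if U: "\<And>i. i \<in> I \<Longrightarrow> openin (zariski (X i)) (U i)" and t: "t \<in> tensor_functions I X U" for U t
  proof -
    obtain m :: nat and g where t': "t = (\<lambda>x. \<Sum>k<m. \<Prod>i\<in>I. g k i (x i))"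
      and g_reg: "\<forall>k<m. \<forall>i\<in>I. g k i \<in> regular (X i) (U i)"
      using tensor_functionsD[OF t] by (elim exE conjE) (rule that)
    note g = g_reg[rule_format]
    have *: "(\<lambda>z. g k i (f z i)) \<in> regular Z (?pre U)" if k: "k < m" and i: "i \<in> I" for k i
    proof -
      have sub: "?pre U \<subseteq> {z \<in> points Z. f z i \<in> U i}" using i by auto
      show ?thesis by (rule regular_restrict[OF Z morphism_pullback[OF f[OF i] g[OF k i]] box sub]) (rule U)
    qed
    show ?thesis unfolding t'
    proof (rule regular_sum[OF Z box[OF U]])
      fix k assume "k \<in> {..<m}"
      then have "k < m" by simp
      then show "(\<lambda>z. \<Prod>i\<in>I. g k i (f z i)) \<in> regular Z (?pre U)"
        by (intro regular_prod[OF Z box[OF U]] *)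
    qed
  qed
  have bas: "openin (zariski Z) {z \<in> points Z. f z \<in> {x \<in> Pi\<^sub>E I U. t x \<noteq> 0}}" if "tensor_open I X U t" for U t
  proof -
    have "{z \<in> points Z. f z \<in> {x \<in> Pi\<^sub>E I U. t x \<noteq> 0}} = {z \<in> ?pre U. t (f z) \<noteq> 0}" by auto
    then show ?thesis
      using regular_nonzero_open[OF Z tens[of U t]] that by (simp add: tensor_open_def)
  qed
  show op: "openin (zariski Z) {z \<in> points Z. f z \<in> W}" if W: "openin (zariski (product_space I X)) W" for W
  proof (subst openin_subopen, rule ballI)
    fix z assume z: "z \<in> {z \<in> points Z. f z \<in> W}"
    then have fz: "f z \<in> W" by simp
    obtain U t where U: "tensor_open I X U t" "f z \<in> Pi\<^sub>E I U" "t (f z) \<noteq> 0" "{y \<in> Pi\<^sub>E I U. t y \<noteq> 0} \<subseteq> W"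
      using tensor_open_basis[OF W fz] by (elim exE conjE) (rule that)
    then show "\<exists>T. openin (zariski Z) T \<and> z \<in> T \<and> T \<subseteq> {z \<in> points Z. f z \<in> W}"
      using z by (intro exI[of _ "{z \<in> points Z. f z \<in> {x \<in> Pi\<^sub>E I U. t x \<noteq> 0}}"] conjI bas[OF U(1)]) auto
  qed
  show "(\<lambda>z. g (f z)) \<in> regular Z {z \<in> points Z. f z \<in> W}" if g: "g \<in> regular (product_space I X) W" for W g
  proof (rule regular_local[OF Z])
    note oW = op[OF regular_product_spaceD(1)[OF g]]
    show "openin (zariski Z) {z \<in> points Z. f z \<in> W}" by (rule oW)
    fix z assume z: "z \<in> {z \<in> points Z. f z \<in> W}"
    then have fz: "f z \<in> W" by simp
    obtain U s t where U: "tensor_open I X U t" "s \<in> tensor_functions I X U" "f z \<in> Pi\<^sub>E I U"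
        "t (f z) \<noteq> 0" and eq: "\<forall>y. y \<in> W \<and> y \<in> Pi\<^sub>E I U \<and> t y \<noteq> 0 \<longrightarrow> g y = s y / t y"
      using regular_product_spaceD(2)[OF g fz] by (elim exE conjE) (rule that)
    have oU: "\<And>i. i \<in> I \<Longrightarrow> openin (zariski (X i)) (U i)" and t: "t \<in> tensor_functions I X U"
      using U(1) unfolding tensor_open_def by simp_all
    let ?V = "{z \<in> points Z. f z \<in> W} \<inter> {z \<in> ?pre U. t (f z) \<noteq> 0}"
    have oV: "openin (zariski Z) ?V"
      by (rule openin_Int[OF oW regular_nonzero_open[OF Z tens]]) (rule oU, assumption, rule t)
    have sub: "?V \<subseteq> ?pre U" by blast
    have "(\<lambda>z. s (f z)) \<in> regular Z ?V" by (rule regular_restrict[OF Z tens oV sub]) (rule oU, assumption, rule U(2))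
    moreover have "(\<lambda>z. t (f z)) \<in> regular Z ?V" by (rule regular_restrict[OF Z tens oV sub]) (rule oU, assumption, rule t)
    ultimately have "(\<lambda>z. s (f z) / t (f z)) \<in> regular Z ?V"
      by (rule regular_divide[OF Z]) simp
    then have "(\<lambda>z. g (f z)) \<in> regular Z ?V"
    proof (rule regular_cong[OF Z])
      fix x assume "x \<in> ?V"
      then have "f x \<in> W \<and> f x \<in> Pi\<^sub>E I U \<and> t (f x) \<noteq> 0" by simp
      then show "g (f x) = s (f x) / t (f x)" by (rule eq[rule_format])
    qed
    moreover have "z \<in> ?V" using z U(3,4) by simp
    ultimately show "\<exists>V. z \<in> V \<and> V \<subseteq> {z \<in> points Z. f z \<in> W} \<and> (\<lambda>z. g (f z)) \<in> regular Z V"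
      by (intro exI[of _ ?V] conjI Int_lower1)
  qed
qed

end

subsection \<open>Affine space\<close>

lemma polynomial_uminus: "p \<in> polynomial_functions \<Longrightarrow> (\<lambda>x. - p x) \<in> polynomial_functions"
  using polynomial_functions.mult[OF polynomial_functions.const[of "-1"]] by fastforce

lemma polynomial_diff:
  "p \<in> polynomial_functions \<Longrightarrow> q \<in> polynomial_functions \<Longrightarrow> (\<lambda>x. p x - q x) \<in> polynomial_functions"
  using polynomial_functions.add[OF _ polynomial_uminus] by fastforce

lemma polynomial_power: "p \<in> polynomial_functions \<Longrightarrow> (\<lambda>x. p x ^ n) \<in> polynomial_functions"
  by (induction n) (auto intro: polynomial_functions.intros)

lemma polynomial_prod:
  "(\<And>k. k \<in> K \<Longrightarrow> p k \<in> polynomial_functions) \<Longrightarrow> (\<lambda>x. \<Prod>k\<in>K. p k x) \<in> polynomial_functions"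
  by (induction K rule: infinite_finite_induct) (auto intro: polynomial_functions.intros)

lemmas polynomial_intros = polynomial_functions.intros polynomial_uminus polynomial_diff polynomial_power

lemma polynomial_substitute:
  assumes "p \<in> polynomial_functions" "\<And>i. q i \<in> polynomial_functions"
  shows "(\<lambda>x. p (\<lambda>i. q i x)) \<in> polynomial_functions"
  using assms(1) by induction (auto intro: polynomial_functions.intros assms(2))

lemma zariski_affine_space:
  "zariski (affine_space N) = topology_generated_by {{x \<in> vectors N. p x \<noteq> 0} | p. p \<in> polynomial_functions}"
  by (simp add: affine_space_def Let_def)

lemma openin_affine_basic:
  "p \<in> polynomial_functions \<Longrightarrow> openin (zariski (affine_space N)) {x \<in> vectors N. p x \<noteq> 0}"
  unfolding zariski_affine_space by (rule topology_generated_by_Basis) blast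

text \<open>The nonvanishing loci of polynomials are closed under intersection, since polynomials can be
  multiplied, so they are a basis of the topology that they generate.\<close>

lemma openin_affine_space:
  "openin (zariski (affine_space N)) U \<longleftrightarrow>
    U \<subseteq> vectors N \<and> (\<forall>x\<in>U. \<exists>p\<in>polynomial_functions. p x \<noteq> 0 \<and> (\<forall>y\<in>vectors N. p y \<noteq> 0 \<longrightarrow> y \<in> U))"
proof
  assume "openin (zariski (affine_space N)) U"
  then have "generate_topology_on {{x \<in> vectors N. p x \<noteq> 0} | p. p \<in> polynomial_functions} U"
    unfolding zariski_affine_space openin_topology_generated_by_iff .
  then show "U \<subseteq> vectors N \<and> (\<forall>x\<in>U. \<exists>p\<in>polynomial_functions. p x \<noteq> 0 \<and> (\<forall>y\<in>vectors N. p y \<noteq> 0 \<longrightarrow> y \<in> U))"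
  proof induction
    case Empty show ?case by simp
  next
    case (Int a b)
    show ?case
    proof (intro conjI ballI)
      show "a \<inter> b \<subseteq> vectors N" using Int.IH by blast
      fix x assume x: "x \<in> a \<inter> b"
      obtain p where p: "p \<in> polynomial_functions" "p x \<noteq> 0" "\<forall>y\<in>vectors N. p y \<noteq> 0 \<longrightarrow> y \<in> a"
        using Int.IH(1) x by blast
      obtain q where q: "q \<in> polynomial_functions" "q x \<noteq> 0" "\<forall>y\<in>vectors N. q y \<noteq> 0 \<longrightarrow> y \<in> b"
        using Int.IH(2) x by blast
      show "\<exists>p\<in>polynomial_functions. p x \<noteq> 0 \<and> (\<forall>y\<in>vectors N. p y \<noteq> 0 \<longrightarrow> y \<in> a \<inter> b)"
        using p q by (intro bexI[OF _ polynomial_functions.mult[OF p(1) q(1)]]) simp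
    qed
  next
    case (UN K)
    show ?case
    proof (intro conjI ballI)
      show "\<Union>K \<subseteq> vectors N" using UN.IH by (intro Union_least) simp
      fix x assume "x \<in> \<Union>K"
      then obtain k where k: "k \<in> K" "x \<in> k" by (rule UnionE)
      then obtain p where "p \<in> polynomial_functions" "p x \<noteq> 0" "\<forall>y\<in>vectors N. p y \<noteq> 0 \<longrightarrow> y \<in> k"
        using UN.IH[OF k(1)] by blast
      then show "\<exists>p\<in>polynomial_functions. p x \<noteq> 0 \<and> (\<forall>y\<in>vectors N. p y \<noteq> 0 \<longrightarrow> y \<in> \<Union>K)"
        using k(1) by (intro bexI[of _ p]) auto
    qed
  next
    case (Basis s)
    then obtain p where "s = {x \<in> vectors N. p x \<noteq> 0}" "p \<in> polynomial_functions" by blast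
    then show ?case by (intro conjI ballI bexI[of _ p]) auto
  qed
next
  assume U: "U \<subseteq> vectors N \<and> (\<forall>x\<in>U. \<exists>p\<in>polynomial_functions. p x \<noteq> 0 \<and> (\<forall>y\<in>vectors N. p y \<noteq> 0 \<longrightarrow> y \<in> U))"
  show "openin (zariski (affine_space N)) U"
  proof (subst openin_subopen, rule ballI)
    fix x assume x: "x \<in> U"
    then obtain p where p: "p \<in> polynomial_functions" "p x \<noteq> 0" "\<forall>y\<in>vectors N. p y \<noteq> 0 \<longrightarrow> y \<in> U"
      using U by blast
    then show "\<exists>T. openin (zariski (affine_space N)) T \<and> x \<in> T \<and> T \<subseteq> U"
      using x U openin_affine_basic[OF p(1)] by (intro exI[of _ "{x \<in> vectors N. p x \<noteq> 0}"]) auto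
  qed
qed

lemma points_affine_space [simp]: "points (affine_space N) = vectors N"
proof
  have "openin (zariski (affine_space N)) (vectors N)"
    using openin_affine_basic[OF polynomial_functions.const[of 1], of N] by simp
  then show "vectors N \<subseteq> points (affine_space N)" by (rule openin_subset)
  show "points (affine_space N) \<subseteq> vectors N"
    using openin_topspace[of "zariski (affine_space N)"] unfolding openin_affine_space by blast
qed

lemma regular_affine_space:
  "f \<in> regular (affine_space N) U \<longleftrightarrow> openin (zariski (affine_space N)) U \<and>
    (\<forall>x\<in>U. \<exists>V. openin (zariski (affine_space N)) V \<and> x \<in> V \<and> V \<subseteq> U \<and>
      (\<exists>p \<in> polynomial_functions. \<exists>q \<in> polynomial_functions. \<forall>y\<in>V. q y \<noteq> 0 \<and> f y = p y / q y))"
  by (simp add: affine_space_def Let_def)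

text \<open>The neighbourhood in the definition can be absorbed into the fraction: shrink it to the
  locus where an auxiliary polynomial is nonzero, and multiply numerator and denominator by that
  polynomial.\<close>

lemma regular_affine_space_iff:
  "f \<in> regular (affine_space N) U \<longleftrightarrow> openin (zariski (affine_space N)) U \<and>
    (\<forall>x\<in>U. \<exists>p \<in> polynomial_functions. \<exists>q \<in> polynomial_functions. q x \<noteq> 0 \<and>
      (\<forall>y\<in>vectors N. q y \<noteq> 0 \<longrightarrow> y \<in> U \<and> f y = p y / q y))" (is "?L \<longleftrightarrow> ?R")
proof
  assume L: ?L
  note U = conjunct1[OF L[unfolded regular_affine_space]]
    and loc = conjunct2[OF L[unfolded regular_affine_space]]
  show ?R
  proof (rule conjI[OF U], rule ballI)
    fix x assume "x \<in> U"
    from bspec[OF loc this] obtain V p q where V: "openin (zariski (affine_space N)) V" "x \<in> V" "V \<subseteq> U"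
      and p: "p \<in> polynomial_functions" and q: "q \<in> polynomial_functions"
      and eq: "\<forall>y\<in>V. q y \<noteq> 0 \<and> f y = p y / q y"
      by (elim exE conjE bexE) (rule that)
    obtain r where r: "r \<in> polynomial_functions" "r x \<noteq> 0" "\<forall>y\<in>vectors N. r y \<noteq> 0 \<longrightarrow> y \<in> V"
      using V(1,2) unfolding openin_affine_space by blast
    have "\<forall>y\<in>vectors N. q y * r y \<noteq> 0 \<longrightarrow> y \<in> U \<and> f y = p y * r y / (q y * r y)"
      using r(3) V(3) eq by auto
    moreover have "q x * r x \<noteq> 0" using r(2) V(2) eq by auto
    ultimately show "\<exists>p \<in> polynomial_functions. \<exists>q \<in> polynomial_functions. q x \<noteq> 0 \<and>
      (\<forall>y\<in>vectors N. q y \<noteq> 0 \<longrightarrow> y \<in> U \<and> f y = p y / q y)"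
      by (intro bexI[OF _ polynomial_functions.mult[OF p r(1)]]
          bexI[OF _ polynomial_functions.mult[OF q r(1)]]) simp
  qed
next
  assume R: ?R
  show ?L unfolding regular_affine_space
  proof (rule conjI, use R in simp, rule ballI)
    fix x assume x: "x \<in> U"
    from bspec[OF conjunct2[OF R] this] obtain p q
      where pq: "p \<in> polynomial_functions" "q \<in> polynomial_functions" "q x \<noteq> 0"
      and eq: "\<forall>y\<in>vectors N. q y \<noteq> 0 \<longrightarrow> y \<in> U \<and> f y = p y / q y"
      by (elim exE conjE bexE) (rule that)
    have "x \<in> vectors N" using R x unfolding openin_affine_space by blast
    then show "\<exists>V. openin (zariski (affine_space N)) V \<and> x \<in> V \<and> V \<subseteq> U \<and>
      (\<exists>p \<in> polynomial_functions. \<exists>q \<in> polynomial_functions. \<forall>y\<in>V. q y \<noteq> 0 \<and> f y = p y / q y)"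
      using openin_affine_basic[OF pq(2)] pq eq
      by (intro exI[of _ "{x \<in> vectors N. q x \<noteq> 0}"] conjI bexI[of _ p] bexI[of _ q]) auto
  qed
qed

lemma regular_affine_spaceI:
  assumes U: "openin (zariski (affine_space N)) U"
    and loc: "\<And>x. x \<in> U \<Longrightarrow> \<exists>p q. p \<in> polynomial_functions \<and> q \<in> polynomial_functions \<and> q x \<noteq> 0 \<and>
      (\<forall>y\<in>vectors N. q y \<noteq> 0 \<longrightarrow> y \<in> U \<and> f y = p y / q y)"
  shows "f \<in> regular (affine_space N) U"
  unfolding regular_affine_space_iff
proof (rule conjI[OF U], rule ballI)
  fix x assume "x \<in> U"
  from loc[OF this] obtain p q where "p \<in> polynomial_functions" "q \<in> polynomial_functions" "q x \<noteq> 0"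
    "\<forall>y\<in>vectors N. q y \<noteq> 0 \<longrightarrow> y \<in> U \<and> f y = p y / q y"
    by (elim exE conjE) (rule that)
  then show "\<exists>p \<in> polynomial_functions. \<exists>q \<in> polynomial_functions. q x \<noteq> 0 \<and>
      (\<forall>y\<in>vectors N. q y \<noteq> 0 \<longrightarrow> y \<in> U \<and> f y = p y / q y)"
    by (intro bexI[of _ p] bexI[of _ q] conjI)
qed

lemma regular_affine_spaceD:
  assumes f: "f \<in> regular (affine_space N) U"
  shows "openin (zariski (affine_space N)) U"
    and "x \<in> U \<Longrightarrow> \<exists>p q. p \<in> polynomial_functions \<and> q \<in> polynomial_functions \<and> q x \<noteq> 0 \<and>
      (\<forall>y\<in>vectors N. q y \<noteq> 0 \<longrightarrow> y \<in> U \<and> f y = p y / q y)"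
proof -
  show "openin (zariski (affine_space N)) U" using f unfolding regular_affine_space_iff by (rule conjunct1)
  assume "x \<in> U"
  from bspec[OF conjunct2[OF f[unfolded regular_affine_space_iff]] this]
  obtain p q where "p \<in> polynomial_functions" "q \<in> polynomial_functions" "q x \<noteq> 0"
    "\<forall>y\<in>vectors N. q y \<noteq> 0 \<longrightarrow> y \<in> U \<and> f y = p y / q y"
    by (elim exE conjE bexE) (rule that)
  then show "\<exists>p q. p \<in> polynomial_functions \<and> q \<in> polynomial_functions \<and> q x \<noteq> 0 \<and>
      (\<forall>y\<in>vectors N. q y \<noteq> 0 \<longrightarrow> y \<in> U \<and> f y = p y / q y)"
    by (intro exI[of _ p] exI[of _ q] conjI)
qed

lemma space_with_functions_affine_space: "space_with_functions (affine_space N)"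
proof (rule space_with_functionsI)
  let ?A = "affine_space N"
  note op = regular_affine_spaceD(1)
  show "openin (zariski ?A) U" if "f \<in> regular ?A U" for U f by (rule op[OF that])
  show "g \<in> regular ?A U" if f: "f \<in> regular ?A U" and eq: "\<And>x. x \<in> U \<Longrightarrow> g x = f x" for U f g
  proof (rule regular_affine_spaceI[OF op[OF f]])
    fix x assume x: "x \<in> U"
    obtain p q where "p \<in> polynomial_functions" "q \<in> polynomial_functions" "q x \<noteq> 0"
      "\<forall>y\<in>vectors N. q y \<noteq> 0 \<longrightarrow> y \<in> U \<and> f y = p y / q y"
      using regular_affine_spaceD(2)[OF f x] by (elim exE conjE) (rule that)
    then show "\<exists>p q. p \<in> polynomial_functions \<and> q \<in> polynomial_functions \<and> q x \<noteq> 0 \<and>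
      (\<forall>y\<in>vectors N. q y \<noteq> 0 \<longrightarrow> y \<in> U \<and> g y = p y / q y)"
      using eq by (intro exI[of _ p] exI[of _ q]) simp
  qed
  show "(\<lambda>_. c) \<in> regular ?A U" if U: "openin (zariski ?A) U" for U c
  proof (rule regular_affine_spaceI[OF U])
    fix x assume "x \<in> U"
    then obtain p where p: "p \<in> polynomial_functions" "p x \<noteq> 0" "\<forall>y\<in>vectors N. p y \<noteq> 0 \<longrightarrow> y \<in> U"
      using U unfolding openin_affine_space by blast
    then show "\<exists>r q. r \<in> polynomial_functions \<and> q \<in> polynomial_functions \<and> q x \<noteq> 0 \<and>
      (\<forall>y\<in>vectors N. q y \<noteq> 0 \<longrightarrow> y \<in> U \<and> c = r y / q y)"
      by (intro exI[of _ "\<lambda>x. c * p x"] exI[of _ p]) (auto intro: polynomial_functions.intros)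
  qed
  have pair: "\<exists>p q p' q'. p \<in> polynomial_functions \<and> q \<in> polynomial_functions \<and> p' \<in> polynomial_functions \<and>
      q' \<in> polynomial_functions \<and> q x \<noteq> 0 \<and> q' x \<noteq> 0 \<and>
      (\<forall>y\<in>vectors N. q y \<noteq> 0 \<longrightarrow> y \<in> U \<and> f y = p y / q y) \<and> (\<forall>y\<in>vectors N. q' y \<noteq> 0 \<longrightarrow> g y = p' y / q' y)"
    if f: "f \<in> regular ?A U" and g: "g \<in> regular ?A U" and x: "x \<in> U" for f g U x
  proof -
    obtain p q where 1: "p \<in> polynomial_functions" "q \<in> polynomial_functions" "q x \<noteq> 0"
      "\<forall>y\<in>vectors N. q y \<noteq> 0 \<longrightarrow> y \<in> U \<and> f y = p y / q y"
      using regular_affine_spaceD(2)[OF f x] by (elim exE conjE) (rule that)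
    obtain p' q' where 2: "p' \<in> polynomial_functions" "q' \<in> polynomial_functions" "q' x \<noteq> 0"
      "\<forall>y\<in>vectors N. q' y \<noteq> 0 \<longrightarrow> y \<in> U \<and> g y = p' y / q' y"
      using regular_affine_spaceD(2)[OF g x] by (elim exE conjE) (rule that)
    from 2(4) have "\<forall>y\<in>vectors N. q' y \<noteq> 0 \<longrightarrow> g y = p' y / q' y" by simp
    with 1 2 show ?thesis by (intro exI[of _ p] exI[of _ q] exI[of _ p'] exI[of _ q'] conjI)
  qed
  show "(\<lambda>x. f x + g x) \<in> regular ?A U" if f: "f \<in> regular ?A U" and g: "g \<in> regular ?A U" for U f g
  proof (rule regular_affine_spaceI[OF op[OF f]])
    fix x assume x: "x \<in> U"
    obtain p q p' q' where P: "p \<in> polynomial_functions" "q \<in> polynomial_functions" "p' \<in> polynomial_functions"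
      "q' \<in> polynomial_functions" and nz: "q x \<noteq> 0" "q' x \<noteq> 0"
      and eq: "\<forall>y\<in>vectors N. q y \<noteq> 0 \<longrightarrow> y \<in> U \<and> f y = p y / q y" "\<forall>y\<in>vectors N. q' y \<noteq> 0 \<longrightarrow> g y = p' y / q' y"
      using pair[OF f g x] by (elim exE conjE) (rule that)
    show "\<exists>p q. p \<in> polynomial_functions \<and> q \<in> polynomial_functions \<and> q x \<noteq> 0 \<and>
      (\<forall>y\<in>vectors N. q y \<noteq> 0 \<longrightarrow> y \<in> U \<and> f y + g y = p y / q y)"
      using P nz eq by (intro exI[of _ "\<lambda>x. p x * q' x + p' x * q x"] exI[of _ "\<lambda>x. q x * q' x"])
        (auto intro!: polynomial_functions.intros simp: add_frac_eq)
  qed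
  show "(\<lambda>x. f x * g x) \<in> regular ?A U" if f: "f \<in> regular ?A U" and g: "g \<in> regular ?A U" for U f g
  proof (rule regular_affine_spaceI[OF op[OF f]])
    fix x assume x: "x \<in> U"
    obtain p q p' q' where P: "p \<in> polynomial_functions" "q \<in> polynomial_functions" "p' \<in> polynomial_functions"
      "q' \<in> polynomial_functions" and nz: "q x \<noteq> 0" "q' x \<noteq> 0"
      and eq: "\<forall>y\<in>vectors N. q y \<noteq> 0 \<longrightarrow> y \<in> U \<and> f y = p y / q y" "\<forall>y\<in>vectors N. q' y \<noteq> 0 \<longrightarrow> g y = p' y / q' y"
      using pair[OF f g x] by (elim exE conjE) (rule that)
    show "\<exists>p q. p \<in> polynomial_functions \<and> q \<in> polynomial_functions \<and> q x \<noteq> 0 \<and>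
      (\<forall>y\<in>vectors N. q y \<noteq> 0 \<longrightarrow> y \<in> U \<and> f y * g y = p y / q y)"
      using P nz eq by (intro exI[of _ "\<lambda>x. p x * p' x"] exI[of _ "\<lambda>x. q x * q' x"])
        (auto intro!: polynomial_functions.intros)
  qed
  have shrink: "\<exists>p q. p \<in> polynomial_functions \<and> q \<in> polynomial_functions \<and> q x \<noteq> 0 \<and>
      (\<forall>y\<in>vectors N. q y \<noteq> 0 \<longrightarrow> y \<in> V \<and> f y = p y / q y)"
    if f: "f \<in> regular ?A U" and V: "openin (zariski ?A) V" "x \<in> U" "x \<in> V" for f U V x
  proof -
    obtain p q where pq: "p \<in> polynomial_functions" "q \<in> polynomial_functions" "q x \<noteq> 0"
      "\<forall>y\<in>vectors N. q y \<noteq> 0 \<longrightarrow> y \<in> U \<and> f y = p y / q y"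
      using regular_affine_spaceD(2)[OF f V(2)] by (elim exE conjE) (rule that)
    obtain r where r: "r \<in> polynomial_functions" "r x \<noteq> 0" "\<forall>y\<in>vectors N. r y \<noteq> 0 \<longrightarrow> y \<in> V"
      using V(1,3) unfolding openin_affine_space by blast
    show ?thesis using pq r by (intro exI[of _ "\<lambda>x. p x * r x"] exI[of _ "\<lambda>x. q x * r x"])
        (auto intro!: polynomial_functions.intros)
  qed
  show "f \<in> regular ?A V" if f: "f \<in> regular ?A U" and V: "openin (zariski ?A) V" "V \<subseteq> U" for U V f
  proof (rule regular_affine_spaceI[OF V(1)])
    fix x assume "x \<in> V"
    then show "\<exists>p q. p \<in> polynomial_functions \<and> q \<in> polynomial_functions \<and> q x \<noteq> 0 \<and>
      (\<forall>y\<in>vectors N. q y \<noteq> 0 \<longrightarrow> y \<in> V \<and> f y = p y / q y)"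
      using V(2) by (intro shrink[OF f V(1)]) auto
  qed
  show "f \<in> regular ?A U" if U: "openin (zariski ?A) U"
    and loc: "\<And>x. x \<in> U \<Longrightarrow> \<exists>V. x \<in> V \<and> V \<subseteq> U \<and> f \<in> regular ?A V" for U f
  proof (rule regular_affine_spaceI[OF U])
    fix x assume x: "x \<in> U"
    obtain V where V: "x \<in> V" "V \<subseteq> U" "f \<in> regular ?A V" using loc[OF x] by blast
    show "\<exists>p q. p \<in> polynomial_functions \<and> q \<in> polynomial_functions \<and> q x \<noteq> 0 \<and>
      (\<forall>y\<in>vectors N. q y \<noteq> 0 \<longrightarrow> y \<in> U \<and> f y = p y / q y)"
      by (rule shrink[OF V(3) U V(1) x])
  qed
  show "(\<lambda>x. inverse (f x)) \<in> regular ?A {x \<in> U. f x \<noteq> 0}" if f: "f \<in> regular ?A U" for U f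
  proof (rule regular_affine_spaceI)
    have key: "\<exists>p q. p \<in> polynomial_functions \<and> q \<in> polynomial_functions \<and> p x * q x \<noteq> 0 \<and>
      (\<forall>y\<in>vectors N. p y * q y \<noteq> 0 \<longrightarrow> y \<in> {x \<in> U. f x \<noteq> 0} \<and> inverse (f y) = q y * q y / (p y * q y))"
      if x: "x \<in> {x \<in> U. f x \<noteq> 0}" for x
    proof -
      have xU: "x \<in> U" using x by simp
      obtain p q where pq: "p \<in> polynomial_functions" "q \<in> polynomial_functions" "q x \<noteq> 0"
        "\<forall>y\<in>vectors N. q y \<noteq> 0 \<longrightarrow> y \<in> U \<and> f y = p y / q y"
        using regular_affine_spaceD(2)[OF f xU] by (elim exE conjE) (rule that)
      have "x \<in> vectors N" using op[OF f] xU unfolding openin_affine_space by blast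
      then have "p x \<noteq> 0" using pq x by auto
      then show ?thesis using pq by (intro exI[of _ p] exI[of _ q]) auto
    qed
    show "openin (zariski ?A) {x \<in> U. f x \<noteq> 0}"
      unfolding openin_affine_space
    proof (intro conjI ballI)
      show "{x \<in> U. f x \<noteq> 0} \<subseteq> vectors N" using op[OF f] unfolding openin_affine_space by blast
      fix x assume "x \<in> {x \<in> U. f x \<noteq> 0}"
      from key[OF this] obtain p q where "p \<in> polynomial_functions" "q \<in> polynomial_functions" "p x * q x \<noteq> 0"
        "\<forall>y\<in>vectors N. p y * q y \<noteq> 0 \<longrightarrow> y \<in> {x \<in> U. f x \<noteq> 0} \<and> inverse (f y) = q y * q y / (p y * q y)"
        by (elim exE conjE) (rule that)
      then show "\<exists>p\<in>polynomial_functions. p x \<noteq> 0 \<and> (\<forall>y\<in>vectors N. p y \<noteq> 0 \<longrightarrow> y \<in> {x \<in> U. f x \<noteq> 0})"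
        by (intro bexI[of _ "\<lambda>x. p x * q x"] polynomial_functions.mult) auto
    qed
    fix x assume "x \<in> {x \<in> U. f x \<noteq> 0}"
    from key[OF this] obtain p q where "p \<in> polynomial_functions" "q \<in> polynomial_functions" "p x * q x \<noteq> 0"
      "\<forall>y\<in>vectors N. p y * q y \<noteq> 0 \<longrightarrow> y \<in> {x \<in> U. f x \<noteq> 0} \<and> inverse (f y) = q y * q y / (p y * q y)"
      by (elim exE conjE) (rule that)
    then show "\<exists>r s. r \<in> polynomial_functions \<and> s \<in> polynomial_functions \<and> s x \<noteq> 0 \<and>
      (\<forall>y\<in>vectors N. s y \<noteq> 0 \<longrightarrow> y \<in> {x \<in> U. f x \<noteq> 0} \<and> inverse (f y) = r y / s y)"
      by (intro exI[of _ "\<lambda>x. q x * q x"] exI[of _ "\<lambda>x. p x * q x"] conjI polynomial_functions.mult) simp_all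
  qed
qed

lemma regular_coordinate: "(\<lambda>x. x i) \<in> regular (affine_space N) (vectors N)"
proof (rule regular_affine_spaceI)
  show "openin (zariski (affine_space N)) (vectors N)"
    using openin_topspace[of "zariski (affine_space N)"] by simp
  show "\<exists>p q. p \<in> polynomial_functions \<and> q \<in> polynomial_functions \<and> q x \<noteq> 0 \<and>
      (\<forall>y\<in>vectors N. q y \<noteq> 0 \<longrightarrow> y \<in> vectors N \<and> y i = p y / q y)" for x
    by (intro exI[of _ "\<lambda>x. x i"] exI[of _ "\<lambda>_. 1"]) (auto intro: polynomial_functions.intros)
qed

text \<open>A polynomial in regular functions is regular, so basic open sets have open preimages and local
  fractions of polynomials pull back to regular functions.\<close>

lemma morphism_into_affine_space:
  assumes Z: "space_with_functions Z" and f: "\<And>i. i < N \<Longrightarrow> (\<lambda>z. f z i) \<in> regular Z (points Z)"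
    and vec: "\<And>z. z \<in> points Z \<Longrightarrow> f z \<in> vectors N"
  shows "morphism Z (affine_space N) f"
proof (rule morphismI)
  have f': "(\<lambda>z. f z i) \<in> regular Z (points Z)" for i
  proof (cases "i < N")
    case False
    have "(\<lambda>_. 0) \<in> regular Z (points Z)" by (rule regular_const[OF Z openin_topspace])
    then show ?thesis by (rule regular_cong[OF Z]) (use vec False in \<open>simp add: vectors_def\<close>)
  qed (rule f)
  have poly: "(\<lambda>z. p (f z)) \<in> regular Z (points Z)" if "p \<in> polynomial_functions" for p
    by (rule regular_polynomial[OF Z openin_topspace that f'])
  show "f z \<in> points (affine_space N)" if "z \<in> points Z" for z using vec[OF that] by simp
  show op: "openin (zariski Z) {z \<in> points Z. f z \<in> U}" if U: "openin (zariski (affine_space N)) U" for U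
  proof (subst openin_subopen, rule ballI)
    fix z assume z: "z \<in> {z \<in> points Z. f z \<in> U}"
    then obtain p where p: "p \<in> polynomial_functions" "p (f z) \<noteq> 0" "\<forall>y\<in>vectors N. p y \<noteq> 0 \<longrightarrow> y \<in> U"
      using U unfolding openin_affine_space by blast
    then show "\<exists>T. openin (zariski Z) T \<and> z \<in> T \<and> T \<subseteq> {z \<in> points Z. f z \<in> U}"
      using z vec by (intro exI[of _ "{z \<in> points Z. p (f z) \<noteq> 0}"] conjI
          regular_nonzero_open[OF Z poly[OF p(1)]]) auto
  qed
  show "(\<lambda>z. g (f z)) \<in> regular Z {z \<in> points Z. f z \<in> U}" if g: "g \<in> regular (affine_space N) U" for U g
  proof (rule regular_local[OF Z op[OF regular_affine_spaceD(1)[OF g]]])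
    fix z assume z: "z \<in> {z \<in> points Z. f z \<in> U}"
    then have fz: "f z \<in> U" by simp
    obtain p q where pq: "p \<in> polynomial_functions" "q \<in> polynomial_functions" "q (f z) \<noteq> 0"
      and eq: "\<forall>y\<in>vectors N. q y \<noteq> 0 \<longrightarrow> y \<in> U \<and> g y = p y / q y"
      using regular_affine_spaceD(2)[OF g fz] by (elim exE conjE) (rule that)
    let ?V = "{z \<in> points Z. q (f z) \<noteq> 0}"
    have oV: "openin (zariski Z) ?V" by (rule regular_nonzero_open[OF Z poly[OF pq(2)]])
    have sub: "?V \<subseteq> points Z" by blast
    have "(\<lambda>z. p (f z) / q (f z)) \<in> regular Z ?V"
      by (rule regular_divide[OF Z regular_restrict[OF Z poly[OF pq(1)] oV sub]
            regular_restrict[OF Z poly[OF pq(2)] oV sub]]) simp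
    then have gV: "(\<lambda>z. g (f z)) \<in> regular Z ?V"
      by (rule regular_cong[OF Z]) (use eq vec in simp)
    have zV: "z \<in> ?V" and Vsub: "?V \<subseteq> {z \<in> points Z. f z \<in> U}" using z pq(3) eq vec by auto
    show "\<exists>V. z \<in> V \<and> V \<subseteq> {z \<in> points Z. f z \<in> U} \<and> (\<lambda>z. g (f z)) \<in> regular Z V"
      by (intro exI[of _ ?V] conjI zV Vsub gV)
  qed
qed

subsection \<open>Projective space\<close>

abbreviation punctured :: "nat \<Rightarrow> (nat \<Rightarrow> complex) set" where
  "punctured N \<equiv> vectors (Suc N) - {\<lambda>_. 0}"

definition proj_point :: "nat \<Rightarrow> (nat \<Rightarrow> complex) \<Rightarrow> (nat \<Rightarrow> complex) set" where
  "proj_point N v = proportional (Suc N) `` {v}"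

lemma space_with_functions_punctured: "space_with_functions (induced_space (affine_space (Suc N)) (punctured N))"
  by (rule space_with_functions_induced[OF space_with_functions_affine_space])

lemma points_punctured: "points (induced_space (affine_space (Suc N)) (punctured N)) = punctured N"
  by auto

lemma equiv_proportional: "equiv (punctured N) (proportional (Suc N))"
proof (rule equivI)
  show "proportional (Suc N) \<subseteq> punctured N \<times> punctured N" by (auto simp: proportional_def)
  show "refl_on (punctured N) (proportional (Suc N))"
    by (auto simp: refl_on_def proportional_def intro: exI[of _ 1])
  show "sym (proportional (Suc N))"
  proof (rule symI)
    fix v w assume "(v, w) \<in> proportional (Suc N)"
    then obtain c where vw: "v \<in> punctured N" "w \<in> punctured N" "c \<noteq> 0" "w = (\<lambda>i. c * v i)"
      unfolding proportional_def by auto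
    then have "v = (\<lambda>i. inverse c * w i)" by (simp add: fun_eq_iff)
    then show "(w, v) \<in> proportional (Suc N)" using vw unfolding proportional_def
      by (auto intro!: exI[of _ "inverse c"])
  qed
  show "trans (proportional (Suc N))"
  proof (rule transI)
    fix u v w assume "(u, v) \<in> proportional (Suc N)" "(v, w) \<in> proportional (Suc N)"
    then obtain c d where "u \<in> punctured N" "w \<in> punctured N" "c \<noteq> 0" "v = (\<lambda>i. c * u i)" "d \<noteq> 0" "w = (\<lambda>i. d * v i)"
      unfolding proportional_def by auto
    then show "(u, w) \<in> proportional (Suc N)" unfolding proportional_def
      by (auto intro!: exI[of _ "d * c"] simp: mult.assoc)
  qed
qed

lemma equiv_proportional': "equiv (points (induced_space (affine_space (Suc N)) (punctured N))) (proportional (Suc N))"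
  unfolding points_punctured by (rule equiv_proportional)

lemma space_with_functions_projective_space: "space_with_functions (projective_space N)"
  unfolding projective_space_def
  by (rule space_with_functions_quotient[OF space_with_functions_punctured equiv_proportional'])

lemma points_projective_space: "points (projective_space N) = proj_point N ` punctured N"
  unfolding projective_space_def points_quotient_space[OF equiv_proportional'] points_punctured
  by (auto simp: quotient_def proj_point_def)

lemma proj_pointI: "v \<in> punctured N \<Longrightarrow> proj_point N v \<in> points (projective_space N)"
  unfolding points_projective_space by blast

lemma proj_point_self: "v \<in> punctured N \<Longrightarrow> v \<in> proj_point N v"
  unfolding proj_point_def by (rule equiv_class_self[OF equiv_proportional])

lemma in_proj_point_iff:
  assumes "v \<in> punctured N"
  shows "w \<in> proj_point N v \<longleftrightarrow> (\<exists>c. c \<noteq> 0 \<and> w = (\<lambda>i. c * v i))"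
proof
  assume "\<exists>c. c \<noteq> 0 \<and> w = (\<lambda>i. c * v i)"
  then obtain c where c: "c \<noteq> 0" "w = (\<lambda>i. c * v i)" by blast
  have "w \<in> vectors (Suc N)" using assms c by (auto simp: vectors_def)
  moreover have "w \<noteq> (\<lambda>_. 0)" using assms c by (auto simp: fun_eq_iff)
  ultimately show "w \<in> proj_point N v" using assms c by (auto simp: proj_point_def proportional_def)
qed (auto simp: proj_point_def proportional_def)

lemma proj_point_eq_iff:
  assumes "v \<in> punctured N" "w \<in> punctured N"
  shows "proj_point N v = proj_point N w \<longleftrightarrow> (\<exists>c. c \<noteq> 0 \<and> w = (\<lambda>i. c * v i))"
proof -
  have "proj_point N v = proj_point N w \<longleftrightarrow> (v, w) \<in> proportional (Suc N)"
    unfolding proj_point_def by (rule eq_equiv_class_iff[OF equiv_proportional assms])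
  then show ?thesis using assms by (auto simp: proportional_def)
qed

lemma in_projective_pointD:
  assumes "q \<in> points (projective_space N)" "v \<in> q"
  shows "v \<in> punctured N" "q = proj_point N v"
proof -
  obtain w where w: "w \<in> punctured N" "q = proj_point N w"
    using assms(1) unfolding points_projective_space by blast
  have wv: "(w, v) \<in> proportional (Suc N)" using assms(2) w by (simp add: proj_point_def)
  then show v: "v \<in> punctured N" by (auto simp: proportional_def)
  show "q = proj_point N v"
    unfolding w(2) proj_point_def by (rule equiv_class_eq[OF equiv_proportional wv])
qed

lemma projective_point_nonempty: "q \<in> points (projective_space N) \<Longrightarrow> \<exists>v. v \<in> q"
  unfolding points_projective_space using proj_point_self by blast

lemma morphism_proj_point:
  assumes Z: "space_with_functions Z" and f: "\<And>i. i < Suc N \<Longrightarrow> (\<lambda>z. f z i) \<in> regular Z (points Z)"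
    and vec: "\<And>z. z \<in> points Z \<Longrightarrow> f z \<in> punctured N"
  shows "morphism Z (projective_space N) (\<lambda>z. proj_point N (f z))"
proof -
  have "morphism Z (affine_space (Suc N)) f"
    by (rule morphism_into_affine_space[OF Z f]) (use vec in auto)
  then have "morphism Z (induced_space (affine_space (Suc N)) (punctured N)) f"
    by (rule morphism_into_induced_space[OF Z]) (rule vec)
  from morphism_compose[OF this morphism_quotient_map[OF space_with_functions_punctured equiv_proportional']]
  show ?thesis unfolding projective_space_def proj_point_def .
qed

text \<open>On the chart where the \<open>k\<close>-th coordinate does not vanish, dividing by it gives regular
  homogeneous coordinates; so every morphism into projective space is locally given by regular
  homogeneous coordinates.\<close>

definition chart :: "nat \<Rightarrow> nat \<Rightarrow> (nat \<Rightarrow> complex) set set" where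
  "chart N k = {q \<in> points (projective_space N). \<forall>w\<in>q. w k \<noteq> 0}"

lemma proj_point_in_chart: "v \<in> punctured N \<Longrightarrow> v k \<noteq> 0 \<Longrightarrow> proj_point N v \<in> chart N k"
  unfolding chart_def using proj_pointI in_proj_point_iff by auto

lemma projective_space_chart:
  shows "openin (zariski (projective_space N)) (chart N k)"
    and "\<exists>r. (\<forall>i. (\<lambda>q. r q i) \<in> regular (projective_space N) (chart N k)) \<and>
      (\<forall>q\<in>chart N k. r q \<in> q \<and> r q k = 1)"
proof -
  let ?Y = "induced_space (affine_space (Suc N)) (punctured N)"
  let ?U = "chart N k"
  define rep where "rep q = (SOME w. w \<in> q)" for q :: "(nat \<Rightarrow> complex) set"
  define r where "r q = (\<lambda>i. rep q i / rep q k)" for q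
  have rep: "rep q \<in> q" if "q \<in> points (projective_space N)" for q
    unfolding rep_def by (rule someI_ex[OF projective_point_nonempty[OF that]])
  have UnU: "\<Union>?U = {w \<in> punctured N. w k \<noteq> 0}"
  proof (rule equalityI; rule subsetI)
    fix w assume "w \<in> \<Union>?U"
    then obtain q where "w \<in> q" "q \<in> points (projective_space N)" "w k \<noteq> 0" unfolding chart_def by blast
    then show "w \<in> {w \<in> punctured N. w k \<noteq> 0}" using in_projective_pointD(1) by blast
  next
    fix w assume w: "w \<in> {w \<in> punctured N. w k \<noteq> 0}"
    then have "proj_point N w \<in> ?U" unfolding chart_def using proj_pointI in_proj_point_iff by auto
    then show "w \<in> \<Union>?U" using proj_point_self w by blast
  qed
  have coord: "(\<lambda>x. x i) \<in> regular ?Y (punctured N)" for i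
  proof -
    have "(\<lambda>x. x i) \<in> regular (affine_space (Suc N)) (points (affine_space (Suc N)))"
      unfolding points_affine_space by (rule regular_coordinate)
    from regular_induced_points[OF space_with_functions_affine_space this, of "punctured N"]
    show ?thesis unfolding points_punctured .
  qed
  have oY: "openin (zariski ?Y) {w \<in> punctured N. w k \<noteq> 0}"
    by (rule regular_nonzero_open[OF space_with_functions_punctured coord])
  have oU: "openin (zariski (projective_space N)) ?U"
    unfolding projective_space_def openin_quotient_space[OF equiv_proportional'] UnU
  proof (rule conjI[OF _ oY])
    show "?U \<subseteq> points ?Y // proportional (Suc N)"
      unfolding chart_def projective_space_def points_quotient_space[OF equiv_proportional'] by blast
  qed
  have reg: "(\<lambda>q. r q i) \<in> regular (projective_space N) ?U" for i
    unfolding projective_space_def regular_quotient_space UnU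
  proof (rule conjI[OF oU[unfolded projective_space_def]])
    have "(\<lambda>w. w i / w k) \<in> regular ?Y {w \<in> punctured N. w k \<noteq> 0}"
      by (rule regular_divide[OF space_with_functions_punctured
            regular_restrict[OF space_with_functions_punctured coord oY]
            regular_restrict[OF space_with_functions_punctured coord oY]]) auto
    then show "(\<lambda>w. r (proportional (Suc N) `` {w}) i) \<in> regular ?Y {w \<in> punctured N. w k \<noteq> 0}"
    proof (rule regular_cong[OF space_with_functions_punctured])
      fix w assume w: "w \<in> {w \<in> punctured N. w k \<noteq> 0}"
      then have "rep (proj_point N w) \<in> proj_point N w" using rep proj_pointI by blast
      then obtain c where "c \<noteq> 0" "rep (proj_point N w) = (\<lambda>i. c * w i)"
        using in_proj_point_iff w by blast
      then show "r (proportional (Suc N) `` {w}) i = w i / w k"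
        unfolding proj_point_def[symmetric] r_def by simp
    qed
  qed
  have lift: "r q \<in> q" if q: "q \<in> ?U" for q
  proof -
    have qp: "q \<in> points (projective_space N)" and nz: "rep q k \<noteq> 0" using q rep unfolding chart_def by auto
    have "r q = (\<lambda>i. inverse (rep q k) * rep q i)" unfolding r_def by (simp add: fun_eq_iff divide_inverse mult.commute)
    then have "r q \<in> proj_point N (rep q)"
      using in_proj_point_iff[OF in_projective_pointD(1)[OF qp rep[OF qp]]] nz by (metis inverse_nonzero_iff_nonzero)
    then show ?thesis using in_projective_pointD(2)[OF qp rep[OF qp]] by simp
  qed
  show "openin (zariski (projective_space N)) ?U" by (rule oU)
  have "\<forall>q\<in>?U. r q k = 1"
    using rep unfolding chart_def r_def by auto
  then show "\<exists>r. (\<forall>i. (\<lambda>q. r q i) \<in> regular (projective_space N) ?U) \<and> (\<forall>q\<in>?U. r q \<in> q \<and> r q k = 1)"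
    using reg lift by (intro exI[of _ r] conjI allI ballI) simp_all
qed

lemma morphism_local_lift:
  assumes Z: "space_with_functions Z" and f: "morphism Z (projective_space N) f" and z: "z \<in> points Z"
  obtains U u where "openin (zariski Z) U" "z \<in> U"
    "\<And>i. (\<lambda>x. u x i) \<in> regular Z U" "\<And>x. x \<in> U \<Longrightarrow> u x \<in> f x"
proof -
  obtain v where v: "v \<in> punctured N" "f z = proj_point N v"
    using morphism_maps[OF f z] unfolding points_projective_space by blast
  then obtain k where k: "v k \<noteq> 0" by (auto simp: fun_eq_iff)
  let ?V = "chart N k"
  obtain r where r: "\<forall>i. (\<lambda>q. r q i) \<in> regular (projective_space N) ?V" "\<forall>q\<in>?V. r q \<in> q \<and> r q k = 1"
    using projective_space_chart(2)[of N k] by (elim exE conjE) (rule that)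
  show ?thesis
  proof (rule that[of "{x \<in> points Z. f x \<in> ?V}" "\<lambda>x. r (f x)"])
    show "openin (zariski Z) {x \<in> points Z. f x \<in> ?V}" by (rule morphism_preimage_open[OF f projective_space_chart(1)])
    show "z \<in> {x \<in> points Z. f x \<in> ?V}" using z v k proj_point_in_chart by simp
    show "(\<lambda>x. r (f x) i) \<in> regular Z {x \<in> points Z. f x \<in> ?V}" for i
      by (rule morphism_pullback[OF f r(1)[rule_format]])
    show "r (f x) \<in> f x" if "x \<in> {x \<in> points Z. f x \<in> ?V}" for x using r(2) that by simp
  qed
qed

section \<open>Principal open subsets of the plane\<close>

definition pairvec :: "complex \<Rightarrow> complex \<Rightarrow> nat \<Rightarrow> complex" where
  "pairvec a b = (\<lambda>i. if i = 0 then a else if i = 1 then b else 0)"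

lemma pairvec_simps [simp]: "pairvec a b 0 = a" "pairvec a b (Suc 0) = b" "pairvec a b 1 = b"
  by (simp_all add: pairvec_def)

lemma pairvec_vectors [simp]: "pairvec a b \<in> vectors 2"
  by (simp add: vectors_def pairvec_def)

lemma pairvec_eta: "v \<in> vectors 2 \<Longrightarrow> pairvec (v 0) (v 1) = v"
  by (auto simp: vectors_def pairvec_def fun_eq_iff)

lemma vectors2_eqI: "v \<in> vectors 2 \<Longrightarrow> w \<in> vectors 2 \<Longrightarrow> v 0 = w 0 \<Longrightarrow> v 1 = w 1 \<Longrightarrow> v = w"
  by (metis pairvec_eta)

lemma pairvec_eq_iff [simp]: "pairvec a b = pairvec c d \<longleftrightarrow> a = c \<and> b = d"
  by (metis pairvec_simps(1,2))

lemma polynomial_pairvec: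
  assumes "p \<in> polynomial_functions" "a \<in> polynomial_functions" "b \<in> polynomial_functions"
  shows "(\<lambda>x. p (pairvec (a x) (b x))) \<in> polynomial_functions"
proof -
  have "(\<lambda>x. p (\<lambda>i. (if i = 0 then a else if i = 1 then b else (\<lambda>_. 0)) x)) \<in> polynomial_functions"
    by (rule polynomial_substitute[OF assms(1)]) (use assms polynomial_functions.const in simp)
  moreover have "(\<lambda>i. (if i = 0 then a else if i = 1 then b else (\<lambda>_. 0)) x) = pairvec (a x) (b x)" for x
    by (simp add: pairvec_def fun_eq_iff)
  ultimately show ?thesis by simp
qed

subsection \<open>Polynomial functions of two variables as polynomials\<close>

text \<open>The outer polynomial variable stands for the second coordinate and the inner one for the first,
  so that degree and pseudo-division of univariate polynomials apply in the second coordinate.\<close>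

definition eval2 :: "complex poly poly \<Rightarrow> (nat \<Rightarrow> complex) \<Rightarrow> complex" where
  "eval2 P x = poly (poly P [:x 1:]) (x 0)"

lemma eval2_simps [simp]:
  "eval2 (P + Q) x = eval2 P x + eval2 Q x" "eval2 (P * Q) x = eval2 P x * eval2 Q x"
  "eval2 0 x = 0" "eval2 [:r:] x = poly r (x 0)" "eval2 (P ^ n) x = eval2 P x ^ n"
  by (simp_all add: eval2_def poly_power)

lemma eval2_pCons: "eval2 (pCons r P) x = poly r (x 0) + x 1 * eval2 P x"
  by (simp add: eval2_def)

lemma polynomial_is_eval2:
  assumes "p \<in> polynomial_functions"
  shows "\<exists>P. \<forall>x\<in>vectors 2. p x = eval2 P x"
  using assms
proof induction
  case (const c) show ?case by (intro exI[of _ "[:[:c:]:]"]) simp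
next
  case (coord i)
  consider "i = 0" | "i = 1" | "i \<ge> 2" by linarith
  then show ?case
  proof cases
    case 1 then show ?thesis by (intro exI[of _ "[:[:0, 1:]:]"]) simp
  next
    case 2 then show ?thesis by (intro exI[of _ "[:0, 1:]"]) (simp add: eval2_def)
  next
    case 3 then show ?thesis by (intro exI[of _ 0]) (simp add: vectors_def)
  qed
next
  case (add p q)
  then obtain P Q where "\<forall>x\<in>vectors 2. p x = eval2 P x" "\<forall>x\<in>vectors 2. q x = eval2 Q x" by blast
  then show ?case by (intro exI[of _ "P + Q"]) simp
next
  case (mult p q)
  then obtain P Q where "\<forall>x\<in>vectors 2. p x = eval2 P x" "\<forall>x\<in>vectors 2. q x = eval2 Q x" by blast
  then show ?case by (intro exI[of _ "P * Q"]) simp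
qed

lemma polynomial_poly_coord: "(\<lambda>x. poly r (x i)) \<in> polynomial_functions"
proof (induction r)
  case 0 show ?case using polynomial_functions.const[of 0] by simp
next
  case (pCons a r)
  have "(\<lambda>x. a + x i * poly r (x i)) \<in> polynomial_functions"
    by (intro polynomial_functions.intros pCons.IH)
  then show ?case by simp
qed

lemma eval2_polynomial: "eval2 P \<in> polynomial_functions"
proof (induction P)
  case 0 show ?case using polynomial_functions.const[of 0] by (simp add: eval2_def)
next
  case (pCons r P)
  have "(\<lambda>x. poly r (x 0) + x 1 * eval2 P x) \<in> polynomial_functions"
    by (intro polynomial_functions.intros polynomial_poly_coord pCons.IH)
  moreover have "eval2 (pCons r P) = (\<lambda>x. poly r (x 0) + x 1 * eval2 P x)"
    by (simp add: fun_eq_iff eval2_pCons)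
  ultimately show ?case by simp
qed

lemma poly_ne_all_zero: "r \<noteq> (0 :: complex poly) \<Longrightarrow> \<exists>c. poly r c \<noteq> 0"
  using poly_all_0_iff_0 by blast

text \<open>Only finitely many values of the second coordinate, among infinitely many, turn \<open>P\<close> into the zero
  polynomial in the first.\<close>

lemma eval2_ne_zero:
  assumes "P \<noteq> 0" shows "\<exists>x\<in>vectors 2. eval2 P x \<noteq> 0"
proof -
  have "finite {c. poly P c = 0}" by (rule poly_roots_finite[OF assms])
  moreover have "inj (\<lambda>c::complex. [:c:])" by (rule injI) simp
  ultimately have "finite {c. poly P [:c:] = 0}"
    using finite_vimageI[of "{c. poly P c = 0}" "\<lambda>c. [:c:]"] by (simp add: vimage_def)
  then obtain c where "poly P [:c:] \<noteq> 0"
    using infinite_UNIV_char_0[where 'a=complex] by (metis (mono_tags, lifting) UNIV_I mem_Collect_eq rev_finite_subset subsetI)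
  then obtain a where "poly (poly P [:c:]) a \<noteq> 0" using poly_ne_all_zero by blast
  then show ?thesis by (intro bexI[of _ "pairvec a c"]) (simp_all add: eval2_def)
qed

subsection \<open>Irreducible closed sets\<close>

definition principal_open :: "((nat \<Rightarrow> complex) \<Rightarrow> complex) \<Rightarrow> (nat \<Rightarrow> complex) set" where
  "principal_open h = {x \<in> vectors 2. h x \<noteq> 0}"

definition plane_open :: "((nat \<Rightarrow> complex) \<Rightarrow> complex) \<Rightarrow> (nat \<Rightarrow> complex) fspace" where
  "plane_open h = induced_space (affine_space 2) (principal_open h)"

lemma points_plane_open [simp]: "points (plane_open h) = principal_open h"
  by (auto simp: plane_open_def principal_open_def)

lemma space_with_functions_plane_open: "space_with_functions (plane_open h)"
  unfolding plane_open_def by (rule space_with_functions_induced[OF space_with_functions_affine_space])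

lemma openin_plane_open:
  assumes h: "h \<in> polynomial_functions"
  shows "openin (zariski (plane_open h)) U \<longleftrightarrow>
    U \<subseteq> principal_open h \<and> (\<forall>x\<in>U. \<exists>p\<in>polynomial_functions. p x \<noteq> 0 \<and> (\<forall>y\<in>principal_open h. p y \<noteq> 0 \<longrightarrow> y \<in> U))"
  (is "?L \<longleftrightarrow> ?R")
proof
  assume ?L
  then obtain T where T: "openin (zariski (affine_space 2)) T" "U = T \<inter> principal_open h"
    unfolding plane_open_def zariski_induced_space openin_subtopology by blast
  show ?R
  proof (intro conjI ballI)
    show "U \<subseteq> principal_open h" using T by blast
    fix x assume "x \<in> U"
    then obtain p where "p \<in> polynomial_functions" "p x \<noteq> 0" "\<forall>y\<in>vectors 2. p y \<noteq> 0 \<longrightarrow> y \<in> T"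
      using T unfolding openin_affine_space by blast
    then show "\<exists>p\<in>polynomial_functions. p x \<noteq> 0 \<and> (\<forall>y\<in>principal_open h. p y \<noteq> 0 \<longrightarrow> y \<in> U)"
      using T(2) by (intro bexI[of _ p]) (auto simp: principal_open_def)
  qed
next
  assume R: ?R
  have "openin (zariski (affine_space 2)) U"
    unfolding openin_affine_space
  proof (intro conjI ballI)
    show "U \<subseteq> vectors 2" using R by (auto simp: principal_open_def)
    fix x assume x: "x \<in> U"
    then obtain p where p: "p \<in> polynomial_functions" "p x \<noteq> 0" "\<forall>y\<in>principal_open h. p y \<noteq> 0 \<longrightarrow> y \<in> U"
      using R by blast
    have "x \<in> principal_open h" using R x by blast
    then show "\<exists>p\<in>polynomial_functions. p x \<noteq> 0 \<and> (\<forall>y\<in>vectors 2. p y \<noteq> 0 \<longrightarrow> y \<in> U)"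
      using p by (intro bexI[OF _ polynomial_functions.mult[OF p(1) h]]) (auto simp: principal_open_def)
  qed
  moreover have "U = U \<inter> principal_open h" using R by blast
  ultimately show ?L unfolding plane_open_def zariski_induced_space openin_subtopology by blast
qed

text \<open>A closed set is cut out by the polynomials that vanish on it.\<close>

lemma closedin_plane_open_separate:
  assumes h: "h \<in> polynomial_functions" and C: "closedin (zariski (plane_open h)) C"
    and x: "x \<in> principal_open h" "x \<notin> C"
  obtains p where "p \<in> polynomial_functions" "p x \<noteq> 0" "\<And>y. y \<in> C \<Longrightarrow> p y = 0"
proof -
  have "openin (zariski (plane_open h)) (principal_open h - C)" using C by (simp add: closedin_def)
  then obtain p where p: "p \<in> polynomial_functions" "p x \<noteq> 0" "\<forall>y\<in>principal_open h. p y \<noteq> 0 \<longrightarrow> y \<in> principal_open h - C"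
    using x unfolding openin_plane_open[OF h] by blast
  have "C \<subseteq> principal_open h" using closedin_subset[OF C] by simp
  then show ?thesis using p that[of p] by blast
qed

lemma closedin_zero_set:
  assumes h: "h \<in> polynomial_functions" and p: "p \<in> polynomial_functions"
  shows "closedin (zariski (plane_open h)) {x \<in> principal_open h. p x = 0}"
proof -
  have "principal_open h - {x \<in> principal_open h. p x = 0} = {x \<in> principal_open h. p x \<noteq> 0}" by blast
  moreover have "openin (zariski (plane_open h)) {x \<in> principal_open h. p x \<noteq> 0}"
    unfolding openin_plane_open[OF h] using p by blast
  ultimately show ?thesis by (auto simp: closedin_def)
qed

text \<open>Two closed sets that do not contain \<open>S\<close> are excluded by polynomials that vanish on them and not
  on \<open>S\<close>; a point of \<open>S\<close> where neither polynomial vanishes lies outside of both.\<close>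

lemma irreducible_in_plane_openI:
  assumes h: "h \<in> polynomial_functions" and S: "S \<subseteq> principal_open h" "S \<noteq> {}"
    and irr: "\<And>p q x y. p \<in> polynomial_functions \<Longrightarrow> q \<in> polynomial_functions \<Longrightarrow> x \<in> S \<Longrightarrow> y \<in> S \<Longrightarrow>
      p x \<noteq> 0 \<Longrightarrow> q y \<noteq> 0 \<Longrightarrow> \<exists>z\<in>S. p z \<noteq> 0 \<and> q z \<noteq> 0"
  shows "irreducible_in (zariski (plane_open h)) S"
  unfolding irreducible_in_def
proof (intro conjI allI impI; (elim conjE)?)
  show "S \<noteq> {}" "S \<subseteq> points (plane_open h)" using S by simp_all
  fix C D assume C: "closedin (zariski (plane_open h)) C" and D: "closedin (zariski (plane_open h)) D"
    and CD: "S \<subseteq> C \<union> D"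
  show "S \<subseteq> C \<or> S \<subseteq> D"
  proof (rule ccontr)
    assume "\<not> (S \<subseteq> C \<or> S \<subseteq> D)"
    then obtain x y where x: "x \<in> S" "x \<notin> C" and y: "y \<in> S" "y \<notin> D" by blast
    obtain p where p: "p \<in> polynomial_functions" "p x \<noteq> 0" "\<And>y. y \<in> C \<Longrightarrow> p y = 0"
      using closedin_plane_open_separate[OF h C] x S(1) by blast
    obtain q where q: "q \<in> polynomial_functions" "q y \<noteq> 0" "\<And>y. y \<in> D \<Longrightarrow> q y = 0"
      using closedin_plane_open_separate[OF h D] y S(1) by blast
    obtain z where "z \<in> S" "p z \<noteq> 0" "q z \<noteq> 0" using irr[OF p(1) q(1) x(1) y(1) p(2) q(2)] by blast
    then show False using CD p(3) q(3) by blast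
  qed
qed

lemma irreducible_vanishing_prime:
  assumes h: "h \<in> polynomial_functions" and S: "irreducible_in (zariski (plane_open h)) S"
    and p: "p \<in> polynomial_functions" and q: "q \<in> polynomial_functions"
    and pq: "\<And>x. x \<in> S \<Longrightarrow> p x * q x = 0"
  shows "(\<forall>x\<in>S. p x = 0) \<or> (\<forall>x\<in>S. q x = 0)"
proof -
  have sub: "S \<subseteq> principal_open h" using S by (simp add: irreducible_in_def)
  have "S \<subseteq> {x \<in> principal_open h. p x = 0} \<union> {x \<in> principal_open h. q x = 0}" using sub pq by auto
  then have "S \<subseteq> {x \<in> principal_open h. p x = 0} \<or> S \<subseteq> {x \<in> principal_open h. q x = 0}"
    using S closedin_zero_set[OF h p] closedin_zero_set[OF h q] unfolding irreducible_in_def by blast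
  then show ?thesis by blast
qed

lemma irreducible_principal:
  assumes h: "h \<in> polynomial_functions" and ne: "principal_open h \<noteq> {}"
  shows "irreducible_in (zariski (plane_open h)) (principal_open h)"
proof (rule irreducible_in_plane_openI[OF h order_refl ne])
  fix p q x y assume p: "p \<in> polynomial_functions" and q: "q \<in> polynomial_functions"
    and x: "x \<in> principal_open h" "p x \<noteq> 0" and y: "y \<in> principal_open h" "q y \<noteq> 0"
  obtain P Q H where PQH: "\<forall>x\<in>vectors 2. p x = eval2 P x" "\<forall>x\<in>vectors 2. q x = eval2 Q x"
    "\<forall>x\<in>vectors 2. h x = eval2 H x"
    using polynomial_is_eval2[OF p] polynomial_is_eval2[OF q] polynomial_is_eval2[OF h] by blast
  have "P \<noteq> 0" "Q \<noteq> 0" "H \<noteq> 0" using x y PQH by (auto simp: principal_open_def)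
  then have "P * Q * H \<noteq> 0" by simp
  then obtain z where "z \<in> vectors 2" "eval2 (P * Q * H) z \<noteq> 0" using eval2_ne_zero by blast
  then show "\<exists>z\<in>principal_open h. p z \<noteq> 0 \<and> q z \<noteq> 0"
    using PQH by (intro bexI[of _ z]) (auto simp: principal_open_def)
qed

text \<open>A vertical line meets the open set in a cofinite subset of itself.\<close>

lemma poly_nonzero_on_line:
  assumes "p \<in> polynomial_functions"
  shows "\<exists>r. \<forall>t. p (pairvec a t) = poly r t"
  using assms
proof induction
  case (const c) show ?case by (intro exI[of _ "[:c:]"]) simp
next
  case (coord i)
  consider "i = 0" | "i = 1" | "i \<ge> 2" by linarith
  then show ?case
  proof cases
    case 1 then show ?thesis by (intro exI[of _ "[:a:]"]) simp
  next
    case 2 then show ?thesis by (intro exI[of _ "[:0, 1:]"]) simp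
  next
    case 3 then show ?thesis by (intro exI[of _ 0]) (simp add: pairvec_def)
  qed
next
  case (add p q)
  then obtain r s where "\<forall>t. p (pairvec a t) = poly r t" "\<forall>t. q (pairvec a t) = poly s t" by blast
  then show ?case by (intro exI[of _ "r + s"]) simp
next
  case (mult p q)
  then obtain r s where "\<forall>t. p (pairvec a t) = poly r t" "\<forall>t. q (pairvec a t) = poly s t" by blast
  then show ?case by (intro exI[of _ "r * s"]) simp
qed

lemma irreducible_line:
  assumes h: "h \<in> polynomial_functions" and ne: "h (pairvec a b) \<noteq> 0"
  shows "irreducible_in (zariski (plane_open h)) {x \<in> principal_open h. x 0 = a}"
proof (rule irreducible_in_plane_openI[OF h])
  show "{x \<in> principal_open h. x 0 = a} \<subseteq> principal_open h" by blast
  show "{x \<in> principal_open h. x 0 = a} \<noteq> {}" using ne by (auto simp: principal_open_def intro: exI[of _ "pairvec a b"])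
  fix p q x y assume p: "p \<in> polynomial_functions" and q: "q \<in> polynomial_functions"
    and x: "x \<in> {x \<in> principal_open h. x 0 = a}" "p x \<noteq> 0" and y: "y \<in> {x \<in> principal_open h. x 0 = a}" "q y \<noteq> 0"
  obtain P where P: "\<forall>t. p (pairvec a t) = poly P t" using poly_nonzero_on_line[OF p, of a] by blast
  obtain Q where Q: "\<forall>t. q (pairvec a t) = poly Q t" using poly_nonzero_on_line[OF q, of a] by blast
  obtain H where H: "\<forall>t. h (pairvec a t) = poly H t" using poly_nonzero_on_line[OF h, of a] by blast
  have "x = pairvec a (x 1)" "y = pairvec a (y 1)"
    by (rule vectors2_eqI; use x y in \<open>simp add: principal_open_def\<close>)+
  then have "P \<noteq> 0" "Q \<noteq> 0" using P Q x(2) y(2) by (metis poly_0)+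
  moreover have "H \<noteq> 0" using H ne by auto
  ultimately have "P * Q * H \<noteq> 0" by simp
  then obtain t where "poly (P * Q * H) t \<noteq> 0" using poly_ne_all_zero by blast
  then show "\<exists>z\<in>{x \<in> principal_open h. x 0 = a}. p z \<noteq> 0 \<and> q z \<noteq> 0"
    using P Q H by (intro bexI[of _ "pairvec a t"]) (auto simp: principal_open_def)
qed

subsection \<open>Dimension two\<close>

text \<open>Minimal degree elements are compared by pseudo-division, which takes place in the
  principal ideal domain over the field of rational functions of the first variable. If no
  nonzero polynomial of that variable vanished on \<open>W\<close>, a polynomial \<open>g\<close> of minimal degree in
  the second variable vanishing on \<open>W\<close> would divide, up to factors from the first variable,
  everything that vanishes on \<open>W\<close>; by primality the ideals of \<open>W\<close> and of \<open>Z\<close> would agree.\<close>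

lemma prime_ideals_meet_constants:
  fixes I J :: "complex poly poly set"
  assumes sub: "J \<subseteq> I" "J \<noteq> I" and J0: "\<exists>p\<in>J. p \<noteq> 0"
    and I: "\<And>p q. p \<in> I \<Longrightarrow> q \<in> I \<Longrightarrow> p - q \<in> I" "\<And>p q. p \<in> I \<Longrightarrow> q * p \<in> I"
    and J: "\<And>p q. p \<in> J \<Longrightarrow> q * p \<in> J" "\<And>p q. p * q \<in> J \<Longrightarrow> p \<in> J \<or> q \<in> J"
  shows "\<exists>r. r \<noteq> 0 \<and> [:r:] \<in> I"
proof (rule ccontr)
  assume none: "\<not> (\<exists>r. r \<noteq> 0 \<and> [:r:] \<in> I)"
  define g where "g = (ARG_MIN degree p. p \<in> I \<and> p \<noteq> 0)"
  obtain p0 where p0: "p0 \<in> J" "p0 \<noteq> 0" using J0 by blast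
  have g: "g \<in> I \<and> g \<noteq> 0" and gmin: "\<And>p. p \<in> I \<Longrightarrow> p \<noteq> 0 \<Longrightarrow> degree g \<le> degree p"
    unfolding g_def using arg_min_nat_lemma[of "\<lambda>p. p \<in> I \<and> p \<noteq> 0" p0 degree] p0 sub by auto
  define p where "p = (ARG_MIN degree p. p \<in> J \<and> p \<noteq> 0)"
  have p: "p \<in> J \<and> p \<noteq> 0" and pmin: "\<And>q. q \<in> J \<Longrightarrow> q \<noteq> 0 \<Longrightarrow> degree p \<le> degree q"
    unfolding p_def using arg_min_nat_lemma[of "\<lambda>p. p \<in> J \<and> p \<noteq> 0" p0 degree] p0 by auto
  have dg: "degree g > 0"
  proof (rule ccontr)
    assume "\<not> degree g > 0"
    then obtain r where "g = [:r:]" using degree_0_id by (metis gr_zeroI)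
    then show False using g none by auto
  qed
  define c where "c = lead_coeff g"
  have c: "c \<noteq> 0" using g by (simp add: c_def)
  have notI: "[:c ^ k:] \<notin> I" for k using none power_not_zero[OF c] by blast
  have div: "\<exists>k q. [:c ^ k:] * f = g * q" if f: "f \<in> I" for f
  proof -
    obtain q r where qr: "pseudo_divmod f g = (q, r)" by force
    have eq: "smult (c ^ (Suc (degree f) - degree g)) f = g * q + r" "r = 0 \<or> degree r < degree g"
      using pseudo_divmod[OF _ qr] g by (auto simp: c_def)
    have "[:c ^ (Suc (degree f) - degree g):] * f - q * g \<in> I" using I f g by blast
    moreover have "[:c ^ (Suc (degree f) - degree g):] * f - q * g = r"
      using eq(1) by (simp add: mult.commute)
    ultimately have "r = 0" using eq(2) gmin by force
    then show ?thesis using eq(1) by (intro exI[of _ "Suc (degree f) - degree g"] exI[of _ q]) simp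
  qed
  obtain k q where kq: "[:c ^ k:] * p = g * q" using div p sub by blast
  have "g * q \<in> J" using J(1)[of p "[:c ^ k:]"] p kq by simp
  moreover have "q \<notin> J"
  proof
    assume q: "q \<in> J"
    have "q \<noteq> 0" using kq p c by auto
    then have "degree p \<le> degree q" using pmin q by blast
    moreover have "degree p = degree g + degree q"
      using arg_cong[OF kq, of degree] p g c \<open>q \<noteq> 0\<close> by (simp add: degree_mult_eq)
    ultimately show False using dg by simp
  qed
  ultimately have gJ: "g \<in> J" using J(2) by blast
  have "f \<in> J" if f: "f \<in> I" for f
  proof -
    obtain k q where "[:c ^ k:] * f = g * q" using div f by blast
    then have "[:c ^ k:] * f \<in> J" using J(1)[OF gJ, of q] by (simp add: mult.commute)
    then show ?thesis using J(2) notI sub by blast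
  qed
  then show False using sub by blast
qed

definition vanishing :: "(nat \<Rightarrow> complex) set \<Rightarrow> complex poly poly set" where
  "vanishing S = {P. \<forall>x\<in>S. eval2 P x = 0}"

definition swap2 :: "(nat \<Rightarrow> complex) \<Rightarrow> nat \<Rightarrow> complex" where
  "swap2 x = pairvec (x 1) (x 0)"

lemma swap2_simps [simp]: "swap2 x 0 = x 1" "swap2 x (Suc 0) = x 0" "swap2 x 1 = x 0"
  by (simp_all add: swap2_def)

text \<open>A proper inclusion of nonzero primes gives a nonzero polynomial in the first coordinate that
  vanishes on \<open>W\<close>. It splits into linear factors, and by primality one of them vanishes on \<open>W\<close>.
  The statement speaks of primality instead of irreducibility because it is applied to two
  irreducible closed sets and also to their images under the exchange of the coordinates.\<close>

lemma coordinate_constant: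
  assumes WZ: "W \<subseteq> Z" and W: "W \<noteq> {}" "W \<subseteq> vectors 2" and Z: "Z \<subseteq> vectors 2"
    and primeW: "\<And>p q. p \<in> polynomial_functions \<Longrightarrow> q \<in> polynomial_functions \<Longrightarrow>
      (\<And>x. x \<in> W \<Longrightarrow> p x * q x = 0) \<Longrightarrow> (\<forall>x\<in>W. p x = 0) \<or> (\<forall>x\<in>W. q x = 0)"
    and primeZ: "\<And>p q. p \<in> polynomial_functions \<Longrightarrow> q \<in> polynomial_functions \<Longrightarrow>
      (\<And>x. x \<in> Z \<Longrightarrow> p x * q x = 0) \<Longrightarrow> (\<forall>x\<in>Z. p x = 0) \<or> (\<forall>x\<in>Z. q x = 0)"
    and p: "p \<in> polynomial_functions" "\<forall>x\<in>W. p x = 0" "\<exists>x\<in>Z. p x \<noteq> 0"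
    and q: "q \<in> polynomial_functions" "\<forall>x\<in>Z. q x = 0" "\<exists>x\<in>vectors 2. q x \<noteq> 0"
  shows "\<exists>c. \<forall>x\<in>W. x 0 = c"
proof -
  obtain P where P: "\<forall>x\<in>vectors 2. p x = eval2 P x" using polynomial_is_eval2[OF p(1)] by blast
  obtain Q where Q: "\<forall>x\<in>vectors 2. q x = eval2 Q x" using polynomial_is_eval2[OF q(1)] by blast
  have Pe: "eval2 P x = p x" and Qe: "eval2 Q x = q x" if "x \<in> vectors 2" for x
    using P Q that by simp_all
  have "\<exists>r. r \<noteq> 0 \<and> [:r:] \<in> vanishing W"
  proof (rule prime_ideals_meet_constants[of "vanishing Z" "vanishing W"])
    show "vanishing Z \<subseteq> vanishing W" using WZ by (auto simp: vanishing_def)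
    have "P \<in> vanishing W" "P \<notin> vanishing Z"
      using Pe p(2,3) W(2) Z by (auto simp: vanishing_def subset_iff)
    then show "vanishing Z \<noteq> vanishing W" by blast
    have "Q \<in> vanishing Z" "Q \<noteq> 0"
      using Qe q(2,3) Z by (auto simp: vanishing_def subset_iff)
    then show "\<exists>p\<in>vanishing Z. p \<noteq> 0" by blast
    show "p - q \<in> vanishing W" if "p \<in> vanishing W" "q \<in> vanishing W" for p q
      using that by (simp add: vanishing_def eval2_def)
    show "q * p \<in> vanishing W" if "p \<in> vanishing W" for p q using that by (simp add: vanishing_def)
    show "q * p \<in> vanishing Z" if "p \<in> vanishing Z" for p q using that by (simp add: vanishing_def)
    show "p \<in> vanishing Z \<or> q \<in> vanishing Z" if pq: "p * q \<in> vanishing Z" for p q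
      using primeZ[OF eval2_polynomial[of p] eval2_polynomial[of q]] pq by (simp add: vanishing_def)
  qed
  then obtain r where r: "r \<noteq> 0" "\<forall>x\<in>W. poly r (x 0) = 0" by (auto simp: vanishing_def)
  have "\<exists>c. \<forall>x\<in>W. x 0 = c" if "r \<noteq> 0" "\<forall>x\<in>W. poly r (x 0) = 0" "degree r = n" for r n
    using that
  proof (induction n arbitrary: r)
    case 0
    then obtain a where "r = [:a:]" by (metis degree_0_id)
    then show ?case using 0 W(1) by auto
  next
    case (Suc n)
    have "\<not> constant (poly r)" using Suc.prems(3) by (simp add: constant_degree)
    then obtain c where "poly r c = 0" using fundamental_theorem_of_algebra by blast
    then obtain s where s: "r = [:- c, 1:] * s" using poly_eq_0_iff_dvd by (metis dvdE)
    have "s \<noteq> 0" using s Suc.prems(1) by auto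
    then have "degree r = degree [:- c, 1:] + degree s" unfolding s by (intro degree_mult_eq) simp_all
    then have ds: "degree s = n" using Suc.prems(3) by simp
    have "(\<forall>x\<in>W. x 0 - c = 0) \<or> (\<forall>x\<in>W. poly s (x 0) = 0)"
    proof (rule primeW)
      show "(\<lambda>x. x 0 - c) \<in> polynomial_functions" by (intro polynomial_intros)
      show "(\<lambda>x. poly s (x 0)) \<in> polynomial_functions" by (rule polynomial_poly_coord)
      show "(x 0 - c) * poly s (x 0) = 0" if "x \<in> W" for x using Suc.prems(2) that s by (simp add: algebra_simps)
    qed
    then show ?case using Suc.IH[OF \<open>s \<noteq> 0\<close> _ ds] by (metis eq_iff_diff_eq_0)
  qed
  from this[OF r refl] show ?thesis .
qed

text \<open>Both coordinates are constant on \<open>W\<close>: the previous lemma gives this for the first one, and for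
  the second one after the exchange of the coordinates.\<close>

lemma irreducible_chain_point:
  assumes h: "h \<in> polynomial_functions"
    and W: "irreducible_in (zariski (plane_open h)) W" "closedin (zariski (plane_open h)) W"
    and Z: "irreducible_in (zariski (plane_open h)) Z" "closedin (zariski (plane_open h)) Z"
    and WZ: "W \<subset> Z" and Zne: "Z \<noteq> principal_open h"
  shows "\<exists>x. W = {x}"
proof -
  have sub: "W \<subseteq> principal_open h" "Z \<subseteq> principal_open h" "W \<noteq> {}" using W Z by (auto simp: irreducible_in_def)
  then have vec: "W \<subseteq> vectors 2" "Z \<subseteq> vectors 2" by (auto simp: principal_open_def)
  obtain z where z: "z \<in> Z" "z \<notin> W" using WZ by blast
  obtain p where p: "p \<in> polynomial_functions" "p z \<noteq> 0" "\<And>y. y \<in> W \<Longrightarrow> p y = 0"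
    using closedin_plane_open_separate[OF h W(2), of z] z sub by blast
  obtain w where w: "w \<in> principal_open h" "w \<notin> Z" using Zne sub by blast
  obtain q where q: "q \<in> polynomial_functions" "q w \<noteq> 0" "\<And>y. y \<in> Z \<Longrightarrow> q y = 0"
    using closedin_plane_open_separate[OF h Z(2), of w] w by blast
  have wv: "w \<in> vectors 2" using w by (simp add: principal_open_def)
  note primeW = irreducible_vanishing_prime[OF h W(1)] and primeZ = irreducible_vanishing_prime[OF h Z(1)]
  obtain a where a: "\<forall>x\<in>W. x 0 = a"
    using coordinate_constant[of W Z p q, OF _ sub(3) vec primeW primeZ] WZ p q z wv by blast
  have swp: "(\<lambda>x. f (swap2 x)) \<in> polynomial_functions" if "f \<in> polynomial_functions" for f
    unfolding swap2_def by (rule polynomial_pairvec[OF that]) (rule polynomial_functions.coord)+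
  have sw: "swap2 (swap2 x) = x" if "x \<in> vectors 2" for x
    using that pairvec_eta by (simp add: swap2_def)
  have "\<exists>c. \<forall>x\<in>swap2 ` W. x 0 = c"
  proof (rule coordinate_constant[of "swap2 ` W" "swap2 ` Z" "\<lambda>x. p (swap2 x)" "\<lambda>x. q (swap2 x)"])
    show "swap2 ` W \<subseteq> swap2 ` Z" using WZ by blast
    show "swap2 ` W \<noteq> {}" using sub by blast
    show "swap2 ` W \<subseteq> vectors 2" "swap2 ` Z \<subseteq> vectors 2" by (auto simp: swap2_def)
    show "(\<forall>x\<in>swap2 ` W. f x = 0) \<or> (\<forall>x\<in>swap2 ` W. g x = 0)"
      if "f \<in> polynomial_functions" "g \<in> polynomial_functions" "\<And>x. x \<in> swap2 ` W \<Longrightarrow> f x * g x = 0" for f g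
      using primeW[OF swp[OF that(1)] swp[OF that(2)]] that(3) by simp
    show "(\<forall>x\<in>swap2 ` Z. f x = 0) \<or> (\<forall>x\<in>swap2 ` Z. g x = 0)"
      if "f \<in> polynomial_functions" "g \<in> polynomial_functions" "\<And>x. x \<in> swap2 ` Z \<Longrightarrow> f x * g x = 0" for f g
      using primeZ[OF swp[OF that(1)] swp[OF that(2)]] that(3) by simp
    show "(\<lambda>x. p (swap2 x)) \<in> polynomial_functions" "(\<lambda>x. q (swap2 x)) \<in> polynomial_functions"
      using swp p(1) q(1) by blast+
    show "\<forall>x\<in>swap2 ` W. p (swap2 x) = 0" using p(3) sw vec by auto
    show "\<exists>x\<in>swap2 ` Z. p (swap2 x) \<noteq> 0" using p(2) sw vec z by (intro bexI[of _ "swap2 z"]) auto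
    show "\<forall>x\<in>swap2 ` Z. q (swap2 x) = 0" using q(3) sw vec by auto
    show "\<exists>x\<in>vectors 2. q (swap2 x) \<noteq> 0"
      using q(2) sw wv by (intro bexI[of _ "swap2 w"]) (auto simp: swap2_def)
  qed
  then obtain b where b: "\<forall>x\<in>W. x 1 = b" by auto
  obtain x where x: "x \<in> W" using sub by blast
  have "y = x" if y: "y \<in> W" for y
  proof (rule vectors2_eqI)
    show "y \<in> vectors 2" "x \<in> vectors 2" using x y vec by blast+
    show "y 0 = x 0" "y 1 = x 1" using a b x y by metis+
  qed
  then show ?thesis using x by blast
qed

text \<open>In a chain \<open>Z 0 \<subset> Z 1 \<subset> Z 2 \<subset> Z 3\<close> the set \<open>Z 2\<close> is not the whole space, so \<open>Z 1\<close> is a point and \<open>Z 0\<close> is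
  empty. A point, a vertical line through it and the whole space form a chain of length two.\<close>

lemma dimension_plane_open:
  assumes h: "h \<in> polynomial_functions" and ne: "principal_open h \<noteq> {}"
  shows "dimension (plane_open h) = 2"
proof -
  let ?T = "zariski (plane_open h)"
  let ?chain = "\<lambda>n Z. (\<forall>i\<le>n. closedin ?T (Z i) \<and> irreducible_in ?T (Z i)) \<and> (\<forall>i<n. Z i \<subset> Z (Suc i))"
  let ?S = "{enat n | n. \<exists>Z::nat \<Rightarrow> (nat \<Rightarrow> complex) set. ?chain n Z}"
  have upper: "n \<le> 2" if Z: "?chain n Z" for n Z
  proof (rule ccontr)
    assume "\<not> n \<le> 2"
    then have n: "3 \<le> n" by simp
    have irr: "irreducible_in ?T (Z i)" and cl: "closedin ?T (Z i)" if "i \<le> 3" for i using Z n that by auto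
    have lt: "Z 0 \<subset> Z 1" "Z 1 \<subset> Z 2" "Z 2 \<subset> Z 3" using Z n by (auto simp: numeral_3_eq_3 numeral_2_eq_2)
    have "Z 3 \<subseteq> principal_open h" using irr[of 3] by (simp add: irreducible_in_def)
    then have "Z 2 \<noteq> principal_open h" using lt(3) by blast
    then have "\<exists>x. Z 1 = {x}"
      by (rule irreducible_chain_point[OF h irr cl irr cl lt(2), rotated -1]) simp_all
    then obtain x where "Z 1 = {x}" by (rule exE)
    then have "Z 0 \<subset> {x}" using lt(1) by simp
    then have "Z 0 = {}" by blast
    then show False using irr[of 0] by (simp add: irreducible_in_def)
  qed
  have "enat 2 \<in> ?S"
  proof -
    obtain x where x: "x \<in> principal_open h" using ne by blast
    have xeta: "pairvec (x 0) (x 1) = x" using x pairvec_eta by (simp add: principal_open_def)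
    let ?L = "{y \<in> principal_open h. y 0 = x 0}"
    define Z where "Z i = (if i = 0 then {x} else if i = Suc 0 then ?L else principal_open h)" for i :: nat
    have Z012: "Z 0 = {x}" "Z 1 = ?L" "Z 2 = principal_open h" by (simp_all add: Z_def)
    have point: "closedin ?T {x}"
    proof -
      have "y = x" if "y \<in> principal_open h" "y 0 - x 0 = 0" "y 1 - x 1 = 0" for y
        by (rule vectors2_eqI) (use that x in \<open>simp_all add: principal_open_def\<close>)
      then have "{x} = {y \<in> principal_open h. y 0 - x 0 = 0} \<inter> {y \<in> principal_open h. y 1 - x 1 = 0}"
        using x by auto
      moreover have "closedin ?T ({y \<in> principal_open h. y 0 - x 0 = 0} \<inter> {y \<in> principal_open h. y 1 - x 1 = 0})"
        by (intro closedin_Int closedin_zero_set[OF h] polynomial_intros)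
      ultimately show ?thesis by (simp only:)
    qed
    have line: "closedin ?T ?L"
      using closedin_zero_set[OF h polynomial_diff[OF polynomial_functions.coord[of 0] polynomial_functions.const[of "x 0"]]]
      by simp
    have irrpoint: "irreducible_in ?T {x}" using x by (auto simp: irreducible_in_def)
    have irrline: "irreducible_in ?T ?L"
      by (rule irreducible_line[OF h, of _ "x 1"]) (use x xeta in \<open>simp add: principal_open_def\<close>)
    have infinite_line: "\<exists>t. t \<noteq> x 1 \<and> h (pairvec (x 0) t) \<noteq> 0"
    proof -
      obtain H where H: "\<forall>t. h (pairvec (x 0) t) = poly H t" using poly_nonzero_on_line[OF h] by blast
      have "H \<noteq> 0"
      proof
        assume "H = 0"
        then have "h (pairvec (x 0) (x 1)) = 0" using H by simp
        then show False using x xeta by (simp add: principal_open_def)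
      qed
      then have "H * [:- x 1, 1:] \<noteq> 0" by (simp del: mult_pCons_left mult_pCons_right)
      then obtain t where "poly (H * [:- x 1, 1:]) t \<noteq> 0" using poly_ne_all_zero by blast
      then show ?thesis using H by (intro exI[of _ t]) auto
    qed
    then obtain t where t: "t \<noteq> x 1" "h (pairvec (x 0) t) \<noteq> 0" by blast
    have "pairvec (x 0) t \<in> ?L" using t by (simp add: principal_open_def)
    moreover have "pairvec (x 0) t \<noteq> x" using t(1) by (metis pairvec_simps(3))
    ultimately have lt0: "{x} \<subset> ?L" using x by blast
    obtain P where P: "P \<in> principal_open h" "P 0 \<noteq> x 0"
    proof -
      obtain H where H: "\<forall>y\<in>vectors 2. h y = eval2 H y" using polynomial_is_eval2[OF h] by blast
      have "H \<noteq> 0" using H x by (auto simp: principal_open_def)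
      then have "H * [:[:- x 0, 1:]:] \<noteq> 0" by simp
      then obtain y where y: "y \<in> vectors 2" "eval2 (H * [:[:- x 0, 1:]:]) y \<noteq> 0" using eval2_ne_zero by blast
      note y(2)[unfolded eval2_simps]
      then show ?thesis using H y(1) by (intro that[of y]) (auto simp: principal_open_def)
    qed
    then have lt1: "?L \<subset> principal_open h" by blast
    have plane: "closedin ?T (principal_open h)" using closedin_topspace[of ?T] by simp
    have "closedin ?T (Z i) \<and> irreducible_in ?T (Z i)" if "i \<le> 2" for i
    proof -
      consider "i = 0" | "i = 1" | "i = 2" using \<open>i \<le> 2\<close> by linarith
      then show ?thesis
      proof cases
        case 1 show ?thesis unfolding 1 Z012 using point irrpoint by (rule conjI)
      next
        case 2 show ?thesis unfolding 2 Z012 using line irrline by (rule conjI)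
      next
        case 3 show ?thesis unfolding 3 Z012 using plane irreducible_principal[OF h ne] by (rule conjI)
      qed
    qed
    moreover have "Z i \<subset> Z (Suc i)" if "i < 2" for i
    proof -
      consider "i = 0" | "i = 1" using \<open>i < 2\<close> by linarith
      then show ?thesis
      proof cases
        case 1 then show ?thesis using lt0 Z012 by simp
      next
        case 2 then show ?thesis using lt1 Z012 by (simp add: numeral_2_eq_2)
      qed
    qed
    ultimately show ?thesis by blast
  qed
  moreover have "s \<le> enat 2" if s: "s \<in> ?S" for s
  proof -
    obtain n Z where "s = enat n" "?chain n Z" using s by blast
    then show ?thesis using upper[of n Z] by simp
  qed
  ultimately have "Sup ?S = enat 2" by (rule cSup_eq_maximum)
  then show ?thesis unfolding dimension_def by (simp add: numeral_eq_enat)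
qed

subsection \<open>Topological invariants along an isomorphism\<close>

lemma irreducible_in_image:
  assumes f: "continuous_map T T' f" and S: "irreducible_in T S"
  shows "irreducible_in T' (f ` S)"
  unfolding irreducible_in_def
proof (intro conjI allI impI; (elim conjE)?)
  have sub: "S \<subseteq> topspace T" "S \<noteq> {}" using S by (simp_all add: irreducible_in_def)
  show "f ` S \<noteq> {}" using sub by simp
  show "f ` S \<subseteq> topspace T'" using sub f by (auto simp: continuous_map_def Pi_iff)
  fix C D assume C: "closedin T' C" and D: "closedin T' D" and CD: "f ` S \<subseteq> C \<union> D"
  let ?C = "{x \<in> topspace T. f x \<in> C}" and ?D = "{x \<in> topspace T. f x \<in> D}"
  have "S \<subseteq> ?C \<union> ?D" using CD sub by auto
  moreover have "closedin T ?C" "closedin T ?D"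
    by (rule closedin_continuous_map_preimage[OF f C], rule closedin_continuous_map_preimage[OF f D])
  ultimately have "S \<subseteq> ?C \<or> S \<subseteq> ?D" using S unfolding irreducible_in_def by blast
  then show "f ` S \<subseteq> C \<or> f ` S \<subseteq> D" by auto
qed

lemma dimension_le_isomorphism:
  assumes iso: "isomorphism X Y f g" shows "dimension X \<le> dimension Y"
  unfolding dimension_def
proof (rule Sup_subset_mono, rule subsetI, clarify)
  fix n Z
  assume Z: "\<forall>i\<le>n. closedin (zariski X) (Z i) \<and> irreducible_in (zariski X) (Z i)" "\<forall>i<n. Z i \<subset> Z (Suc i)"
  have cf: "continuous_map (zariski X) (zariski Y) f" and cg: "continuous_map (zariski Y) (zariski X) g"
    using isomorphismD(1,2)[OF iso] by (simp_all add: morphism_def)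
  have gf: "g (f x) = x" if "x \<in> points X" for x using isomorphismD(3)[OF iso that] .
  have fg: "f (g y) = y" "g y \<in> points X" if "y \<in> points Y" for y
    using isomorphismD(4)[OF iso that] morphism_maps[OF isomorphismD(2)[OF iso] that] by simp_all
  have fY: "f x \<in> points Y" if "x \<in> points X" for x
    using morphism_maps[OF isomorphismD(1)[OF iso] that] .
  have sub: "Z i \<subseteq> points X" if "i \<le> n" for i using Z(1) that closedin_subset by blast
  have img: "f ` C = {y \<in> points Y. g y \<in> C}" if "C \<subseteq> points X" for C
  proof (rule equalityI; rule subsetI)
    fix y assume "y \<in> f ` C"
    then obtain x where "x \<in> C" "y = f x" by blast
    then show "y \<in> {y \<in> points Y. g y \<in> C}" using that gf[of x] fY[of x] by auto
  next
    fix y assume y: "y \<in> {y \<in> points Y. g y \<in> C}"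
    then have "y = f (g y)" using fg(1)[of y] by simp
    then show "y \<in> f ` C" using y by blast
  qed
  have "closedin (zariski Y) (f ` Z i) \<and> irreducible_in (zariski Y) (f ` Z i)" if "i \<le> n" for i
    unfolding img[OF sub[OF that]] using closedin_continuous_map_preimage[OF cg, of "Z i"] Z(1) that
      irreducible_in_image[OF cf, of "Z i"] img[OF sub[OF that]] by simp
  moreover have "f ` Z i \<subset> f ` Z (Suc i)" if i: "i < n" for i
  proof -
    have "Z i \<subset> Z (Suc i)" using Z(2) i by simp
    then obtain x where x: "x \<in> Z (Suc i)" "x \<notin> Z i" by blast
    have subs: "Z i \<subseteq> points X" "Z (Suc i) \<subseteq> points X" using sub i by simp_all
    have "f x \<notin> f ` Z i" using x subs gf by (metis (no_types, lifting) image_iff subsetD)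
    moreover have "f ` Z i \<subseteq> f ` Z (Suc i)" using Z(2) i by (intro image_mono) auto
    ultimately show ?thesis using x(1) by blast
  qed
  ultimately show "\<exists>m. enat n = enat m \<and> (\<exists>Z::nat \<Rightarrow> 'b set.
     (\<forall>i\<le>m. closedin (zariski Y) (Z i) \<and> irreducible_in (zariski Y) (Z i)) \<and>
     (\<forall>i<m. Z i \<subset> Z (Suc i)))"
    by (intro exI[of _ n] conjI refl exI[of _ "\<lambda>i. f ` Z i"]) blast+
qed

lemma regular_induced_open_subset:
  assumes X: "space_with_functions X" and S: "openin (zariski X) S" and f: "f \<in> regular (induced_space X S) U"
  shows "f \<in> regular X U"
proof -
  have oU: "openin (zariski X) U"
    using regular_induced_open[OF f] openin_trans_full S by blast
  show ?thesis
  proof (rule regular_local[OF X oU])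
    fix x assume x: "x \<in> U"
    obtain V g where V: "g \<in> regular X V" "x \<in> V" "\<forall>y. y \<in> U \<and> y \<in> V \<longrightarrow> f y = g y"
      using regular_induced_spaceD[OF f x] by (elim exE conjE) (rule that)
    have o: "openin (zariski X) (U \<inter> V)" by (rule openin_Int[OF oU regular_open[OF X V(1)]])
    have "f \<in> regular X (U \<inter> V)"
      by (rule regular_cong[OF X regular_restrict[OF X V(1) o Int_lower2]]) (use V(3) in simp)
    then show "\<exists>V. x \<in> V \<and> V \<subseteq> U \<and> f \<in> regular X V" using x V(2)
      by (intro exI[of _ "U \<inter> V"]) simp
  qed
qed

lemma openin_principal: "h \<in> polynomial_functions \<Longrightarrow> openin (zariski (affine_space 2)) (principal_open h)"
  unfolding principal_open_def by (rule openin_affine_basic)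

subsection \<open>Coordinates on a space isomorphic to a principal open set\<close>

text \<open>Tangent vectors will be the derivatives along the lines parallel to the axes.\<close>

definition coord_line :: "nat \<Rightarrow> (nat \<Rightarrow> complex) \<Rightarrow> complex \<Rightarrow> nat \<Rightarrow> complex" where
  "coord_line i a z = a(i := a i + z)"

lemma coord_line_0 [simp]: "coord_line i a 0 = a"
  by (simp add: coord_line_def)

lemma coord_line_vectors: "i < 2 \<Longrightarrow> a \<in> vectors 2 \<Longrightarrow> coord_line i a z \<in> vectors 2"
  by (simp add: coord_line_def vectors_def)

lemma polynomial_coord_line_DERIV:
  assumes "p \<in> polynomial_functions"
  shows "\<exists>d. ((\<lambda>z. p (coord_line i a z)) has_field_derivative d) (at 0)"
  using assms
proof induction
  case (const c) show ?case using DERIV_const by blast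
next
  case (coord j)
  show ?case
  proof (cases "j = i")
    case True
    have "((\<lambda>z. a i + z) has_field_derivative 0 + 1) (at 0)"
      by (rule DERIV_add[OF DERIV_const DERIV_ident])
    then show ?thesis using True by (auto simp: coord_line_def)
  next
    case False
    then show ?thesis by (intro exI[of _ 0]) (simp add: coord_line_def)
  qed
next
  case (add p q) then show ?case using DERIV_add by blast
next
  case (mult p q) then show ?case using DERIV_mult by blast
qed

lemma polynomial_coord_line_nonzero:
  assumes "p \<in> polynomial_functions" "p a \<noteq> 0"
  shows "eventually (\<lambda>z. p (coord_line i a z) \<noteq> 0) (nhds 0)"
proof -
  obtain d where "((\<lambda>z. p (coord_line i a z)) has_field_derivative d) (at 0)"
    using polynomial_coord_line_DERIV[OF assms(1)] by blast
  then have "((\<lambda>z. p (coord_line i a z)) \<longlongrightarrow> p a) (at 0)"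
    using DERIV_isCont isCont_def by (metis coord_line_0)
  then have "eventually (\<lambda>z. p (coord_line i a z) \<noteq> 0) (at 0)"
    by (rule tendsto_imp_eventually_ne[OF _ assms(2)])
  then show ?thesis using assms(2) by (simp add: eventually_nhds_conv_at)
qed

context
  fixes X :: "'a fspace" and \<phi> \<psi> h
  assumes X: "space_with_functions X" and h: "h \<in> polynomial_functions"
    and iso: "isomorphism X (plane_open h) \<phi> \<psi>"
begin

lemma phi_principal: "x \<in> points X \<Longrightarrow> \<phi> x \<in> principal_open h"
  using morphism_maps[OF isomorphismD(1)[OF iso]] by simp

lemma phi_vectors: "x \<in> points X \<Longrightarrow> \<phi> x \<in> vectors 2"
  using phi_principal by (simp add: principal_open_def)

lemma psi_points: "y \<in> principal_open h \<Longrightarrow> \<psi> y \<in> points X"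
  using morphism_maps[OF isomorphismD(2)[OF iso], of y] by simp

lemma psi_phi: "x \<in> points X \<Longrightarrow> \<psi> (\<phi> x) = x"
  by (rule isomorphismD(3)[OF iso])

lemma phi_psi: "y \<in> principal_open h \<Longrightarrow> \<phi> (\<psi> y) = y"
  using isomorphismD(4)[OF iso, of y] by simp

lemma regular_phi: "(\<lambda>x. \<phi> x i) \<in> regular X (points X)"
proof -
  have m: "morphism X (affine_space 2) \<phi>"
    using morphism_compose[OF isomorphismD(1)[OF iso, unfolded plane_open_def]
        morphism_inclusion[OF space_with_functions_affine_space]] .
  have "{x \<in> points X. \<phi> x \<in> vectors 2} = points X" using phi_vectors by blast
  then show ?thesis using morphism_pullback[OF m regular_coordinate] by simp
qed

lemma regular_polynomial_phi: "p \<in> polynomial_functions \<Longrightarrow> (\<lambda>x. p (\<phi> x)) \<in> regular X (points X)"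
  by (rule regular_polynomial[OF X openin_topspace _ regular_phi])

lemma local_fraction:
  assumes f: "f \<in> regular X U" and x: "x \<in> U"
  shows "\<exists>p q. p \<in> polynomial_functions \<and> q \<in> polynomial_functions \<and> q (\<phi> x) \<noteq> 0 \<and>
    (\<forall>y\<in>vectors 2. q y \<noteq> 0 \<longrightarrow> y \<in> principal_open h \<and> \<psi> y \<in> U \<and> f (\<psi> y) = p y / q y)"
proof -
  have xX: "x \<in> points X" using regular_subset[OF X f] x by blast
  have "(\<lambda>y. f (\<psi> y)) \<in> regular (plane_open h) {y \<in> points (plane_open h). \<psi> y \<in> U}"
    by (rule morphism_pullback[OF isomorphismD(2)[OF iso] f])
  then have r: "(\<lambda>y. f (\<psi> y)) \<in> regular (affine_space 2) {y \<in> principal_open h. \<psi> y \<in> U}"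
    unfolding plane_open_def
    using regular_induced_open_subset[OF space_with_functions_affine_space openin_principal[OF h]]
    by (simp add: plane_open_def[symmetric])
  have m: "\<phi> x \<in> {y \<in> principal_open h. \<psi> y \<in> U}" using x phi_principal[OF xX] psi_phi[OF xX] by simp
  obtain p q where pq: "p \<in> polynomial_functions" "q \<in> polynomial_functions" "q (\<phi> x) \<noteq> 0"
    "\<forall>y\<in>vectors 2. q y \<noteq> 0 \<longrightarrow> y \<in> {y \<in> principal_open h. \<psi> y \<in> U} \<and> f (\<psi> y) = p y / q y"
    using regular_affine_spaceD(2)[OF r m] by (elim exE conjE) (rule that)
  show ?thesis using pq by (intro exI[of _ p] exI[of _ q]) simp
qed

subsection \<open>Tangent spaces\<close>

lemma regular_at_common:
  assumes "f \<in> regular_at X x" "g \<in> regular_at X x"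
  shows "\<exists>U. x \<in> U \<and> f \<in> regular X U \<and> g \<in> regular X U"
proof -
  obtain U where U: "x \<in> U" "f \<in> regular X U" using assms(1) by (auto simp: regular_at_def)
  obtain V where V: "x \<in> V" "g \<in> regular X V" using assms(2) by (auto simp: regular_at_def)
  have o: "openin (zariski X) (U \<inter> V)"
    by (rule openin_Int[OF regular_open[OF X U(2)] regular_open[OF X V(2)]])
  show ?thesis
    by (intro exI[of _ "U \<inter> V"] conjI regular_restrict[OF X U(2) o] regular_restrict[OF X V(2) o]) (use U V in auto)
qed

lemma regular_atI: "f \<in> regular X U \<Longrightarrow> x \<in> U \<Longrightarrow> f \<in> regular_at X x"
  by (auto simp: regular_at_def)

lemma regular_at_add: "f \<in> regular_at X x \<Longrightarrow> g \<in> regular_at X x \<Longrightarrow> (\<lambda>y. f y + g y) \<in> regular_at X x"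
proof -
  assume "f \<in> regular_at X x" "g \<in> regular_at X x"
  then obtain U where U: "x \<in> U" "f \<in> regular X U" "g \<in> regular X U"
    using regular_at_common by blast
  show ?thesis by (rule regular_atI[OF regular_add[OF X U(2,3)] U(1)])
qed

lemma regular_at_mult: "f \<in> regular_at X x \<Longrightarrow> g \<in> regular_at X x \<Longrightarrow> (\<lambda>y. f y * g y) \<in> regular_at X x"
proof -
  assume "f \<in> regular_at X x" "g \<in> regular_at X x"
  then obtain U where U: "x \<in> U" "f \<in> regular X U" "g \<in> regular X U"
    using regular_at_common by blast
  show ?thesis by (rule regular_atI[OF regular_mult[OF X U(2,3)] U(1)])
qed

lemma regular_at_const: "x \<in> points X \<Longrightarrow> (\<lambda>_. c) \<in> regular_at X x"
  by (rule regular_atI[OF regular_const[OF X openin_topspace]])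

lemma regular_at_phi: "x \<in> points X \<Longrightarrow> p \<in> polynomial_functions \<Longrightarrow> (\<lambda>x. p (\<phi> x)) \<in> regular_at X x"
  by (rule regular_atI[OF regular_polynomial_phi])

text \<open>The value zero for functions that are not regular at the point is part of the definition of a
  tangent vector.\<close>

definition partial :: "nat \<Rightarrow> 'a \<Rightarrow> ('a \<Rightarrow> complex) \<Rightarrow> complex" where
  "partial i x f = (if f \<in> regular_at X x
    then THE d. ((\<lambda>z. f (\<psi> (coord_line i (\<phi> x) z))) has_field_derivative d) (at 0) else 0)"

lemma partial_DERIV:
  assumes i: "i < 2" and x: "x \<in> points X" and f: "f \<in> regular_at X x"
  shows "((\<lambda>z. f (\<psi> (coord_line i (\<phi> x) z))) has_field_derivative partial i x f) (at 0)"
proof -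
  obtain U where U: "x \<in> U" "f \<in> regular X U" using f by (auto simp: regular_at_def)
  obtain p q where pq: "p \<in> polynomial_functions" "q \<in> polynomial_functions" "q (\<phi> x) \<noteq> 0"
    and eq: "\<forall>y\<in>vectors 2. q y \<noteq> 0 \<longrightarrow> y \<in> principal_open h \<and> \<psi> y \<in> U \<and> f (\<psi> y) = p y / q y"
    using local_fraction[OF U(2,1)] by (elim exE conjE) (rule that)
  obtain a where a: "((\<lambda>z. p (coord_line i (\<phi> x) z)) has_field_derivative a) (at 0)"
    using polynomial_coord_line_DERIV[OF pq(1)] by blast
  obtain b where b: "((\<lambda>z. q (coord_line i (\<phi> x) z)) has_field_derivative b) (at 0)"
    using polynomial_coord_line_DERIV[OF pq(2)] by blast
  have d: "((\<lambda>z. p (coord_line i (\<phi> x) z) / q (coord_line i (\<phi> x) z)) has_field_derivative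
     (a * q (coord_line i (\<phi> x) 0) - p (coord_line i (\<phi> x) 0) * b) / (q (coord_line i (\<phi> x) 0) * q (coord_line i (\<phi> x) 0))) (at 0)"
    by (rule DERIV_divide[OF a b]) (simp add: pq(3))
  have "eventually (\<lambda>z. f (\<psi> (coord_line i (\<phi> x) z)) = p (coord_line i (\<phi> x) z) / q (coord_line i (\<phi> x) z)) (nhds 0)"
    using polynomial_coord_line_nonzero[OF pq(2,3), of i]
    by (rule eventually_mono) (use eq coord_line_vectors[OF i phi_vectors[OF x]] in blast)
  from DERIV_cong_ev[OF refl this refl, THEN iffD2, OF d]
  have "\<exists>d. ((\<lambda>z. f (\<psi> (coord_line i (\<phi> x) z))) has_field_derivative d) (at 0)" by (rule exI)
  then have "\<exists>!d. ((\<lambda>z. f (\<psi> (coord_line i (\<phi> x) z))) has_field_derivative d) (at 0)"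
    using DERIV_unique by (elim exE) (rule ex1I)
  from theI'[OF this] show ?thesis using f by (simp add: partial_def)
qed

lemma partial_unique:
  assumes "i < 2" "x \<in> points X" "f \<in> regular_at X x"
    and "((\<lambda>z. f (\<psi> (coord_line i (\<phi> x) z))) has_field_derivative d) (at 0)"
  shows "partial i x f = d"
  by (rule DERIV_unique[OF partial_DERIV[OF assms(1-3)] assms(4)])

lemma partial_tangent:
  assumes i: "i < 2" and x: "x \<in> points X"
  shows "partial i x \<in> tangent_space X x"
proof -
  let ?l = "coord_line i (\<phi> x)"
  have l0: "\<psi> (?l 0) = x" by (simp add: psi_phi[OF x])
  note D = partial_DERIV[OF i x] and uniq = partial_unique[OF i x]
  have outside: "partial i x f = 0" if "f \<notin> regular_at X x" for f using that by (simp add: partial_def)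
  have germ: "partial i x f = partial i x g" if f: "f \<in> regular_at X x" and g: "g \<in> regular_at X x"
    and U: "openin (zariski X) U" "x \<in> U" "\<forall>y\<in>U. f y = g y" for f g U
  proof (rule uniq[OF f])
    \<comment> \<open>A local fraction for the constant one has its domain of definition inside \<open>U\<close>, which gives a basic neighbourhood.\<close>
    have one: "(\<lambda>_. 1) \<in> regular X U" by (rule regular_const[OF X U(1)])
    obtain p q where pq: "p \<in> polynomial_functions" "q \<in> polynomial_functions" "q (\<phi> x) \<noteq> 0"
      and eq: "\<forall>y\<in>vectors 2. q y \<noteq> 0 \<longrightarrow> y \<in> principal_open h \<and> \<psi> y \<in> U \<and> 1 = p y / q y"
      using local_fraction[OF one U(2)] by (elim exE conjE) (rule that)
    have "eventually (\<lambda>z. f (\<psi> (?l z)) = g (\<psi> (?l z))) (nhds 0)"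
      using polynomial_coord_line_nonzero[OF pq(2,3), of i]
      by (rule eventually_mono) (use eq coord_line_vectors[OF i phi_vectors[OF x]] U(3) in blast)
    from DERIV_cong_ev[OF refl this refl, THEN iffD2, OF D[OF g]]
    show "((\<lambda>z. f (\<psi> (?l z))) has_field_derivative partial i x g) (at 0)" .
  qed
  have add: "partial i x (\<lambda>y. f y + g y) = partial i x f + partial i x g"
    if f: "f \<in> regular_at X x" and g: "g \<in> regular_at X x" for f g
    by (rule uniq[OF regular_at_add[OF f g] DERIV_add[OF D[OF f] D[OF g]]])
  have scale: "partial i x (\<lambda>y. c * f y) = c * partial i x f" if f: "f \<in> regular_at X x" for c f
    by (rule uniq[OF regular_at_mult[OF regular_at_const[OF x] f] DERIV_cmult[OF D[OF f]]])
  have mult: "partial i x (\<lambda>y. f y * g y) = f x * partial i x g + g x * partial i x f"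
    if f: "f \<in> regular_at X x" and g: "g \<in> regular_at X x" for f g
  proof -
    have "partial i x (\<lambda>y. f y * g y) = partial i x f * g (\<psi> (?l 0)) + partial i x g * f (\<psi> (?l 0))"
      by (rule uniq[OF regular_at_mult[OF f g] DERIV_mult[OF D[OF f] D[OF g]]])
    then show ?thesis unfolding l0 by (simp add: algebra_simps)
  qed
  show ?thesis unfolding tangent_space_def
  proof (intro CollectI conjI allI ballI impI; (elim exE conjE)?)
    fix f g U assume "f \<in> regular_at X x" "g \<in> regular_at X x" "openin (zariski X) U" "x \<in> U" "\<forall>y\<in>U. f y = g y"
    then show "partial i x f = partial i x g" by (rule germ)
  qed (simp_all add: outside add scale mult)
qed

lemma partial_coordinate:
  assumes i: "i < 2" and x: "x \<in> points X"
  shows "partial i x (\<lambda>x. \<phi> x j) = (if i = j then 1 else 0)"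
proof (rule partial_unique[OF i x])
  show "(\<lambda>x. \<phi> x j) \<in> regular_at X x" by (rule regular_atI[OF regular_phi x])
  have hx: "h (\<phi> x) \<noteq> 0" using phi_principal[OF x] by (simp add: principal_open_def)
  have ev: "eventually (\<lambda>z. \<phi> (\<psi> (coord_line i (\<phi> x) z)) j = \<phi> x j + (if i = j then z else 0)) (nhds 0)"
    using polynomial_coord_line_nonzero[OF h hx, of i]
  proof (rule eventually_mono)
    fix z assume "h (coord_line i (\<phi> x) z) \<noteq> 0"
    then have "coord_line i (\<phi> x) z \<in> principal_open h"
      using coord_line_vectors[OF i phi_vectors[OF x]] by (simp add: principal_open_def)
    then show "\<phi> (\<psi> (coord_line i (\<phi> x) z)) j = \<phi> x j + (if i = j then z else 0)"
      using phi_psi by (simp add: coord_line_def)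
  qed
  have "((\<lambda>z. \<phi> x j + (if i = j then z else 0)) has_field_derivative (if i = j then 1 else 0)) (at 0)"
  proof (cases "i = j")
    case True
    have "((\<lambda>z. \<phi> x j + z) has_field_derivative 0 + 1) (at 0)"
      by (rule DERIV_add[OF DERIV_const DERIV_ident])
    then show ?thesis using True by simp
  qed simp
  from DERIV_cong_ev[OF refl ev refl, THEN iffD2, OF this]
  show "((\<lambda>z. \<phi> (\<psi> (coord_line i (\<phi> x) z)) j) has_field_derivative (if i = j then 1 else 0)) (at 0)" .
qed

text \<open>A derivation kills constants, so it is determined on polynomials by its values on the
  coordinates, and on fractions by the quotient rule.\<close>

lemma tangent_vector_zero:
  assumes x: "x \<in> points X" and D: "D \<in> tangent_space X x"
    and D0: "D (\<lambda>x. \<phi> x 0) = 0" "D (\<lambda>x. \<phi> x 1) = 0"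
  shows "D f = 0"
proof (cases "f \<in> regular_at X x")
  case False then show ?thesis using D by (simp add: tangent_space_def)
next
  case True
  have germ: "D f = D g" if "f \<in> regular_at X x" "g \<in> regular_at X x" "openin (zariski X) U" "x \<in> U" "\<And>y. y \<in> U \<Longrightarrow> f y = g y" for f g U
    using D that unfolding tangent_space_def by blast
  have additive: "D (\<lambda>y. f y + g y) = D f + D g" if "f \<in> regular_at X x" "g \<in> regular_at X x" for f g
    using D that by (simp add: tangent_space_def)
  have scale: "D (\<lambda>y. c * f y) = c * D f" if "f \<in> regular_at X x" for c f
    using D that by (simp add: tangent_space_def)
  have leibniz: "D (\<lambda>y. f y * g y) = f x * D g + g x * D f" if "f \<in> regular_at X x" "g \<in> regular_at X x" for f g
    using D that by (simp add: tangent_space_def)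
  have c: "D (\<lambda>_. c) = 0" for c
  proof -
    have "D (\<lambda>_. 1) = 0" using leibniz[of "\<lambda>_. 1" "\<lambda>_. 1"] regular_at_const[OF x] by simp
    then show ?thesis using scale[of "\<lambda>_. 1" c] regular_at_const[OF x] by simp
  qed
  have poly: "D (\<lambda>x. p (\<phi> x)) = 0" if "p \<in> polynomial_functions" for p
    using that
  proof induction
    case (const a) show ?case by (rule c)
  next
    case (coord i)
    consider "i = 0" | "i = 1" | "i \<ge> 2" by linarith
    then show ?case
    proof cases
      case 3
      have "D (\<lambda>x. \<phi> x i) = D (\<lambda>_. 0)"
        by (rule germ[OF regular_atI[OF regular_phi x] regular_at_const[OF x] openin_topspace x])
           (use phi_vectors 3 in \<open>simp add: vectors_def\<close>)
      then show ?thesis using c by simp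
    qed (use D0 in simp_all)
  next
    case (add p q) then show ?case using additive[OF regular_at_phi[OF x] regular_at_phi[OF x]] by simp
  next
    case (mult p q) then show ?case using leibniz[OF regular_at_phi[OF x] regular_at_phi[OF x]] by simp
  qed
  obtain U where U: "x \<in> U" "f \<in> regular X U" using True by (auto simp: regular_at_def)
  obtain p q where pq: "p \<in> polynomial_functions" "q \<in> polynomial_functions" "q (\<phi> x) \<noteq> 0"
    and eq: "\<forall>y\<in>vectors 2. q y \<noteq> 0 \<longrightarrow> y \<in> principal_open h \<and> \<psi> y \<in> U \<and> f (\<psi> y) = p y / q y"
    using local_fraction[OF U(2,1)] by (elim exE conjE) (rule that)
  have "D (\<lambda>y. f y * q (\<phi> y)) = D (\<lambda>y. p (\<phi> y))"
  proof (rule germ[OF regular_at_mult[OF True regular_at_phi[OF x pq(2)]] regular_at_phi[OF x pq(1)]])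
    show "openin (zariski X) {y \<in> points X. q (\<phi> y) \<noteq> 0}"
      by (rule regular_nonzero_open[OF X regular_polynomial_phi[OF pq(2)]])
    show "x \<in> {y \<in> points X. q (\<phi> y) \<noteq> 0}" using x pq(3) by simp
    fix y assume y: "y \<in> {y \<in> points X. q (\<phi> y) \<noteq> 0}"
    then have "f (\<psi> (\<phi> y)) = p (\<phi> y) / q (\<phi> y)" using eq phi_vectors by blast
    then show "f y * q (\<phi> y) = p (\<phi> y)" using y psi_phi by simp
  qed
  then show ?thesis using leibniz[OF True regular_at_phi[OF x pq(2)]] poly[OF pq(1)] poly[OF pq(2)] pq(3) by simp
qed

text \<open>The partial derivatives are independent because they are dual to the coordinates. They span
  because a tangent vector minus its expansion in them kills both coordinates.\<close>

lemma tangent_dim_two: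
  assumes x: "x \<in> points X" shows "tangent_dim X x = 2"
proof -
  interpret V: vector_space "\<lambda>(c::complex) D f. c * D f" 
    by unfold_locales (auto simp: fun_eq_iff algebra_simps)
  let ?d0 = "partial 0 x" and ?d1 = "partial 1 x" and ?u = "\<lambda>j x. \<phi> x j"
  let ?T = "tangent_space X x"
  have val: "?d0 (?u 0) = 1" "?d0 (?u 1) = 0" "?d1 (?u 0) = 0" "?d1 (?u 1) = 1"
    using partial_coordinate[OF _ x] by simp_all
  have mem: "?d0 \<in> ?T" "?d1 \<in> ?T" using partial_tangent[OF _ x] by simp_all
  have comb: "(\<lambda>f. D f - (a * D' f + b * E f)) \<in> ?T" if D: "D \<in> ?T" "D' \<in> ?T" "E \<in> ?T" for D D' E a b
  proof -
    have 1: "D (\<lambda>y. f y + g y) = D f + D g" "D (\<lambda>y. f y * g y) = f x * D g + g x * D f"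
      if "D \<in> ?T" "f \<in> regular_at X x" "g \<in> regular_at X x" for D f g using that by (simp_all add: tangent_space_def)
    have 2: "D (\<lambda>y. c * f y) = c * D f" if "D \<in> ?T" "f \<in> regular_at X x" for D f c
      using that by (simp add: tangent_space_def)
    have 3: "D f = 0" if "D \<in> ?T" "f \<notin> regular_at X x" for D f using that by (simp add: tangent_space_def)
    have 4: "D f = D g" if "D \<in> ?T" "f \<in> regular_at X x" "g \<in> regular_at X x"
      "openin (zariski X) U" "x \<in> U" "\<forall>y\<in>U. f y = g y" for D f g U
      using that unfolding tangent_space_def by blast
    show ?thesis unfolding tangent_space_def
    proof (intro CollectI conjI allI ballI impI; (elim exE conjE)?)
      fix f g U assume "f \<in> regular_at X x" "g \<in> regular_at X x" "openin (zariski X) U" "x \<in> U" "\<forall>y\<in>U. f y = g y"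
      then have "D f = D g" "D' f = D' g" "E f = E g" using 4 D by blast+
      then show "D f - (a * D' f + b * E f) = D g - (a * D' g + b * E g)" by simp
    qed (simp_all add: 1[OF D(1)] 1[OF D(2)] 1[OF D(3)] 2[OF D(1)] 2[OF D(2)] 2[OF D(3)]
        3[OF D(1)] 3[OF D(2)] 3[OF D(3)] algebra_simps)
  qed
  have span: "?T \<subseteq> V.span {?d0, ?d1}"
  proof
    fix D assume D: "D \<in> ?T"
    let ?a = "D (?u 0)" and ?b = "D (?u 1)"
    have zero: "D f - (?a * ?d0 f + ?b * ?d1 f) = 0" for f
      by (rule tangent_vector_zero[OF x comb[OF D mem]]) (simp_all add: val val[unfolded One_nat_def])
    have eq: "D = (\<lambda>f. ?a * ?d0 f) + (\<lambda>f. ?b * ?d1 f)"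
      unfolding plus_fun_def by (rule ext) (rule right_minus_eq[THEN iffD1, OF zero])
    show "D \<in> V.span {?d0, ?d1}"
      by (subst eq) (intro V.span_add V.span_scale V.span_base insertI1 insertI2)
  qed
  have ne: "?d0 \<noteq> ?d1" using val by (metis zero_neq_one)
  have "?d1 \<noteq> 0"
  proof
    assume "?d1 = 0"
    then have "?d1 (?u 1) = 0" by (simp only: zero_fun_apply)
    then show False using val(4) by simp
  qed
  then have ind1: "V.independent {?d1}" by (simp add: V.dependent_single)
  have "?d0 \<notin> V.span {?d1}"
  proof
    assume "?d0 \<in> V.span {?d1}"
    then obtain k where "?d0 = (\<lambda>f. k * ?d1 f)" unfolding V.span_singleton by blast
    then have "?d0 (?u 0) = k * ?d1 (?u 0)" by (rule fun_cong)
    then show False using val by simp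
  qed
  then have ind: "V.independent {?d0, ?d1}" using ind1 ne by (simp add: V.independent_insert)
  have "V.dim ?T = 2"
    by (rule V.dim_unique[OF _ span ind]) (use mem ne in simp_all)
  then show ?thesis unfolding tangent_dim_def .
qed

subsection \<open>Smooth rational surfaces\<close>

text \<open>The coordinates are regular on the whole space and separate its points. Their differences
  between the two factors are regular on the product, and the diagonal is the common zero locus of
  these differences.\<close>

lemma separated_by_coordinates: "separated X"
proof -
  let ?P = "product_space {0, 1::nat} (\<lambda>_. X)"
  have fin: "finite {0, 1::nat}" "{0, 1::nat} \<noteq> {}" by simp_all
  have P: "space_with_functions ?P" by (rule space_with_functions_product[OF fin X])
  have pts: "points ?P = Pi\<^sub>E {0, 1} (\<lambda>_. points X)" by (rule points_product_space[OF fin X])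
  have coord: "(\<lambda>x. \<phi> (x k) i) \<in> regular ?P (points ?P)" if "k \<in> {0, 1}" for k i
  proof -
    have m: "morphism ?P X (\<lambda>x. x k)" by (rule morphism_projection[OF fin X that])
    have "{x \<in> points ?P. x k \<in> points X} = points ?P" using morphism_maps[OF m] by blast
    then show ?thesis using morphism_pullback[OF m regular_phi[of i]] by simp
  qed
  have o: "openin (zariski ?P) {x \<in> points ?P. \<phi> (x 0) i - \<phi> (x 1) i \<noteq> 0}" for i
    by (rule regular_nonzero_open[OF P regular_diff[OF P coord coord]]) simp_all
  have "points ?P - {x \<in> points ?P. x 0 = x 1} = (\<Union>i. {x \<in> points ?P. \<phi> (x 0) i - \<phi> (x 1) i \<noteq> 0})"
  proof (rule equalityI; rule subsetI)
    fix x assume x: "x \<in> points ?P - {x \<in> points ?P. x 0 = x 1}"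
    then have "x 0 \<in> points X" "x 1 \<in> points X" unfolding pts by auto
    then have "\<phi> (x 0) \<noteq> \<phi> (x 1)" using psi_phi x by (metis (mono_tags, lifting) DiffE mem_Collect_eq)
    then show "x \<in> (\<Union>i. {x \<in> points ?P. \<phi> (x 0) i - \<phi> (x 1) i \<noteq> 0})" using x by (auto simp: fun_eq_iff)
  qed auto
  moreover have "openin (zariski ?P) (\<Union>i. {x \<in> points ?P. \<phi> (x 0) i - \<phi> (x 1) i \<noteq> 0})"
    using o by blast
  ultimately show ?thesis unfolding separated_def Let_def closedin_def by auto
qed

end

definition triplevec :: "complex \<Rightarrow> complex \<Rightarrow> complex \<Rightarrow> nat \<Rightarrow> complex" where
  "triplevec a b c = (\<lambda>i. if i = 0 then a else if i = 1 then b else if i = 2 then c else 0)"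

lemma triplevec_simps [simp]:
  "triplevec a b c 0 = a" "triplevec a b c 1 = b" "triplevec a b c (Suc 0) = b" "triplevec a b c 2 = c"
  "triplevec a b c \<in> vectors 3"
  by (simp_all add: triplevec_def vectors_def)

lemma triplevec_eta: "v \<in> vectors 3 \<Longrightarrow> triplevec (v 0) (v 1) (v 2) = v"
  by (auto simp: vectors_def triplevec_def fun_eq_iff)

lemma regular_plane_open_coordinate: "(\<lambda>x. x i) \<in> regular (plane_open h) (principal_open h)"
proof -
  have "(\<lambda>x. x i) \<in> regular (affine_space 2) (points (affine_space 2))" using regular_coordinate by simp
  from regular_induced_points[OF space_with_functions_affine_space this, of "principal_open h"]
  show ?thesis unfolding plane_open_def[symmetric] by simp
qed

text \<open>The graph of \<open>1 / h\<close> is closed in three-space: it is the locus where \<open>h\<close> times the third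
  coordinate is one.\<close>

lemma isomorphic_plane_open_closed:
  assumes h: "h \<in> polynomial_functions"
  defines "Z \<equiv> {x \<in> vectors 3. h (pairvec (x 0) (x 1)) * x 2 - 1 = 0}"
  shows "closedin (zariski (affine_space 3)) Z"
    and "isomorphism (plane_open h) (induced_space (affine_space 3) Z)
      (\<lambda>x. triplevec (x 0) (x 1) (inverse (h x))) (\<lambda>y. pairvec (y 0) (y 1))"
proof -
  let ?D = "plane_open h" and ?Y = "induced_space (affine_space 3) Z"
  note D = space_with_functions_plane_open[of h]
  have Y: "space_with_functions ?Y" by (rule space_with_functions_induced[OF space_with_functions_affine_space])
  let ?g = "\<lambda>x. h (pairvec (x 0) (x 1)) * x 2 - 1"
  have g: "?g \<in> polynomial_functions"
    by (intro polynomial_intros polynomial_pairvec[OF h])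
  have "vectors 3 - Z = {x \<in> vectors 3. ?g x \<noteq> 0}" unfolding Z_def by blast
  then show "closedin (zariski (affine_space 3)) Z"
    using openin_affine_basic[OF g, of 3] unfolding closedin_def points_affine_space by (auto simp: Z_def)
  have pY: "points ?Y = Z" by (auto simp: Z_def)
  have oD: "openin (zariski ?D) (principal_open h)" using openin_topspace[of "zariski ?D"] by simp
  show "isomorphism ?D ?Y (\<lambda>x. triplevec (x 0) (x 1) (inverse (h x))) (\<lambda>y. pairvec (y 0) (y 1))"
    unfolding isomorphism_def
  proof (intro conjI ballI)
    have hreg: "(\<lambda>x. inverse (h x)) \<in> regular ?D (principal_open h)"
    proof -
      have "{x \<in> principal_open h. h x \<noteq> 0} = principal_open h" by (auto simp: principal_open_def)
      moreover have "h \<in> regular ?D (principal_open h)"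
        using regular_polynomial[OF D oD h, of "\<lambda>x. x"] regular_plane_open_coordinate by simp
      ultimately show ?thesis using regular_inverse[OF D, of h "principal_open h"] by simp
    qed
    show "morphism ?D ?Y (\<lambda>x. triplevec (x 0) (x 1) (inverse (h x)))"
    proof (rule morphism_into_induced_space[OF D morphism_into_affine_space[OF D]])
      show "(\<lambda>x. triplevec (x 0) (x 1) (inverse (h x)) i) \<in> regular ?D (points ?D)" if "i < 3" for i
      proof -
        consider "i = 0" | "i = 1" | "i = 2" using \<open>i < 3\<close> by linarith
        then show ?thesis using regular_plane_open_coordinate hreg by cases simp_all
      qed
      show "triplevec (x 0) (x 1) (inverse (h x)) \<in> Z" if "x \<in> points ?D" for x
        using that pairvec_eta[of x] by (auto simp: Z_def principal_open_def)
    qed simp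
    show "morphism ?Y ?D (\<lambda>y. pairvec (y 0) (y 1))"
      unfolding plane_open_def
    proof (rule morphism_into_induced_space[OF Y morphism_into_affine_space[OF Y]])
      have c: "(\<lambda>y. y i) \<in> regular ?Y (points ?Y)" for i
      proof -
        have "(\<lambda>x. x i) \<in> regular (affine_space 3) (points (affine_space 3))" using regular_coordinate by simp
        from regular_induced_points[OF space_with_functions_affine_space this, of Z] show ?thesis .
      qed
      show "(\<lambda>y. pairvec (y 0) (y 1) i) \<in> regular ?Y (points ?Y)" if "i < 2" for i
      proof -
        consider "i = 0" | "i = 1" using \<open>i < 2\<close> by linarith
        then show ?thesis using c by cases simp_all
      qed
      show "pairvec (y 0) (y 1) \<in> principal_open h" if "y \<in> points ?Y" for y
        using that unfolding pY by (auto simp: Z_def principal_open_def)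
    qed simp
    show "pairvec (triplevec (x 0) (x 1) (inverse (h x)) 0) (triplevec (x 0) (x 1) (inverse (h x)) 1) = x"
      if "x \<in> points ?D" for x using that pairvec_eta by (simp add: principal_open_def)
    show "triplevec (pairvec (y 0) (y 1) 0) (pairvec (y 0) (y 1) 1) (inverse (h (pairvec (y 0) (y 1)))) = y"
      if "y \<in> points ?Y" for y
    proof -
      have y: "y \<in> vectors 3" "h (pairvec (y 0) (y 1)) * y 2 = 1" using that unfolding pY Z_def by simp_all
      then have "inverse (h (pairvec (y 0) (y 1))) = y 2" by (metis inverse_unique)
      then show ?thesis using triplevec_eta[OF y(1)] by simp
    qed
  qed
qed

text \<open>The chart of the projective plane where the first homogeneous coordinate does not vanish is a
  plane.\<close>

lemma plane_open_in_projective_plane: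
  assumes h: "h \<in> polynomial_functions"
  shows "\<exists>V f g. openin (zariski (projective_space 2)) V \<and>
    isomorphism (plane_open h) (induced_space (projective_space 2) V) f g"
proof -
  let ?P = "projective_space 2" and ?D = "plane_open h" and ?U = "chart 2 0"
  note P = space_with_functions_projective_space[of 2] and D = space_with_functions_plane_open[of h]
  obtain r where r: "\<forall>i. (\<lambda>q. r q i) \<in> regular ?P ?U" "\<forall>q\<in>?U. r q \<in> q \<and> r q 0 = 1"
    using projective_space_chart(2)[of 2 0] by (elim exE conjE) (rule that)
  note oU = projective_space_chart(1)[of 2 0]
  define c where "c q = pairvec (r q 1) (r q 2)" for q
  define f where "f x = proj_point 2 (triplevec 1 (x 0) (x 1))" for x :: "nat \<Rightarrow> complex"
  have creg: "(\<lambda>q. c q i) \<in> regular ?P ?U" for i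
  proof -
    consider "i = 0" | "i = 1" | "i \<noteq> 0" "i \<noteq> 1" by blast
    then show ?thesis
      using r(1) regular_const[OF P oU, of 0] by cases (simp_all add: c_def pairvec_def)
  qed
  have hc: "(\<lambda>q. h (c q)) \<in> regular ?P ?U" by (rule regular_polynomial[OF P oU h creg])
  define V where "V = {q \<in> ?U. h (c q) \<noteq> 0}"
  have oV: "openin (zariski ?P) V" unfolding V_def by (rule regular_nonzero_open[OF P hc])
  let ?Y = "induced_space ?P V"
  have Y: "space_with_functions ?Y" by (rule space_with_functions_induced[OF P])
  have pY: "points ?Y = V" using openin_subset[OF oV] by auto
  have pun: "triplevec 1 a b \<in> punctured 2" for a b
  proof -
    have "triplevec 1 a b \<in> vectors (Suc 2)" using triplevec_simps(5)[of 1 a b] by (simp add: eval_nat_numeral)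
    moreover have "triplevec 1 a b \<noteq> (\<lambda>_. 0)"
    proof
      assume "triplevec 1 a b = (\<lambda>_. 0)"
      from fun_cong[OF this, of 0] show False by simp
    qed
    ultimately show ?thesis by simp
  qed
  have sub: "V \<subseteq> ?U" unfolding V_def by blast
  have rf: "r (f x) = triplevec 1 (x 0) (x 1)" and fU: "f x \<in> ?U" for x
  proof -
    show fU: "f x \<in> ?U" unfolding f_def by (rule proj_point_in_chart[OF pun]) simp
    then obtain k where k: "r (f x) = (\<lambda>i. k * triplevec 1 (x 0) (x 1) i)" "r (f x) 0 = 1"
      using r(2) in_proj_point_iff[OF pun] unfolding f_def by blast
    then have "k = 1" by simp
    then show "r (f x) = triplevec 1 (x 0) (x 1)" using k(1) by simp
  qed
  have cf: "c (f x) = x" if "x \<in> vectors 2" for x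
    using pairvec_eta[OF that] by (simp add: c_def rf)
  have fc: "f (c q) = q" if q: "q \<in> ?U" for q
  proof -
    have qp: "q \<in> points ?P" using q by (simp add: chart_def)
    have rq: "r q \<in> q" "r q 0 = 1" using r(2) q by simp_all
    have "r q \<in> vectors 3" using in_projective_pointD(1)[OF qp rq(1)] by (simp add: numeral_3_eq_3 numeral_2_eq_2)
    then have "triplevec 1 (c q 0) (c q 1) = r q" using triplevec_eta[of "r q"] rq(2) by (simp add: c_def)
    then show ?thesis unfolding f_def using in_projective_pointD(2)[OF qp rq(1)] by simp
  qed
  have "isomorphism ?D ?Y f c"
    unfolding isomorphism_def
  proof (intro conjI ballI)
    have "morphism ?D ?P f"
      unfolding f_def
    proof (rule morphism_proj_point[OF D _ pun])
      fix i :: nat assume "i < Suc 2"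
      then consider "i = 0" | "i = 1" | "i = 2" by linarith
      then show "(\<lambda>x. triplevec 1 (x 0) (x 1) i) \<in> regular ?D (points ?D)"
        using regular_plane_open_coordinate regular_const[OF D openin_topspace, of 1] by cases simp_all
    qed
    then show "morphism ?D ?Y f"
    proof (rule morphism_into_induced_space[OF D])
      fix x assume "x \<in> points ?D"
      then show "f x \<in> V" unfolding V_def using fU cf by (simp add: principal_open_def)
    qed
    show "morphism ?Y ?D c"
      unfolding plane_open_def
    proof (rule morphism_into_induced_space[OF Y morphism_into_affine_space[OF Y]])
      show "(\<lambda>q. c q i) \<in> regular ?Y (points ?Y)" for i
      proof -
        have "{q \<in> points ?Y. q \<in> ?U} = points ?Y" using pY sub by blast
        then show ?thesis using morphism_pullback[OF morphism_inclusion[OF P, of V] creg[of i]] by simp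
      qed
      show "c q \<in> principal_open h" if "q \<in> points ?Y" for q
        using that unfolding pY V_def principal_open_def by (simp add: c_def)
    qed (simp add: c_def)
    show "c (f x) = x" if "x \<in> points ?D" for x using that cf by (simp add: principal_open_def)
    show "f (c q) = q" if "q \<in> points ?Y" for q using that fc pY sub by blast
  qed
  then show ?thesis using oV by blast
qed

text \<open>The whole space is a single affine chart. Irreducibility and dimension are carried over from the
  plane by the homeomorphism, the tangent spaces are computed in its coordinates, and followed by
  the embedding of the plane in the projective plane it is a birational map.\<close>

theorem smooth_rational_surface_plane_open:
  assumes X: "space_with_functions X" and h: "h \<in> polynomial_functions"
    and iso: "isomorphism X (plane_open h) \<phi> \<psi>" and ne: "points X \<noteq> {}"
  shows "smooth_rational_surface X"
proof -
  have hne: "principal_open h \<noteq> {}" using ne phi_principal[OF X h iso] by blast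
  have dim: "dimension X = 2"
    using dimension_le_isomorphism[OF iso] dimension_le_isomorphism[OF isomorphism_sym[OF iso]]
      dimension_plane_open[OF h hne] by simp
  have irr: "irreducible_in (zariski X) (points X)"
  proof -
    have c: "continuous_map (zariski (plane_open h)) (zariski X) \<psi>"
      using isomorphismD(2)[OF iso] by (simp add: morphism_def)
    have "\<psi> ` principal_open h = points X"
    proof (rule equalityI; rule subsetI)
      fix x assume "x \<in> \<psi> ` principal_open h"
      then show "x \<in> points X" using psi_points[OF X h iso] by blast
    next
      fix x assume x: "x \<in> points X"
      then show "x \<in> \<psi> ` principal_open h"
        using psi_phi[OF X h iso x] phi_principal[OF X h iso x] by (metis imageI)
    qed
    then show ?thesis using irreducible_in_image[OF c irreducible_principal[OF h hne]] by simp
  qed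
  note iX = isomorphism_induced_points[OF X]
  have aff: "affine_variety (induced_space X (points X))"
    unfolding affine_variety_def isomorphic_def
    using isomorphism_compose[OF isomorphism_compose[OF iX iso] isomorphic_plane_open_closed(2)[OF h]]
      isomorphic_plane_open_closed(1)[OF h] by blast
  have var: "variety X"
    unfolding variety_def
    using X separated_by_coordinates[OF X h iso] irr aff by (intro conjI exI[of _ "{points X}"]) auto
  have rat: "rational X"
  proof -
    obtain V f g where V: "openin (zariski (projective_space 2)) V"
      and fg: "isomorphism (plane_open h) (induced_space (projective_space 2) V) f g"
      using plane_open_in_projective_plane[OF h] by blast
    have "V \<noteq> {}" using morphism_maps[OF isomorphismD(1)[OF fg]] hne by auto
    then have "birational X (projective_space 2)"
      unfolding birational_def isomorphic_def
      using V ne isomorphism_compose[OF isomorphism_compose[OF iX iso] fg]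
      by (intro exI[of _ "points X"] exI[of _ V] conjI exI) auto
    then show ?thesis unfolding rational_def by blast
  qed
  have "smooth X" unfolding smooth_def
    using tangent_dim_two[OF X h iso] dim by (simp add: numeral_eq_enat)
  then show ?thesis unfolding smooth_rational_surface_def using var dim rat by simp
qed

section \<open>Automorphisms of the projective line\<close>

subsection \<open>Regular functions on the affine line are polynomials\<close>

definition linevec :: "complex \<Rightarrow> nat \<Rightarrow> complex" where
  "linevec t = (\<lambda>i. if i = 0 then t else 0)"

lemma linevec_simps [simp]: "linevec t 0 = t" "linevec t \<in> vectors (Suc 0)"
  by (simp_all add: linevec_def vectors_def)

lemma polynomial_on_line:
  assumes "p \<in> polynomial_functions" shows "\<exists>P. \<forall>t. p (linevec t) = poly P t"
  using assms
proof induction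
  case (const c) show ?case by (intro exI[of _ "[:c:]"]) simp
next
  case (coord i)
  show ?case
  proof (cases "i = 0")
    case True then show ?thesis by (intro exI[of _ "[:0, 1:]"]) simp
  next
    case False then show ?thesis by (intro exI[of _ 0]) (simp add: linevec_def)
  qed
next
  case (add p q)
  then obtain P Q where "\<forall>t. p (linevec t) = poly P t" "\<forall>t. q (linevec t) = poly Q t" by blast
  then show ?case by (intro exI[of _ "P + Q"]) simp
next
  case (mult p q)
  then obtain P Q where "\<forall>t. p (linevec t) = poly P t" "\<forall>t. q (linevec t) = poly Q t" by blast
  then show ?case by (intro exI[of _ "P * Q"]) simp
qed

lemma poly_cofinite_identity:
  fixes P Q B :: "complex poly"
  assumes "B \<noteq> 0" "\<And>t. poly B t \<noteq> 0 \<Longrightarrow> poly P t = poly Q t"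
  shows "P = Q"
proof -
  have "poly (B * (P - Q)) t = 0" for t using assms(2)[of t] by (cases "poly B t = 0") auto
  then have "B * (P - Q) = 0" using poly_all_0_iff_0 by blast
  then show ?thesis using assms(1) by simp
qed

text \<open>Among the denominators of a regular function take one of minimal degree. At a root of it
  the numerator vanishes as well, and a local representation near the root shows that the common
  linear factor can be cancelled.\<close>

lemma regular_affine_line_polynomial:
  assumes f: "f \<in> regular (affine_space (Suc 0)) (vectors (Suc 0))"
  shows "\<exists>P. \<forall>t. f (linevec t) = poly P t"
proof -
  have loc: "\<exists>A B. poly B c \<noteq> 0 \<and> (\<forall>t. poly B t \<noteq> 0 \<longrightarrow> poly B t * f (linevec t) = poly A t)" for c
  proof -
    have c: "linevec c \<in> vectors (Suc 0)" by simp
    obtain p q where pq: "p \<in> polynomial_functions" "q \<in> polynomial_functions" "q (linevec c) \<noteq> 0"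
      and eq: "\<forall>y\<in>vectors (Suc 0). q y \<noteq> 0 \<longrightarrow> y \<in> vectors (Suc 0) \<and> f y = p y / q y"
      using regular_affine_spaceD(2)[OF f c] by (elim exE conjE) (rule that)
    obtain A where A: "\<forall>t. p (linevec t) = poly A t" using polynomial_on_line[OF pq(1)] by blast
    obtain B where B: "\<forall>t. q (linevec t) = poly B t" using polynomial_on_line[OF pq(2)] by blast
    have "poly B t * f (linevec t) = poly A t" if "poly B t \<noteq> 0" for t
    proof -
      have "f (linevec t) = p (linevec t) / q (linevec t)" using eq that B by simp
      then show ?thesis using that A B by simp
    qed
    then show ?thesis using pq(3) B by (intro exI[of _ A] exI[of _ B]) simp
  qed
  define good where "good Q \<longleftrightarrow> Q \<noteq> 0 \<and> (\<exists>P. \<forall>t. poly Q t * f (linevec t) = poly P t)" for Q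
  obtain A B where AB: "poly B 0 \<noteq> 0" "\<forall>t. poly B t \<noteq> 0 \<longrightarrow> poly B t * f (linevec t) = poly A t"
    using loc by blast
  have "good (B * B)"
    unfolding good_def
  proof (intro conjI exI[of _ "B * A"] allI)
    show "B * B \<noteq> 0" using AB(1) by auto
    show "poly (B * B) t * f (linevec t) = poly (B * A) t" for t
      using AB(2) by (cases "poly B t = 0") (simp_all add: mult.assoc)
  qed
  then obtain Q where Q: "good Q" and min: "\<And>Q'. good Q' \<Longrightarrow> degree Q \<le> degree Q'"
    using ex_has_least_nat[of good "B * B" degree] by blast
  obtain P where P: "\<forall>t. poly Q t * f (linevec t) = poly P t" using Q unfolding good_def by blast
  have "degree Q = 0"
  proof (rule ccontr)
    assume "degree Q \<noteq> 0"
    then have "\<not> constant (poly Q)" by (simp add: constant_degree)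
    then obtain c where c: "poly Q c = 0" using fundamental_theorem_of_algebra by blast
    then have "poly P c = 0" using P by (metis mult_zero_left)
    then obtain P1 where P1: "P = [:- c, 1:] * P1" using poly_eq_0_iff_dvd by (metis dvdE)
    obtain Q1 where Q1: "Q = [:- c, 1:] * Q1" using c poly_eq_0_iff_dvd by (metis dvdE)
    have Q10: "Q1 \<noteq> 0" using Q Q1 unfolding good_def by auto
    have off: "poly Q1 t * f (linevec t) = poly P1 t" if "t \<noteq> c" for t
    proof -
      have "(t - c) * (poly Q1 t * f (linevec t)) = (t - c) * poly P1 t"
        using P[rule_format, of t] unfolding P1 Q1 by (simp add: algebra_simps)
      then show ?thesis using that by simp
    qed
    obtain A B where AB: "poly B c \<noteq> 0" "\<forall>t. poly B t \<noteq> 0 \<longrightarrow> poly B t * f (linevec t) = poly A t"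
      using loc by blast
    have "Q1 * A = P1 * B"
    proof (rule poly_cofinite_identity[of "B * [:- c, 1:]"])
      show "B * [:- c, 1:] \<noteq> 0" using AB(1) by (auto simp del: mult_pCons_left mult_pCons_right)
      fix t assume "poly (B * [:- c, 1:]) t \<noteq> 0"
      then have t: "poly B t \<noteq> 0" "t \<noteq> c" by auto
      have "poly Q1 t * poly A t = poly Q1 t * f (linevec t) * poly B t" using AB(2) t(1) by (metis mult.assoc mult.commute)
      then show "poly (Q1 * A) t = poly (P1 * B) t" using off[OF t(2)] by simp
    qed
    then have "poly Q1 c * poly A c = poly P1 c * poly B c" by (metis poly_mult)
    moreover have "poly A c = poly B c * f (linevec c)" using AB by simp
    ultimately have "poly B c * (poly Q1 c * f (linevec c)) = poly B c * poly P1 c" by (simp add: algebra_simps)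
    then have "poly Q1 c * f (linevec c) = poly P1 c" using AB(1) by simp
    then have "good Q1" unfolding good_def using Q10 off by (intro conjI exI[of _ P1] allI) metis+
    from min[OF this] have "degree Q \<le> degree Q1" .
    moreover have "degree Q = degree [:- c, 1:] + degree Q1" unfolding Q1 using Q10 by (intro degree_mult_eq) simp_all
    ultimately show False by simp
  qed
  then obtain a where a: "Q = [:a:]" by (metis degree_0_id)
  then have "a \<noteq> 0" using Q unfolding good_def by auto
  then have "f (linevec t) = poly (smult (inverse a) P) t" for t
    using P[rule_format, of t] a by (simp add: field_simps)
  then show ?thesis by blast
qed

subsection \<open>Points of the projective line\<close>

abbreviation "P1 \<equiv> projective_space (Suc 0)"

definition pt :: "(nat \<Rightarrow> complex) \<Rightarrow> (nat \<Rightarrow> complex) set" where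
  "pt v = proj_point (Suc 0) v"

definition br :: "(nat \<Rightarrow> complex) \<Rightarrow> (nat \<Rightarrow> complex) \<Rightarrow> complex" where
  "br v w = v 0 * w 1 - v 1 * w 0"

definition nzvec :: "(nat \<Rightarrow> complex) set" where
  "nzvec = vectors 2 - {\<lambda>_. 0}"

lemma punctured_line: "punctured (Suc 0) = nzvec"
  by (simp add: nzvec_def numeral_2_eq_2)

lemma nzvec_iff: "v \<in> nzvec \<longleftrightarrow> v \<in> vectors 2 \<and> (v 0 \<noteq> 0 \<or> v 1 \<noteq> 0)"
proof -
  have "v = (\<lambda>_. 0) \<longleftrightarrow> v 0 = 0 \<and> v 1 = 0" if "v \<in> vectors 2"
    using vectors2_eqI[OF that, of "\<lambda>_. 0"] by (auto simp: vectors_def)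
  then show ?thesis by (auto simp: nzvec_def)
qed

lemma pairvec_nzvec [simp]: "pairvec a b \<in> nzvec \<longleftrightarrow> a \<noteq> 0 \<or> b \<noteq> 0"
  by (simp add: nzvec_iff)

lemma points_P1: "points P1 = pt ` nzvec"
  unfolding points_projective_space punctured_line pt_def by simp

lemma pt_eq_scale_iff: "v \<in> nzvec \<Longrightarrow> w \<in> nzvec \<Longrightarrow> pt v = pt w \<longleftrightarrow> (\<exists>c. c \<noteq> 0 \<and> w = (\<lambda>i. c * v i))"
  unfolding pt_def by (rule proj_point_eq_iff) (simp_all only: punctured_line)

lemma pt_eq_iff:
  assumes v: "v \<in> nzvec" and w: "w \<in> nzvec"
  shows "pt v = pt w \<longleftrightarrow> br v w = 0"
proof
  assume "pt v = pt w"
  then obtain c where "w = (\<lambda>i. c * v i)" using pt_eq_scale_iff[OF v w] by blast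
  then show "br v w = 0" by (simp add: br_def mult.left_commute)
next
  assume b: "br v w = 0"
  have vv: "v \<in> vectors 2" "w \<in> vectors 2" using v w by (simp_all add: nzvec_def)
  define c where "c = (if v 0 \<noteq> 0 then w 0 / v 0 else w 1 / v 1)"
  have e: "w 0 = c * v 0" "w 1 = c * v 1"
    using b v w unfolding c_def br_def nzvec_iff by (auto simp: field_simps)
  have "w = (\<lambda>i. c * v i)"
    by (rule vectors2_eqI) (use vv e in \<open>auto simp: vectors_def\<close>)
  moreover have "c \<noteq> 0" using e w unfolding nzvec_iff by auto
  ultimately show "pt v = pt w" using pt_eq_scale_iff[OF v w] by blast
qed

lemma in_pt_iff: "v \<in> nzvec \<Longrightarrow> w \<in> pt v \<longleftrightarrow> (\<exists>c. c \<noteq> 0 \<and> w = (\<lambda>i. c * v i))"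
  unfolding pt_def by (rule in_proj_point_iff) (simp only: punctured_line)

lemma pt_self: "v \<in> nzvec \<Longrightarrow> v \<in> pt v"
  unfolding pt_def by (rule proj_point_self) (simp only: punctured_line)

lemma in_P1D: "q \<in> points P1 \<Longrightarrow> v \<in> q \<Longrightarrow> v \<in> nzvec \<and> q = pt v"
  using in_projective_pointD[of q "Suc 0" v] unfolding punctured_line pt_def by simp

lemma pt_cases:
  assumes "q \<in> points P1"
  obtains "q = pt (pairvec 1 0)" | t where "q = pt (pairvec t 1)"
proof -
  obtain v where v: "v \<in> nzvec" "q = pt v" using assms unfolding points_P1 by blast
  show ?thesis
  proof (cases "v 1 = 0")
    case True
    then have "q = pt (pairvec 1 0)" using v pt_eq_iff[OF v(1), of "pairvec 1 0"] by (simp add: br_def)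
    then show ?thesis by (rule that(1))
  next
    case False
    then have "q = pt (pairvec (v 0 / v 1) 1)"
      using v pt_eq_iff[OF v(1), of "pairvec (v 0 / v 1) 1"] by (simp add: br_def)
    then show ?thesis by (rule that(2))
  qed
qed

lemma pt_affine_eq_iff: "pt (pairvec t 1) = pt (pairvec u 1) \<longleftrightarrow> t = u"
  by (subst pt_eq_iff) (auto simp: br_def)

lemma pt_affine_ne_infinity: "pt (pairvec t 1) \<noteq> pt (pairvec 1 0)"
  by (subst pt_eq_iff) (auto simp: br_def)

text \<open>A morphism that sends no finite point to infinity restricts to a regular function on the affine
  line, hence to a polynomial.\<close>

lemma morphism_fixing_infinity_polynomial:
  assumes f: "morphism P1 P1 f" and inf: "\<And>t. f (pt (pairvec t 1)) \<noteq> pt (pairvec 1 0)"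
  shows "\<exists>P. \<forall>t. f (pt (pairvec t 1)) = pt (pairvec (poly P t) 1)"
proof -
  let ?A = "affine_space (Suc 0)"
  note A = space_with_functions_affine_space[of "Suc 0"]
  have oA: "openin (zariski ?A) (points ?A)" by (rule openin_topspace)
  have m: "morphism ?A P1 (\<lambda>x. pt (pairvec (x 0) 1))"
    unfolding pt_def
  proof (rule morphism_proj_point[OF A])
    show "pairvec (x 0) 1 \<in> punctured (Suc 0)" for x :: "nat \<Rightarrow> complex" unfolding punctured_line by simp
    fix i assume "i < Suc (Suc 0)"
    then consider "i = 0" | "i = 1" by linarith
    then show "(\<lambda>x. pairvec (x 0) 1 i) \<in> regular ?A (points ?A)"
      using regular_coordinate[of 0 "Suc 0"] regular_const[OF A oA, of 1] by cases simp_all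
  qed
  have mf: "morphism ?A P1 (\<lambda>x. f (pt (pairvec (x 0) 1)))" by (rule morphism_compose[OF m f])
  obtain r where r: "\<forall>i. (\<lambda>q. r q i) \<in> regular P1 (chart (Suc 0) 1)" "\<forall>q\<in>chart (Suc 0) 1. r q \<in> q \<and> r q 1 = 1"
    using projective_space_chart(2)[of "Suc 0" 1] by (elim exE conjE) (rule that)
  have fin: "f (pt (pairvec t 1)) \<in> points P1" for t
    by (rule morphism_maps[OF f]) (simp add: points_P1)
  have ch: "f (pt (pairvec t 1)) \<in> chart (Suc 0) 1" for t
  proof -
    obtain u where u: "f (pt (pairvec t 1)) = pt (pairvec u 1)"
      by (rule pt_cases[OF fin[of t]]) (use inf[of t] in auto)
    then show ?thesis using proj_point_in_chart[of "pairvec u 1" "Suc 0" 1]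
      unfolding punctured_line pt_def by simp
  qed
  have "{x \<in> points ?A. f (pt (pairvec (x 0) 1)) \<in> chart (Suc 0) 1} = vectors (Suc 0)" using ch by simp
  then have "(\<lambda>x. r (f (pt (pairvec (x 0) 1))) 0) \<in> regular ?A (vectors (Suc 0))"
    using morphism_pullback[OF mf r(1)[rule_format, of 0]] by simp
  from regular_affine_line_polynomial[OF this]
  obtain P where P: "\<forall>t. r (f (pt (pairvec t 1))) 0 = poly P t" by auto
  have "f (pt (pairvec t 1)) = pt (pairvec (poly P t) 1)" for t
  proof -
    let ?v = "r (f (pt (pairvec t 1)))"
    have v: "?v \<in> f (pt (pairvec t 1))" "?v 1 = 1" using r(2) ch[of t] by simp_all
    have nz: "?v \<in> nzvec" and eq: "f (pt (pairvec t 1)) = pt ?v" using in_P1D[OF fin v(1)] by simp_all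
    have "?v = pairvec (poly P t) 1"
      by (rule vectors2_eqI) (use nz P v(2) in \<open>simp_all add: nzvec_def\<close>)
    then show ?thesis using eq by simp
  qed
  then show ?thesis by blast
qed

text \<open>An automorphism that fixes infinity is, together with its inverse, given by a polynomial;
  degrees multiply under composition, so both have degree one.\<close>

lemma automorphism_fixing_three_points:
  assumes iso: "isomorphism P1 P1 \<phi> \<psi>"
    and fix3: "\<phi> (pt (pairvec 1 0)) = pt (pairvec 1 0)" "\<phi> (pt (pairvec 0 1)) = pt (pairvec 0 1)"
      "\<phi> (pt (pairvec 1 1)) = pt (pairvec 1 1)"
    and z: "z \<in> points P1"
  shows "\<phi> z = z"
proof -
  have mem: "pt (pairvec t 1) \<in> points P1" "pt (pairvec 1 0) \<in> points P1" for t by (simp_all add: points_P1)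
  have psi_inf: "\<psi> (pt (pairvec 1 0)) = pt (pairvec 1 0)"
    using isomorphismD(3)[OF iso mem(2)] fix3(1) by simp
  have "\<phi> (pt (pairvec t 1)) \<noteq> pt (pairvec 1 0)" for t
    using isomorphismD(3)[OF iso mem(1)[of t]] psi_inf pt_affine_ne_infinity[of t] by metis
  from morphism_fixing_infinity_polynomial[OF isomorphismD(1)[OF iso] this]
  obtain P where P: "\<And>t. \<phi> (pt (pairvec t 1)) = pt (pairvec (poly P t) 1)" by blast
  have "\<psi> (pt (pairvec t 1)) \<noteq> pt (pairvec 1 0)" for t
    using isomorphismD(4)[OF iso mem(1)[of t]] fix3(1) pt_affine_ne_infinity[of t] by metis
  from morphism_fixing_infinity_polynomial[OF isomorphismD(2)[OF iso] this]
  obtain Q where Q: "\<And>t. \<psi> (pt (pairvec t 1)) = pt (pairvec (poly Q t) 1)" by blast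
  have "poly (pcompose Q P) t = poly [:0, 1:] t" for t
    using isomorphismD(3)[OF iso mem(1)[of t]] by (simp add: P Q pt_affine_eq_iff poly_pcompose)
  then have "pcompose Q P = [:0, 1:]" using poly_eq_poly_eq_iff[of "pcompose Q P" "[:0, 1:]"] by (simp add: fun_eq_iff)
  then have "degree Q * degree P = 1" using degree_pcompose[of Q P] by simp
  then have "degree P = 1" by simp
  then obtain a b where ab: "P = [:b, a:]" by (metis degree1_coeffs)
  have "poly P 0 = 0" "poly P 1 = 1" using P[of 0] P[of 1] fix3(2,3) by (simp_all add: pt_affine_eq_iff)
  then have "P = [:0, 1:]" using ab by simp
  then have "\<phi> (pt (pairvec t 1)) = pt (pairvec t 1)" for t using P[of t] by simp
  then show ?thesis using fix3(1) by (rule_tac pt_cases[OF z]) auto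
qed

subsection \<open>Linear automorphisms\<close>

definition lin :: "complex \<Rightarrow> complex \<Rightarrow> complex \<Rightarrow> complex \<Rightarrow> (nat \<Rightarrow> complex) \<Rightarrow> nat \<Rightarrow> complex" where
  "lin a b c d v = pairvec (a * v 0 + b * v 1) (c * v 0 + d * v 1)"

lemma lin_scale: "lin a b c d (\<lambda>i. k * v i) = (\<lambda>i. k * lin a b c d v i)"
  by (simp add: lin_def pairvec_def fun_eq_iff algebra_simps)

lemma br_lin: "br (lin a b c d v) (lin a b c d w) = (a * d - b * c) * br v w"
  by (simp add: br_def lin_def algebra_simps)

lemma lin_adjugate:
  assumes "v \<in> vectors 2"
  shows "lin d (- b) (- c) a (lin a b c d v) = (\<lambda>i. (a * d - b * c) * v i)"
proof (rule vectors2_eqI)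
  show "lin d (- b) (- c) a (lin a b c d v) \<in> vectors 2" by (simp add: lin_def)
  show "(\<lambda>i. (a * d - b * c) * v i) \<in> vectors 2" using assms by (simp add: vectors_def)
qed (simp_all add: lin_def algebra_simps)

lemma lin_nzvec:
  assumes det: "a * d - b * c \<noteq> 0" and v: "v \<in> nzvec"
  shows "lin a b c d v \<in> nzvec"
proof -
  have "lin a b c d v 0 \<noteq> 0 \<or> lin a b c d v 1 \<noteq> 0"
  proof (rule ccontr)
    assume "\<not> ?thesis"
    then have e: "a * v 0 + b * v 1 = 0" "c * v 0 + d * v 1 = 0" by (simp_all add: lin_def)
    have "(a * d - b * c) * v 0 = d * (a * v 0 + b * v 1) - b * (c * v 0 + d * v 1)"
      "(a * d - b * c) * v 1 = a * (c * v 0 + d * v 1) - c * (a * v 0 + b * v 1)" by (simp_all add: algebra_simps)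
    then show False using e det v by (simp add: nzvec_iff)
  qed
  then show ?thesis by (simp add: nzvec_iff lin_def)
qed

definition mob :: "complex \<Rightarrow> complex \<Rightarrow> complex \<Rightarrow> complex \<Rightarrow> (nat \<Rightarrow> complex) set \<Rightarrow> (nat \<Rightarrow> complex) set" where
  "mob a b c d q = lin a b c d ` q"

lemma pt_eq_image:
  assumes v: "v \<in> nzvec" shows "pt v = (\<lambda>k i. k * v i) ` {k. k \<noteq> 0}"
proof (rule Set.set_eqI)
  fix w show "w \<in> pt v \<longleftrightarrow> w \<in> (\<lambda>k i. k * v i) ` {k. k \<noteq> 0}"
    unfolding in_pt_iff[OF v] image_iff Bex_def mem_Collect_eq ..
qed

lemma mob_pt:
  assumes det: "a * d - b * c \<noteq> 0" and v: "v \<in> nzvec"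
  shows "mob a b c d (pt v) = pt (lin a b c d v)"
  unfolding mob_def pt_eq_image[OF v] pt_eq_image[OF lin_nzvec[OF det v]] image_image lin_scale ..

lemma mob_morphism:
  assumes det: "a * d - b * c \<noteq> 0"
  shows "morphism P1 P1 (mob a b c d)"
proof -
  let ?Y = "induced_space (affine_space (Suc (Suc 0))) (punctured (Suc 0))"
  note Y = space_with_functions_punctured[of "Suc 0"]
  have pY: "points ?Y = nzvec" using points_punctured punctured_line by (rule trans)
  have co: "(\<lambda>x. x i) \<in> regular ?Y (points ?Y)" for i
  proof -
    have "(\<lambda>x. x i) \<in> regular (affine_space (Suc (Suc 0))) (points (affine_space (Suc (Suc 0))))"
      using regular_coordinate by simp
    from regular_induced_points[OF space_with_functions_affine_space this, of "punctured (Suc 0)"]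
    show ?thesis .
  qed
  have oY: "openin (zariski ?Y) (points ?Y)" by (rule openin_topspace)
  have l: "(\<lambda>x. k * x 0 + m * x 1) \<in> regular ?Y (points ?Y)" for k m
    by (intro regular_add[OF Y] regular_mult[OF Y] regular_const[OF Y oY] co)
  have "morphism ?Y P1 (\<lambda>v. proj_point (Suc 0) (lin a b c d v))"
  proof (rule morphism_proj_point[OF Y])
    show "lin a b c d v \<in> punctured (Suc 0)" if "v \<in> points ?Y" for v
      using that lin_nzvec[OF det, of v] pY punctured_line by blast
    fix i assume "i < Suc (Suc 0)"
    then consider "i = 0" | "i = 1" by linarith
    then show "(\<lambda>v. lin a b c d v i) \<in> regular ?Y (points ?Y)"
      using l[of a b] l[of c d] unfolding lin_def by cases simp_all
  qed
  then show ?thesis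
    unfolding projective_space_def
  proof (rule morphism_from_quotient_space[OF Y equiv_proportional'])
    fix v assume "v \<in> points ?Y"
    then have "v \<in> nzvec" unfolding pY .
    from mob_pt[OF det this] show "mob a b c d (proportional (Suc (Suc 0)) `` {v}) = proj_point (Suc 0) (lin a b c d v)"
      unfolding pt_def proj_point_def .
  qed
qed

lemma mob_isomorphism:
  assumes det: "a * d - b * c \<noteq> 0"
  shows "isomorphism P1 P1 (mob a b c d) (mob d (- b) (- c) a)"
proof -
  have det': "d * a - (- b) * (- c) \<noteq> 0" using det by (simp add: mult.commute)
  have inv: "mob d (- b) (- c) a (mob a b c d q) = q"
    if q: "q \<in> points P1" and det: "a * d - b * c \<noteq> 0" for q a b c d
  proof -
    obtain v where v: "v \<in> nzvec" "q = pt v" using q unfolding points_P1 by blast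
    have det': "d * a - (- b) * (- c) \<noteq> 0" using det by (simp add: mult.commute)
    have vv: "v \<in> vectors 2" using v(1) by (simp add: nzvec_def)
    have "mob d (- b) (- c) a (mob a b c d q) = pt (lin d (- b) (- c) a (lin a b c d v))"
      unfolding v(2) mob_pt[OF det v(1)] by (rule mob_pt[OF det' lin_nzvec[OF det v(1)]])
    also have "\<dots> = pt (\<lambda>i. (a * d - b * c) * v i)"
      by (rule arg_cong[OF lin_adjugate[OF vv]])
    also have "\<dots> = pt v"
    proof -
      have "(\<lambda>i. (a * d - b * c) * v i) \<in> nzvec" using v(1) det by (auto simp: nzvec_iff vectors_def)
      then have "pt v = pt (\<lambda>i. (a * d - b * c) * v i)"
        by (intro iffD2[OF pt_eq_scale_iff[OF v(1)]] exI[of _ "a * d - b * c"] conjI det refl)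
      then show ?thesis by (rule sym)
    qed
    finally show ?thesis by (rule trans) (rule v(2)[symmetric])
  qed
  show ?thesis unfolding isomorphism_def
  proof (intro conjI ballI)
    show "morphism P1 P1 (mob a b c d)" by (rule mob_morphism[OF det])
    show "morphism P1 P1 (mob d (- b) (- c) a)" by (rule mob_morphism[OF det'])
    show "mob d (- b) (- c) a (mob a b c d q) = q" if "q \<in> points P1" for q by (rule inv[OF that det])
    show "mob a b c d (mob d (- b) (- c) a q) = q" if "q \<in> points P1" for q
      using inv[OF that det'] by (simp only: minus_minus)
  qed
qed

section \<open>Quadratic maps of the line\<close>

text \<open>The determinant of the Sylvester matrix is expanded along first columns, three times in
  succession. The result is the value of \<open>Y\<^sup>2 - X * Z\<close> at the cross product \<open>(X, Y, Z)\<close> of the two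
  rows of coefficients.\<close>

lemma form_resultant_formula:
  "form_resultant a = (a 2 * a 3 - a 0 * a 5)\<^sup>2 - (a 1 * a 5 - a 2 * a 4) * (a 0 * a 4 - a 1 * a 3)"
proof -
  let ?p = "[:a 2, a 1, a 0:]" and ?q = "[:a 5, a 4, a 3:]"
  define S where "S = sylvester_mat_sub 2 2 ?p ?q"
  have S: "S \<in> carrier_mat 4 4" using sylvester_mat_sub_carrier[of 2 2 ?p ?q] by (simp add: S_def)
  have Sij: "S $$ (i, j) = (if i < 2 then if i \<le> j \<and> j - i \<le> 2 then coeff ?p (2 + i - j) else 0
     else if i - 2 \<le> j \<and> j \<le> i then coeff ?q (i - j) else 0)" if "i < 4" "j < 4" for i j
    unfolding S_def using sylvester_mat_sub_index[of i 2 2 j ?p ?q] that by simp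
  have L: "det A = (\<Sum>i<n. A $$ (i, 0) * cofactor A i 0)" if "A \<in> carrier_mat n n" "0 < n" for A :: "complex mat" and n
    by (rule laplace_expansion_column[OF that])
  have e: "mat_delete A i 0 $$ (k, l) = A $$ (if k < i then k else Suc k, Suc l)"
    if "A \<in> carrier_mat (Suc n) (Suc n)" "k < n" "l < n" for A :: "complex mat" and i k l n
    using that by (simp add: mat_delete_def)
  have c: "mat_delete A i 0 \<in> carrier_mat n n" if "A \<in> carrier_mat (Suc n) (Suc n)" for A :: "complex mat" and i n
    using that by (simp add: mat_delete_def)
  have d1: "det A = A $$ (0, 0)" if A: "A \<in> carrier_mat 1 1" for A :: "complex mat"
    using A det_single by blast
  have d2: "det A = A $$ (0, 0) * A $$ (1, 1) - A $$ (1, 0) * A $$ (0, 1)" if A: "A \<in> carrier_mat 2 2" for A :: "complex mat"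
  proof -
    have A': "A \<in> carrier_mat (Suc 1) (Suc 1)" using A by (simp add: numeral_2_eq_2)
    have "det A = (\<Sum>i<2. A $$ (i, 0) * cofactor A i 0)" by (rule L[OF A]) simp
    then show ?thesis
      by (simp add: numeral_2_eq_2 cofactor_def d1[OF c[OF A']] e[OF A'])
  qed
  have d3: "det A = A $$ (0, 0) * (A $$ (1, 1) * A $$ (2, 2) - A $$ (2, 1) * A $$ (1, 2))
     - A $$ (1, 0) * (A $$ (0, 1) * A $$ (2, 2) - A $$ (2, 1) * A $$ (0, 2))
     + A $$ (2, 0) * (A $$ (0, 1) * A $$ (1, 2) - A $$ (1, 1) * A $$ (0, 2))"
    if A: "A \<in> carrier_mat 3 3" for A :: "complex mat"
  proof -
    have A': "A \<in> carrier_mat (Suc 2) (Suc 2)" using A by (simp add: numeral_3_eq_3 numeral_2_eq_2)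
    have "det A = (\<Sum>i<3. A $$ (i, 0) * cofactor A i 0)" by (rule L[OF A]) simp
    then have "det A = A $$ (0, 0) * cofactor A 0 0 + A $$ (1, 0) * cofactor A 1 0 + A $$ (2, 0) * cofactor A 2 0"
      by (simp add: numeral_3_eq_3 numeral_2_eq_2)
    then show ?thesis
      by (simp add: cofactor_def d2[OF c[OF A']] e[OF A'] numeral_2_eq_2 numeral_3_eq_3) (simp add: algebra_simps)
  qed
  have S': "S \<in> carrier_mat (Suc 3) (Suc 3)" using S by simp
  have "det S = (\<Sum>i<4. S $$ (i, 0) * cofactor S i 0)" by (rule L[OF S]) simp
  then have "det S = S $$ (0, 0) * cofactor S 0 0 + S $$ (1, 0) * cofactor S 1 0
      + S $$ (2, 0) * cofactor S 2 0 + S $$ (3, 0) * cofactor S 3 0"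
    by (simp add: eval_nat_numeral)
  also have "cofactor S 0 0 = det (mat_delete S 0 0)" by (simp add: cofactor_def)
  also have "cofactor S 1 0 = - det (mat_delete S 1 0)" by (simp add: cofactor_def)
  also have "cofactor S 2 0 = det (mat_delete S 2 0)" by (simp add: cofactor_def)
  also have "cofactor S 3 0 = - det (mat_delete S 3 0)" by (simp add: cofactor_def)
  finally have "det S = S $$ (0, 0) * det (mat_delete S 0 0) - S $$ (1, 0) * det (mat_delete S 1 0)
      + S $$ (2, 0) * det (mat_delete S 2 0) - S $$ (3, 0) * det (mat_delete S 3 0)" by simp
  then have "det S = (a 2 * a 3 - a 0 * a 5)\<^sup>2 - (a 1 * a 5 - a 2 * a 4) * (a 0 * a 4 - a 1 * a 3)"
    by (simp add: d3[OF c[OF S']] e[OF S'] Sij eval_nat_numeral) (simp add: algebra_simps power2_eq_square)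
  then show ?thesis unfolding form_resultant_def resultant_sub_def S_def .
qed

lemma quadratic_pair_simps [simp]:
  "quadratic_pair a v 0 = a 0 * (v 0)\<^sup>2 + a 1 * v 0 * v 1 + a 2 * (v 1)\<^sup>2"
  "quadratic_pair a v (Suc 0) = a 3 * (v 0)\<^sup>2 + a 4 * v 0 * v 1 + a 5 * (v 1)\<^sup>2"
  "quadratic_pair a v \<in> vectors 2"
  by (simp_all add: quadratic_pair_def vectors_def)

lemma quadratic_pair_scale: "quadratic_pair (\<lambda>i. d * a i) (\<lambda>i. c * v i) = (\<lambda>i. d * c\<^sup>2 * quadratic_pair a v i)"
  by (simp add: quadratic_pair_def fun_eq_iff power2_eq_square algebra_simps)

text \<open>Elimination: if both forms vanish at a vector, the resultant times the fourth power of either of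
  its coordinates is zero. The equations (1), (2) and (3) come from eliminating one coefficient of
  each form at a time.\<close>

lemma quadratic_pair_nonzero:
  assumes R: "form_resultant a \<noteq> 0" and v: "v \<in> nzvec"
  shows "quadratic_pair a v \<in> nzvec"
proof (rule ccontr)
  assume "quadratic_pair a v \<notin> nzvec"
  then have F: "a 0 * (v 0)\<^sup>2 + a 1 * v 0 * v 1 + a 2 * (v 1)\<^sup>2 = 0"
    and G: "a 3 * (v 0)\<^sup>2 + a 4 * v 0 * v 1 + a 5 * (v 1)\<^sup>2 = 0"
    by (simp_all add: nzvec_iff)
  define X where "X = a 1 * a 5 - a 2 * a 4"
  define Y where "Y = a 2 * a 3 - a 0 * a 5"
  define Z where "Z = a 0 * a 4 - a 1 * a 3"
  let ?u = "v 0" and ?w = "v 1"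
  let ?F = "a 0 * ?u\<^sup>2 + a 1 * ?u * ?w + a 2 * ?w\<^sup>2" and ?G = "a 3 * ?u\<^sup>2 + a 4 * ?u * ?w + a 5 * ?w\<^sup>2"
  have "X * (?u * ?w) - Y * ?u\<^sup>2 = a 5 * ?F - a 2 * ?G" by (simp add: X_def Y_def algebra_simps power2_eq_square)
  then have 1: "Y * ?u\<^sup>2 = X * (?u * ?w)" using F G by simp
  have "Z * (?u * ?w) - Y * ?w\<^sup>2 = a 0 * ?G - a 3 * ?F" by (simp add: Z_def Y_def algebra_simps power2_eq_square)
  then have 2: "Y * ?w\<^sup>2 = Z * (?u * ?w)" using F G by simp
  have "X * ?w\<^sup>2 - Z * ?u\<^sup>2 = a 1 * ?G - a 4 * ?F" by (simp add: X_def Z_def algebra_simps power2_eq_square)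
  then have 3: "X * ?w\<^sup>2 = Z * ?u\<^sup>2" using F G by simp
  have R': "Y\<^sup>2 - X * Z \<noteq> 0" using R unfolding form_resultant_formula X_def Y_def Z_def by simp
  have "(Y\<^sup>2 - X * Z) * (?u\<^sup>2 * ?u\<^sup>2) = (Y * ?u\<^sup>2) * (Y * ?u\<^sup>2) - X * ?u\<^sup>2 * (Z * ?u\<^sup>2)"
    by (simp add: algebra_simps power2_eq_square)
  also have "\<dots> = 0" unfolding 1 3[symmetric] by (simp add: algebra_simps power2_eq_square)
  finally have u: "?u = 0" using R' by simp
  have "(Y\<^sup>2 - X * Z) * (?w\<^sup>2 * ?w\<^sup>2) = (Y * ?w\<^sup>2) * (Y * ?w\<^sup>2) - X * ?w\<^sup>2 * (Z * ?w\<^sup>2)"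
    by (simp add: algebra_simps power2_eq_square)
  also have "\<dots> = 0" unfolding 2 3 by (simp add: algebra_simps power2_eq_square)
  finally have "?w = 0" using R' by simp
  then show False using u v by (simp add: nzvec_iff)
qed

lemma binary_quadratic_form_zero:
  "\<exists>v\<in>nzvec. p * (v 0)\<^sup>2 + q * v 0 * v 1 + r * (v 1)\<^sup>2 = 0" for p q r :: complex
proof (cases "p = 0")
  case True then show ?thesis by (intro bexI[of _ "pairvec 1 0"]) simp_all
next
  case False
  have "\<not> constant (poly [:r, q, p:])" using False by (simp add: constant_degree)
  then obtain t where "poly [:r, q, p:] t = 0" using fundamental_theorem_of_algebra by blast
  then show ?thesis by (intro bexI[of _ "pairvec t 1"]) (simp_all add: algebra_simps power2_eq_square)
qed

text \<open>The cross product of the two rows of coefficients is orthogonal to both of them. If the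
  resultant vanishes it lies on the conic of squares, so it gives a common zero; if the cross
  product itself vanishes, the two forms are proportional.\<close>

lemma form_resultant_nonzeroI:
  assumes nz: "\<And>v. v \<in> nzvec \<Longrightarrow> quadratic_pair a v \<in> nzvec"
  shows "form_resultant a \<noteq> 0"
proof
  assume R: "form_resultant a = 0"
  define X where "X = a 1 * a 5 - a 2 * a 4"
  define Y where "Y = a 2 * a 3 - a 0 * a 5"
  define Z where "Z = a 0 * a 4 - a 1 * a 3"
  have R': "Y\<^sup>2 = X * Z" using R unfolding form_resultant_formula X_def Y_def Z_def by simp
  have o1: "a 0 * X + a 1 * Y + a 2 * Z = 0" and o2: "a 3 * X + a 4 * Y + a 5 * Z = 0"
    by (simp_all add: X_def Y_def Z_def algebra_simps)
  have "\<exists>v\<in>nzvec. quadratic_pair a v 0 = 0 \<and> quadratic_pair a v 1 = 0"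
  proof (cases "X = 0")
    case False
    have "a 0 * X\<^sup>2 + a 1 * X * Y + a 2 * Y\<^sup>2 = X * (a 0 * X + a 1 * Y + a 2 * Z)"
      "a 3 * X\<^sup>2 + a 4 * X * Y + a 5 * Y\<^sup>2 = X * (a 3 * X + a 4 * Y + a 5 * Z)"
      unfolding R' by (simp_all add: algebra_simps power2_eq_square)
    then show ?thesis using False o1 o2 by (intro bexI[of _ "pairvec X Y"]) simp_all
  next
    case True
    then have Y: "Y = 0" using R' by simp
    show ?thesis
    proof (cases "Z = 0")
      case False
      then have "a 2 = 0" "a 5 = 0" using o1 o2 True Y by simp_all
      then show ?thesis by (intro bexI[of _ "pairvec 0 1"]) simp_all
    next
      case Z: True
      have m: "a 1 * a 5 = a 2 * a 4" "a 2 * a 3 = a 0 * a 5" "a 0 * a 4 = a 1 * a 3"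
        using True Y Z by (simp_all add: X_def Y_def Z_def)
      show ?thesis
      proof (cases "a 0 = 0 \<and> a 1 = 0 \<and> a 2 = 0")
        case True
        obtain v where "v \<in> nzvec" "a 3 * (v 0)\<^sup>2 + a 4 * v 0 * v 1 + a 5 * (v 1)\<^sup>2 = 0"
          using binary_quadratic_form_zero by blast
        then show ?thesis using True by (intro bexI[of _ v]) simp_all
      next
        case False
        obtain v where v: "v \<in> nzvec" "a 0 * (v 0)\<^sup>2 + a 1 * v 0 * v 1 + a 2 * (v 1)\<^sup>2 = 0"
          using binary_quadratic_form_zero by blast
        let ?F = "a 0 * (v 0)\<^sup>2 + a 1 * v 0 * v 1 + a 2 * (v 1)\<^sup>2"
        let ?G = "a 3 * (v 0)\<^sup>2 + a 4 * v 0 * v 1 + a 5 * (v 1)\<^sup>2"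
        have "a 0 * ?G - a 3 * ?F = (a 0 * a 4 - a 1 * a 3) * (v 0 * v 1) + (a 0 * a 5 - a 2 * a 3) * (v 1)\<^sup>2"
          "a 1 * ?G - a 4 * ?F = (a 1 * a 3 - a 0 * a 4) * (v 0)\<^sup>2 + (a 1 * a 5 - a 2 * a 4) * (v 1)\<^sup>2"
          "a 2 * ?G - a 5 * ?F = (a 2 * a 3 - a 0 * a 5) * (v 0)\<^sup>2 + (a 2 * a 4 - a 1 * a 5) * (v 0 * v 1)"
          by (simp_all add: algebra_simps)
        then have "a 0 * ?G = 0 \<and> a 1 * ?G = 0 \<and> a 2 * ?G = 0"
          unfolding m v(2) by simp
        then have "?G = 0" using False by (metis mult_eq_0_iff)
        then show ?thesis using v by (intro bexI[of _ v]) simp_all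
      qed
    qed
  qed
  then show False using nz by (auto simp: nzvec_iff)
qed

text \<open>Two quadratic maps that agree at five points agree: their difference is a binary quartic
  with five zeros. Once the quartic vanishes identically, the linear forms in the Bezout
  identity for the resultant show that the coefficients are proportional.\<close>

lemma quadratic_maps_agree_at_five:
  assumes R: "form_resultant a \<noteq> 0" and t: "t \<noteq> 0" "t \<noteq> 1" "u \<noteq> 0" "u \<noteq> 1" "t \<noteq> u"
    and z: "\<And>v. v \<in> {pairvec 1 0, pairvec 0 1, pairvec 1 1, pairvec t 1, pairvec u 1} \<Longrightarrow>
      br (quadratic_pair a v) (quadratic_pair b v) = 0"
  shows "\<exists>c. \<forall>i<6. b i = c * a i"
proof -
  define e0 where "e0 = a 0 * b 3 - b 0 * a 3"
  define e1 where "e1 = a 0 * b 4 + a 1 * b 3 - b 0 * a 4 - b 1 * a 3"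
  define e2 where "e2 = a 0 * b 5 + a 1 * b 4 + a 2 * b 3 - b 0 * a 5 - b 1 * a 4 - b 2 * a 3"
  define e3 where "e3 = a 1 * b 5 + a 2 * b 4 - b 1 * a 5 - b 2 * a 4"
  define e4 where "e4 = a 2 * b 5 - b 2 * a 5"
  note e = e0_def e1_def e2_def e3_def e4_def
  have quartic: "br (quadratic_pair a (pairvec x y)) (quadratic_pair b (pairvec x y)) =
      e0 * x^4 + e1 * x^3 * y + e2 * x\<^sup>2 * y\<^sup>2 + e3 * x * y^3 + e4 * y^4" for x y
    by (simp add: br_def e algebra_simps eval_nat_numeral)
  have E0: "e0 = 0" using z[of "pairvec 1 0"] unfolding quartic by simp
  have E4: "e4 = 0" using z[of "pairvec 0 1"] unfolding quartic by simp
  have s: "e1 + e2 + e3 = 0" using z[of "pairvec 1 1"] E0 E4 unfolding quartic by simp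
  have lin: "(x + 1) * e1 + e2 = 0" if "x \<noteq> 0" "x \<noteq> 1" "br (quadratic_pair a (pairvec x 1)) (quadratic_pair b (pairvec x 1)) = 0" for x
  proof -
    have "e1 * x ^ 3 + e2 * x\<^sup>2 + e3 * x = 0" using that(3) E0 E4 unfolding quartic by simp
    moreover have "x * (x - 1) * ((x + 1) * e1 + e2) = (e1 * x ^ 3 + e2 * x\<^sup>2 + e3 * x) - x * (e1 + e2 + e3)"
      by (simp add: algebra_simps eval_nat_numeral)
    ultimately have "x * (x - 1) * ((x + 1) * e1 + e2) = 0" using s by simp
    then show ?thesis using that(1,2) by simp
  qed
  have "(t + 1) * e1 + e2 = 0" "(u + 1) * e1 + e2 = 0" using lin t z by simp_all
  moreover have "(t - u) * e1 = ((t + 1) * e1 + e2) - ((u + 1) * e1 + e2)" by (simp add: algebra_simps)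
  ultimately have "(t - u) * e1 = 0" by simp
  then have E1: "e1 = 0" using t(5) by simp
  then have E2: "e2 = 0" using \<open>(t + 1) * e1 + e2 = 0\<close> by simp
  then have E3: "e3 = 0" using s E1 by simp
  define X where "X = a 1 * a 5 - a 2 * a 4"
  define Y where "Y = a 2 * a 3 - a 0 * a 5"
  define Z where "Z = a 0 * a 4 - a 1 * a 3"
  have R': "Y\<^sup>2 - X * Z \<noteq> 0" using R unfolding form_resultant_formula X_def Y_def Z_def by simp
  \<comment> \<open>This is the resultant times the common ratio: the same combination of \<open>a 0\<close> and \<open>a 3\<close> is the resultant. The cofactors in the next six identities are solutions of linear equations for their coefficients.\<close>
  define cR where "cR = (- a 4 * X - a 5 * Y) * b 0 + (a 1 * X + a 2 * Y) * b 3"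
  have c0: "(Y\<^sup>2 - X * Z) * b 0 - cR * a 0 = e0 * (a 0 * a 2 * a 5 - a 1 * a 1 * a 5 + a 1 * a 2 * a 4 - a 2 * a 2 * a 3)"
    unfolding cR_def X_def Y_def Z_def e by (simp add: algebra_simps power2_eq_square)
  have c1: "(Y\<^sup>2 - X * Z) * b 1 - cR * a 1 = e0 * (- a 1 * a 2 * a 5 + a 2 * a 2 * a 4) + e1 * (a 0 * a 2 * a 5 - a 1 * a 1 * a 5 + a 1 * a 2 * a 4 - a 2 * a 2 * a 3) + e2 * (a 0 * a 1 * a 5 - a 0 * a 2 * a 4) + e3 * (- a 0 * a 0 * a 5 + a 0 * a 2 * a 3) + e4 * (a 0 * a 0 * a 4 - a 0 * a 1 * a 3)"
    unfolding cR_def X_def Y_def Z_def e by (simp add: algebra_simps power2_eq_square)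
  have c2: "(Y\<^sup>2 - X * Z) * b 2 - cR * a 2 = e1 * (- a 1 * a 2 * a 5 + a 2 * a 2 * a 4) + e2 * (a 0 * a 2 * a 5 - a 2 * a 2 * a 3) + e3 * (- a 0 * a 2 * a 4 + a 1 * a 2 * a 3) + e4 * (- a 0 * a 0 * a 5 + a 0 * a 1 * a 4 + a 0 * a 2 * a 3 - a 1 * a 1 * a 3)"
    unfolding cR_def X_def Y_def Z_def e by (simp add: algebra_simps power2_eq_square)
  have c3: "(Y\<^sup>2 - X * Z) * b 3 - cR * a 3 = e0 * (a 0 * a 5 * a 5 - a 1 * a 4 * a 5 - a 2 * a 3 * a 5 + a 2 * a 4 * a 4)"
    unfolding cR_def X_def Y_def Z_def e by (simp add: algebra_simps power2_eq_square)
  have c4: "(Y\<^sup>2 - X * Z) * b 4 - cR * a 4 = e0 * (- a 1 * a 5 * a 5 + a 2 * a 4 * a 5) + e1 * (a 0 * a 5 * a 5 - a 1 * a 4 * a 5 - a 2 * a 3 * a 5 + a 2 * a 4 * a 4) + e2 * (a 1 * a 3 * a 5 - a 2 * a 3 * a 4) + e3 * (- a 0 * a 3 * a 5 + a 2 * a 3 * a 3) + e4 * (a 0 * a 3 * a 4 - a 1 * a 3 * a 3)"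
    unfolding cR_def X_def Y_def Z_def e by (simp add: algebra_simps power2_eq_square)
  have c5: "(Y\<^sup>2 - X * Z) * b 5 - cR * a 5 = e1 * (- a 1 * a 5 * a 5 + a 2 * a 4 * a 5) + e2 * (a 0 * a 5 * a 5 - a 2 * a 3 * a 5) + e3 * (- a 0 * a 4 * a 5 + a 1 * a 3 * a 5) + e4 * (- a 0 * a 3 * a 5 + a 0 * a 4 * a 4 - a 1 * a 3 * a 4 + a 2 * a 3 * a 3)"
    unfolding cR_def X_def Y_def Z_def e by (simp add: algebra_simps power2_eq_square)
  have "b i = cR / (Y\<^sup>2 - X * Z) * a i" if "i < 6" for i
  proof -
    have "(Y\<^sup>2 - X * Z) * b i = cR * a i"
      using c0 c1 c2 c3 c4 c5 E0 E1 E2 E3 E4 that by (auto simp: less_Suc_eq eval_nat_numeral)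
    then show ?thesis using R' by (simp add: field_simps)
  qed
  then show ?thesis by blast
qed

text \<open>The quadratic map with prescribed values \<open>l 1 * w 1\<close>, \<open>l 2 * w 2\<close> and \<open>l 3 * w 3\<close> at the three
  vectors \<open>(1, 0)\<close>, \<open>(0, 1)\<close> and \<open>(1, 1)\<close>.\<close>

definition interp :: "(nat \<Rightarrow> complex) \<Rightarrow> (nat \<Rightarrow> nat \<Rightarrow> complex) \<Rightarrow> nat \<Rightarrow> complex" where
  "interp l w = (\<lambda>i.
     if i = 0 then l 1 * w 1 0 else if i = 1 then l 3 * w 3 0 - l 1 * w 1 0 - l 2 * w 2 0
     else if i = 2 then l 2 * w 2 0 else if i = 3 then l 1 * w 1 1
     else if i = 4 then l 3 * w 3 1 - l 1 * w 1 1 - l 2 * w 2 1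
     else if i = 5 then l 2 * w 2 1 else 0)"

lemma interp_eval:
  assumes "k < 2"
  shows "quadratic_pair (interp l w) v k =
    l 1 * w 1 k * (v 0 * (v 0 - v 1)) + l 2 * w 2 k * (v 1 * (v 1 - v 0)) + l 3 * w 3 k * (v 0 * v 1)"
proof -
  consider "k = 0" | "k = 1" using assms by linarith
  then show ?thesis by cases (simp_all add: interp_def algebra_simps power2_eq_square)
qed

lemma br_interp:
  "br (quadratic_pair (interp l w) v) u =
    l 1 * (v 0 * (v 0 - v 1) * br (w 1) u) + l 2 * (v 1 * (v 1 - v 0) * br (w 2) u) + l 3 * (v 0 * v 1 * br (w 3) u)"
  by (simp add: br_def interp_eval[of 0] interp_eval[of 1, unfolded One_nat_def] algebra_simps del: quadratic_pair_simps)

text \<open>Lagrange interpolation of a binary quadratic form at three points, in homogeneous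
  coordinates.\<close>

lemma quadratic_form_zero_at_three:
  fixes p q r :: complex
  defines "Q \<equiv> \<lambda>v :: nat \<Rightarrow> complex. p * (v 0)\<^sup>2 + q * v 0 * v 1 + r * (v 1)\<^sup>2"
  assumes b: "br a b \<noteq> 0" "br a c \<noteq> 0" "br b c \<noteq> 0" and z: "Q a = 0" "Q b = 0" "Q c = 0"
  shows "Q v = 0"
proof -
  have "Q v * (br a b * br a c * br b c) =
    Q a * (br v b * br v c * br b c) - Q b * (br v a * br v c * br a c) + Q c * (br v a * br v b * br a b)"
    unfolding Q_def br_def by (simp add: algebra_simps power2_eq_square)
  then show ?thesis using b z by simp
qed

text \<open>Conjugating a quadratic map by a linear map gives a quadratic map, so it is enough to compare
  the two sides at three vectors.\<close>

lemma conjugate_quadratic_eqI: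
  assumes br: "br x y \<noteq> 0" "br x z \<noteq> 0" "br y z \<noteq> 0"
    and eq: "\<And>u. u \<in> {x, y, z} \<Longrightarrow> quadratic_pair f (lin a b c d u) = lin a b c d (quadratic_pair g u)"
  shows "quadratic_pair f (lin a b c d v) = lin a b c d (quadratic_pair g v)"
proof (rule vectors2_eqI)
  show "quadratic_pair f (lin a b c d v) \<in> vectors 2" "lin a b c d (quadratic_pair g v) \<in> vectors 2"
    by (simp_all add: lin_def)
  define Q where "Q p q r v = p * (v 0)\<^sup>2 + q * v 0 * v 1 + r * (v 1)\<^sup>2" for p q r :: complex and v :: "nat \<Rightarrow> complex"
  have form: "p * (lin a b c d u 0)\<^sup>2 + q * lin a b c d u 0 * lin a b c d u 1 + r * (lin a b c d u 1)\<^sup>2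
       - (m * quadratic_pair g u 0 + k * quadratic_pair g u 1) =
     Q (p * a\<^sup>2 + q * a * c + r * c\<^sup>2 - (m * g 0 + k * g 3))
       (2 * p * a * b + q * (a * d + b * c) + 2 * r * c * d - (m * g 1 + k * g 4))
       (p * b\<^sup>2 + q * b * d + r * d\<^sup>2 - (m * g 2 + k * g 5)) u" for p q r m k u
    by (simp add: Q_def lin_def algebra_simps power2_eq_square)
  have c0: "quadratic_pair f (lin a b c d u) 0 - lin a b c d (quadratic_pair g u) 0 =
     Q (f 0 * a\<^sup>2 + f 1 * a * c + f 2 * c\<^sup>2 - (a * g 0 + b * g 3))
       (2 * f 0 * a * b + f 1 * (a * d + b * c) + 2 * f 2 * c * d - (a * g 1 + b * g 4))
       (f 0 * b\<^sup>2 + f 1 * b * d + f 2 * d\<^sup>2 - (a * g 2 + b * g 5)) u" for u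
    using form[of "f 0" u "f 1" "f 2" a b] by (simp add: lin_def)
  have c1: "quadratic_pair f (lin a b c d u) 1 - lin a b c d (quadratic_pair g u) 1 =
     Q (f 3 * a\<^sup>2 + f 4 * a * c + f 5 * c\<^sup>2 - (c * g 0 + d * g 3))
       (2 * f 3 * a * b + f 4 * (a * d + b * c) + 2 * f 5 * c * d - (c * g 1 + d * g 4))
       (f 3 * b\<^sup>2 + f 4 * b * d + f 5 * d\<^sup>2 - (c * g 2 + d * g 5)) u" for u
    using form[of "f 3" u "f 4" "f 5" c d] by (simp add: lin_def)
  have z: "quadratic_pair f (lin a b c d u) k - lin a b c d (quadratic_pair g u) k = 0" if "u \<in> {x, y, z}" for u k
    using eq[OF that] by simp
  have "Q p q r v = 0" if "Q p q r x = 0" "Q p q r y = 0" "Q p q r z = 0" for p q r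
    using quadratic_form_zero_at_three[OF br] that unfolding Q_def by blast
  note zero = this
  have "quadratic_pair f (lin a b c d v) 0 - lin a b c d (quadratic_pair g v) 0 = 0"
    unfolding c0 by (rule zero) (unfold c0[symmetric], simp_all only: z insert_iff simp_thms)
  then show "quadratic_pair f (lin a b c d v) 0 = lin a b c d (quadratic_pair g v) 0" by simp
  have "quadratic_pair f (lin a b c d v) 1 - lin a b c d (quadratic_pair g v) 1 = 0"
    unfolding c1 by (rule zero) (unfold c1[symmetric], simp_all only: z insert_iff simp_thms)
  then show "quadratic_pair f (lin a b c d v) 1 = lin a b c d (quadratic_pair g v) 1" by simp
qed

lemma br_parallel_trans:
  assumes w: "w \<in> nzvec" and "br f w = 0" "br g w = 0"
  shows "br f g = 0"
proof -
  have "br f g * w 0 = br f w * g 0 - br g w * f 0" "br f g * w 1 = br f w * g 1 - br g w * f 1"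
    by (simp_all add: br_def algebra_simps)
  then show ?thesis using assms by (auto simp: nzvec_iff)
qed

section \<open>The normal form of a quadratic map with a portrait\<close>

text \<open>In a frame the first three points are infinity, zero and one, the others are affine with
  coordinates \<open>t 4, t 5, \<dots>\<close>.\<close>

definition frame :: "(nat \<Rightarrow> complex) \<Rightarrow> nat \<Rightarrow> nat \<Rightarrow> complex" where
  "frame t i = (if i = 1 then pairvec 1 0 else if i = 2 then pairvec 0 1
     else if i = 3 then pairvec 1 1 else pairvec (t i) 1)"

lemma frame_simps [simp]:
  "frame t (Suc 0) = pairvec 1 0" "frame t 1 = pairvec 1 0" "frame t 2 = pairvec 0 1"
  "frame t 3 = pairvec 1 1" "frame t 4 = pairvec (t 4) 1" "frame t 5 = pairvec (t 5) 1"
  "frame t i \<in> nzvec" "frame t i \<in> vectors 2"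
  by (simp_all add: frame_def)

text \<open>\<open>portrait_coeff \<Psi> t i j\<close> is the coefficient of the value \<open>l j\<close> in the condition that
  the \<open>i\<close>-th point of the frame is mapped to its image in the portrait. All these coefficients
  are nonzero because the points are distinct and \<open>\<Psi>\<close> is injective.\<close>

definition portrait_coeff :: "(nat \<Rightarrow> nat) \<Rightarrow> (nat \<Rightarrow> complex) \<Rightarrow> nat \<Rightarrow> nat \<Rightarrow> complex" where
  "portrait_coeff \<Psi> t i j =
     (if j = 1 then t i * (t i - 1) else if j = 2 then 1 - t i else t i) * br (frame t (\<Psi> j)) (frame t (\<Psi> i))"

lemma br_interp_frame:
  assumes "4 \<le> i"
  shows "br (quadratic_pair (interp l (\<lambda>j. frame t (\<Psi> j))) (frame t i)) (frame t (\<Psi> i)) =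
    l 1 * portrait_coeff \<Psi> t i 1 + l 2 * portrait_coeff \<Psi> t i 2 + l 3 * portrait_coeff \<Psi> t i 3"
proof -
  have "frame t i = pairvec (t i) 1" using assms by (simp add: frame_def)
  then show ?thesis unfolding br_interp portrait_coeff_def by (simp add: algebra_simps)
qed

text \<open>For three points nothing is left to choose in the frame, and the value zero is a default.\<close>

definition param :: "nat \<Rightarrow> (nat \<Rightarrow> complex) \<Rightarrow> nat \<Rightarrow> complex" where
  "param n s i = (if n = 3 then 0 else if n = 4 \<or> i = 4 then s 0 else s 1)"

text \<open>For three points the values are free up to a common factor, for four points they satisfy one
  linear condition, which is solved for the third value, and for five points the two linear
  conditions determine them as a cross product.\<close>

definition slice_value :: "nat \<Rightarrow> (nat \<Rightarrow> nat) \<Rightarrow> (nat \<Rightarrow> complex) \<Rightarrow> nat \<Rightarrow> complex" where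
  "slice_value n \<Psi> s j = (let A = portrait_coeff \<Psi> (param n s) 4; B = portrait_coeff \<Psi> (param n s) 5 in
     if n = 3 then (if j = 1 then 1 else if j = 2 then s 0 else s 1)
     else if n = 4 then (if j = 1 then A 3 else if j = 2 then s 1 * A 3 else - (A 1 + s 1 * A 2))
     else (if j = 1 then A 2 * B 3 - A 3 * B 2 else if j = 2 then A 3 * B 1 - A 1 * B 3
           else A 1 * B 2 - A 2 * B 1))"

definition slice_frame :: "nat \<Rightarrow> (nat \<Rightarrow> complex) \<Rightarrow> nat \<Rightarrow> nat \<Rightarrow> complex" where
  "slice_frame n s = frame (param n s)"

definition slice_map :: "nat \<Rightarrow> (nat \<Rightarrow> nat) \<Rightarrow> (nat \<Rightarrow> complex) \<Rightarrow> nat \<Rightarrow> complex" where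
  "slice_map n \<Psi> s = interp (slice_value n \<Psi> s) (\<lambda>j. slice_frame n s (\<Psi> j))"

definition discriminant :: "nat \<Rightarrow> (nat \<Rightarrow> nat) \<Rightarrow> (nat \<Rightarrow> complex) \<Rightarrow> complex" where
  "discriminant n \<Psi> s = form_resultant (slice_map n \<Psi> s) *
     (\<Prod>(i, j)\<in>{(i, j). i \<in> {1..n} \<and> j \<in> {1..n} \<and> i \<noteq> j}. br (slice_frame n s i) (slice_frame n s j))"

text \<open>These formulas recover the parameters \<open>s\<close> from the values and the affine coordinates of the
  frame. They depend on the values through quotients only, because a map determines its values on
  the frame only up to a common factor.\<close>

definition coords :: "nat \<Rightarrow> (nat \<Rightarrow> complex) \<Rightarrow> (nat \<Rightarrow> complex) \<Rightarrow> nat \<Rightarrow> complex" where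
  "coords n l t = (if n = 3 then pairvec (l 2 / l 1) (l 3 / l 1)
     else if n = 4 then pairvec (t 4) (l 2 / l 1) else pairvec (t 4) (t 5))"

lemma discriminant_nonzero_iff:
  "discriminant n \<Psi> s \<noteq> 0 \<longleftrightarrow> form_resultant (slice_map n \<Psi> s) \<noteq> 0 \<and>
    (\<forall>i\<in>{1..n}. \<forall>j\<in>{1..n}. i \<noteq> j \<longrightarrow> br (slice_frame n s i) (slice_frame n s j) \<noteq> 0)"
proof -
  have "{(i, j). i \<in> {1..n} \<and> j \<in> {1..n} \<and> i \<noteq> j} \<subseteq> {1..n} \<times> {1..n}" by auto
  then have fin: "finite {(i, j). i \<in> {1..n} \<and> j \<in> {1..n} \<and> i \<noteq> j}" by (rule finite_subset) simp
  show ?thesis unfolding discriminant_def mult_eq_0_iff prod_zero_iff[OF fin] by fastforce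
qed

subsection \<open>The discriminant is a polynomial\<close>

lemma polynomial_param: "(\<lambda>s. param n s i) \<in> polynomial_functions"
  unfolding param_def by (cases "n = 3"; cases "n = 4 \<or> i = 4") (simp_all add: polynomial_functions.intros)

lemma polynomial_pairvec_component:
  assumes "a \<in> polynomial_functions" "b \<in> polynomial_functions"
  shows "(\<lambda>s. pairvec (a s) (b s) k) \<in> polynomial_functions"
proof -
  consider "k = 0" | "k = 1" | "k \<noteq> 0" "k \<noteq> 1" by blast
  then show ?thesis
    using assms polynomial_functions.const[of 0] by cases (simp_all add: pairvec_def)
qed

lemma polynomial_frame: "(\<lambda>s. slice_frame n s i k) \<in> polynomial_functions"
proof -
  note c = polynomial_functions.const
  have "(\<lambda>s. if i = 1 then pairvec 1 0 k else if i = 2 then pairvec 0 1 k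
      else if i = 3 then pairvec 1 1 k else pairvec (param n s i) 1 k) \<in> polynomial_functions"
    using c[of "pairvec 1 0 k"] c[of "pairvec 0 1 k"] c[of "pairvec 1 1 k"]
      polynomial_pairvec_component[OF polynomial_param[of n i] c[of 1], of k]
    by (cases "i = 1"; cases "i = 2"; cases "i = 3") (simp_all only: if_True if_False simp_thms)
  moreover have "(\<lambda>s. slice_frame n s i k) = (\<lambda>s. if i = 1 then pairvec 1 0 k else if i = 2 then pairvec 0 1 k
      else if i = 3 then pairvec 1 1 k else pairvec (param n s i) 1 k)"
    unfolding slice_frame_def frame_def if_distribR ..
  ultimately show ?thesis by (simp only:)
qed

lemma polynomial_br:
  assumes "\<And>k. (\<lambda>s. v s k) \<in> polynomial_functions" "\<And>k. (\<lambda>s. w s k) \<in> polynomial_functions"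
  shows "(\<lambda>s. br (v s) (w s)) \<in> polynomial_functions"
  unfolding br_def by (intro polynomial_intros assms)

lemma polynomial_portrait_coeff: "(\<lambda>s. portrait_coeff \<Psi> (param n s) i j) \<in> polynomial_functions"
proof -
  have b: "(\<lambda>s. br (frame (param n s) (\<Psi> j)) (frame (param n s) (\<Psi> i))) \<in> polynomial_functions"
    using polynomial_br[OF polynomial_frame[of n "\<Psi> j"] polynomial_frame[of n "\<Psi> i"]] by (simp add: slice_frame_def)
  consider "j = 1" | "j = 2" | "j \<noteq> 1" "j \<noteq> 2" by blast
  then show ?thesis
  proof cases
    case 1
    have "(\<lambda>s. param n s i * (param n s i - 1) * br (frame (param n s) (\<Psi> j)) (frame (param n s) (\<Psi> i))) \<in> polynomial_functions"
      by (intro polynomial_intros polynomial_param b)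
    then show ?thesis using 1 by (simp add: portrait_coeff_def)
  next
    case 2
    have "(\<lambda>s. (1 - param n s i) * br (frame (param n s) (\<Psi> j)) (frame (param n s) (\<Psi> i))) \<in> polynomial_functions"
      by (intro polynomial_intros polynomial_param b)
    then show ?thesis using 2 by (simp add: portrait_coeff_def)
  next
    case 3
    have "(\<lambda>s. param n s i * br (frame (param n s) (\<Psi> j)) (frame (param n s) (\<Psi> i))) \<in> polynomial_functions"
      by (intro polynomial_intros polynomial_param b)
    then show ?thesis using 3 by (simp add: portrait_coeff_def)
  qed
qed

lemma polynomial_slice_value: "(\<lambda>s. slice_value n \<Psi> s j) \<in> polynomial_functions"
proof -
  note p = polynomial_portrait_coeff
  consider "n = 3" | "n = 4" | "n \<noteq> 3" "n \<noteq> 4" by blast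
  then show ?thesis
  proof cases
    case 1 then show ?thesis unfolding slice_value_def Let_def
      by (cases "j = 1"; cases "j = 2") (simp_all add: polynomial_functions.intros)
  next
    case 2
    have "(\<lambda>s. s 1 * portrait_coeff \<Psi> (param 4 s) 4 3) \<in> polynomial_functions"
      "(\<lambda>s. - (portrait_coeff \<Psi> (param 4 s) 4 1 + s 1 * portrait_coeff \<Psi> (param 4 s) 4 2)) \<in> polynomial_functions"
      by (intro polynomial_intros p)+
    then show ?thesis using 2 p unfolding slice_value_def Let_def
      by (cases "j = 1"; cases "j = 2") simp_all
  next
    case 3
    have "(\<lambda>s. portrait_coeff \<Psi> (param n s) 4 a * portrait_coeff \<Psi> (param n s) 5 b
       - portrait_coeff \<Psi> (param n s) 4 c * portrait_coeff \<Psi> (param n s) 5 d) \<in> polynomial_functions" for a b c d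
      by (intro polynomial_intros p)
    then show ?thesis using 3 unfolding slice_value_def Let_def by (cases "j = 1"; cases "j = 2") simp_all
  qed
qed

lemma polynomial_slice_map: "(\<lambda>s. slice_map n \<Psi> s i) \<in> polynomial_functions"
proof -
  have "(\<lambda>s. slice_value n \<Psi> s 1 * slice_frame n s (\<Psi> 1) k) \<in> polynomial_functions"
    "(\<lambda>s. slice_value n \<Psi> s 2 * slice_frame n s (\<Psi> 2) k) \<in> polynomial_functions"
    "(\<lambda>s. slice_value n \<Psi> s 3 * slice_frame n s (\<Psi> 3) k - slice_value n \<Psi> s 1 * slice_frame n s (\<Psi> 1) k
      - slice_value n \<Psi> s 2 * slice_frame n s (\<Psi> 2) k) \<in> polynomial_functions" for k
    by (intro polynomial_intros polynomial_slice_value polynomial_frame)+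
  note P = this[of 0] this[of 1] polynomial_functions.const[of 0]
  consider "i = 0" | "i = 1" | "i = 2" | "i = 3" | "i = 4" | "i = 5" | "i > 5" by linarith
  then show ?thesis
    unfolding slice_map_def interp_def by cases (use P in simp_all)
qed

lemma polynomial_form_resultant:
  assumes "\<And>i. (\<lambda>s. a s i) \<in> polynomial_functions"
  shows "(\<lambda>s. form_resultant (a s)) \<in> polynomial_functions"
  unfolding form_resultant_formula by (intro polynomial_intros assms)

lemma polynomial_discriminant: "discriminant n \<Psi> \<in> polynomial_functions"
proof -
  have b: "(\<lambda>s. br (slice_frame n s i) (slice_frame n s j)) \<in> polynomial_functions" for i j
    by (rule polynomial_br[OF polynomial_frame polynomial_frame])
  have "(\<lambda>s. \<Prod>p\<in>{(i, j). i \<in> {1..n} \<and> j \<in> {1..n} \<and> i \<noteq> j}. br (slice_frame n s (fst p)) (slice_frame n s (snd p)))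
     \<in> polynomial_functions"
    by (rule polynomial_prod) (rule b)
  from polynomial_functions.mult[OF polynomial_form_resultant[OF polynomial_slice_map] this]
  show ?thesis unfolding discriminant_def[abs_def] by (simp add: case_prod_beta)
qed

subsection \<open>The parameters determine the normal form\<close>

lemma interp_frame_value:
  assumes "j \<in> {1, 2, 3}" and w: "w j \<in> vectors 2"
  shows "quadratic_pair (interp l w) (frame t j) = (\<lambda>k. l j * w j k)"
proof (rule vectors2_eqI)
  show "quadratic_pair (interp l w) (frame t j) \<in> vectors 2" by simp
  show "(\<lambda>k. l j * w j k) \<in> vectors 2" using w by (simp add: vectors_def)
  show "quadratic_pair (interp l w) (frame t j) 0 = l j * w j 0"
    using interp_eval[of 0 l w "frame t j"] assms(1) by auto
  show "quadratic_pair (interp l w) (frame t j) 1 = l j * w j 1"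
    using interp_eval[of 1 l w "frame t j"] assms(1) by auto
qed

context
  fixes n :: nat and \<Psi> :: "nat \<Rightarrow> nat"
  assumes n: "n \<in> {3, 4, 5}" and Psi: "bij_betw \<Psi> {1..n} {1..n}"
begin

lemma Psi_range: "i \<in> {1..n} \<Longrightarrow> \<Psi> i \<in> {1..n}"
  using Psi bij_betwE by blast

lemma Psi_inj: "i \<in> {1..n} \<Longrightarrow> j \<in> {1..n} \<Longrightarrow> \<Psi> i = \<Psi> j \<longleftrightarrow> i = j"
  by (rule inj_on_eq_iff[OF bij_betw_imp_inj_on[OF Psi]])

lemma three_in: "1 \<in> {1..n}" "2 \<in> {1..n}" "3 \<in> {1..n}"
  using n by auto

lemma index_cases:
  assumes "i \<in> {1..n}"
  obtains "i = 1" | "i = 2" | "i = 3" | "i = 4" "4 \<le> n" | "i = 5" "n = 5"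
proof -
  have "1 \<le> i" "i \<le> n" "n = 3 \<or> n = 4 \<or> n = 5" using assms n by auto
  then have "i = 1 \<or> i = 2 \<or> i = 3 \<or> (i = 4 \<and> 4 \<le> n) \<or> (i = 5 \<and> n = 5)" by presburger
  then show ?thesis using that by blast
qed

lemma interp_value_nonzero:
  assumes R: "form_resultant (interp l w) \<noteq> 0" and w: "w j \<in> vectors 2" and j: "j \<in> {1, 2, 3}"
  shows "l j \<noteq> 0"
proof
  assume "l j = 0"
  then have "quadratic_pair (interp l w) (frame undefined j) = (\<lambda>_. 0)"
    using interp_frame_value[where t=undefined and l=l and w=w and j=j, OF j w] by simp
  moreover have "quadratic_pair (interp l w) (frame undefined j) \<in> nzvec"
    by (rule quadratic_pair_nonzero[OF R]) simp
  ultimately show False by (simp add: nzvec_def)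
qed

lemma frame_distinct:
  assumes br: "\<And>i j. i \<in> {1..n} \<Longrightarrow> j \<in> {1..n} \<Longrightarrow> i \<noteq> j \<Longrightarrow> br (frame t i) (frame t j) \<noteq> 0"
    and i: "i \<in> {4..n}"
  shows "t i \<noteq> 0" "t i \<noteq> 1" "j \<in> {1, 2, 3} \<Longrightarrow> portrait_coeff \<Psi> t i j \<noteq> 0"
proof -
  have fi: "frame t i = pairvec (t i) 1" and iin: "i \<in> {1..n}" using i by (auto simp: frame_def)
  have "br (frame t i) (frame t 2) \<noteq> 0" by (rule br) (use iin i three_in in auto)
  then show t0: "t i \<noteq> 0" by (simp add: fi br_def)
  have "br (frame t i) (frame t 3) \<noteq> 0" by (rule br) (use iin i three_in in auto)
  then show t1: "t i \<noteq> 1" by (simp add: fi br_def)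
  assume j: "j \<in> {1, 2, 3}"
  have jin: "j \<in> {1..n}" using j three_in by blast
  have "j \<noteq> i" using j i by auto
  note jin = jin this
  have "br (frame t (\<Psi> j)) (frame t (\<Psi> i)) \<noteq> 0"
    by (rule br[OF Psi_range[OF jin(1)] Psi_range[OF iin]]) (use Psi_inj[OF jin(1) iin] jin(2) in simp)
  then show "portrait_coeff \<Psi> t i j \<noteq> 0" using t0 t1 unfolding portrait_coeff_def by simp
qed

text \<open>For five points the cross product cannot vanish: otherwise the two conditions coincide and
  there is a pencil of maps with the same values at the five points, while a map of degree two
  is determined by its values at five points.\<close>

lemma slice_parameters:
  assumes R: "form_resultant (interp l (\<lambda>j. frame t (\<Psi> j))) \<noteq> 0"
    and br: "\<And>i j. i \<in> {1..n} \<Longrightarrow> j \<in> {1..n} \<Longrightarrow> i \<noteq> j \<Longrightarrow> br (frame t i) (frame t j) \<noteq> 0"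
    and cond: "\<And>i. i \<in> {4..n} \<Longrightarrow>
      br (quadratic_pair (interp l (\<lambda>j. frame t (\<Psi> j))) (frame t i)) (frame t (\<Psi> i)) = 0"
  defines "s \<equiv> coords n l t"
  shows "\<And>i. i \<in> {1..n} \<Longrightarrow> slice_frame n s i = frame t i"
    and "\<exists>k. k \<noteq> 0 \<and> (\<forall>j\<in>{1, 2, 3}. slice_value n \<Psi> s j = k * l j)"
proof -
  show fr: "slice_frame n s i = frame t i" if i: "i \<in> {1..n}" for i
    using i by (rule index_cases)
      (use n in \<open>auto simp: slice_frame_def param_def s_def coords_def\<close>)
  have l: "l j \<noteq> 0" if "j \<in> {1, 2, 3}" for j
    by (rule interp_value_nonzero[OF R _ that]) simp
  let ?A = "portrait_coeff \<Psi> t 4" and ?B = "portrait_coeff \<Psi> t 5"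
  have coeff: "portrait_coeff \<Psi> (param n s) i j = portrait_coeff \<Psi> t i j" if i: "i \<in> {4..n}" and j: "j \<in> {1, 2, 3}" for i j
  proof -
    have iin: "i \<in> {1..n}" "j \<in> {1..n}" using i j three_in by auto
    have "param n s i = t i" using fr[OF iin(1)] i by (simp add: slice_frame_def frame_def)
    then show ?thesis unfolding portrait_coeff_def
      using fr[OF Psi_range[OF iin(1)]] fr[OF Psi_range[OF iin(2)]] by (simp add: slice_frame_def)
  qed
  have A: "l 1 * ?A 1 + l 2 * ?A 2 + l 3 * ?A 3 = 0" if "4 \<le> n"
    using cond[of 4] that br_interp_frame[of 4 l t \<Psi>] by simp
  have B: "l 1 * ?B 1 + l 2 * ?B 2 + l 3 * ?B 3 = 0" if "n = 5"
    using cond[of 5] that br_interp_frame[of 5 l t \<Psi>] by simp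
  have l123: "l 1 \<noteq> 0" "l 2 \<noteq> 0" "l 3 \<noteq> 0" using l by simp_all
  consider "n = 3" | "n = 4" | "n = 5" using n by blast
  then show "\<exists>k. k \<noteq> 0 \<and> (\<forall>j\<in>{1, 2, 3}. slice_value n \<Psi> s j = k * l j)"
  proof cases
    case 1
    then show ?thesis using l123
      by (intro exI[of _ "1 / l 1"]) (simp add: slice_value_def s_def coords_def)
  next
    case 2
    have c: "portrait_coeff \<Psi> (param n s) 4 j = ?A j" if "j \<in> {1, 2, 3}" for j using coeff[of 4 j] 2 that by simp
    have A3: "?A 3 \<noteq> 0" using frame_distinct(3)[OF br, of 4 3] 2 by simp
    have s1: "s 1 = l 2 / l 1" using 2 by (simp add: s_def coords_def)
    have e: "l 3 * ?A 3 = - (l 1 * ?A 1 + l 2 * ?A 2)" using A 2 by (simp add: add_eq_0_iff)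
    have v: "slice_value n \<Psi> s 1 = ?A 3" "slice_value n \<Psi> s 2 = s 1 * ?A 3" "slice_value n \<Psi> s 3 = - (?A 1 + s 1 * ?A 2)"
      using 2 c by (simp_all add: slice_value_def Let_def)
    have "?A 3 / l 1 * l 3 = (l 3 * ?A 3) / l 1" by simp
    also have "\<dots> = - (?A 1 + l 2 / l 1 * ?A 2)" unfolding e using l123(1) by (simp add: field_simps)
    finally have "slice_value n \<Psi> s 3 = ?A 3 / l 1 * l 3" unfolding v s1 by (rule sym)
    then show ?thesis using v s1 l123 A3 by (intro exI[of _ "?A 3 / l 1"]) (simp add: field_simps)
  next
    case 3
    have c4: "portrait_coeff \<Psi> (param n s) 4 j = ?A j" if "j \<in> {1, 2, 3}" for j using coeff[of 4 j] 3 that by simp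
    have c5: "portrait_coeff \<Psi> (param n s) 5 j = ?B j" if "j \<in> {1, 2, 3}" for j using coeff[of 5 j] 3 that by simp
    have v: "slice_value n \<Psi> s 1 = ?A 2 * ?B 3 - ?A 3 * ?B 2" "slice_value n \<Psi> s 2 = ?A 3 * ?B 1 - ?A 1 * ?B 3"
      "slice_value n \<Psi> s 3 = ?A 1 * ?B 2 - ?A 2 * ?B 1"
      using 3 c4 c5 by (simp_all add: slice_value_def Let_def)
    have Az: "l 1 * ?A 1 + l 2 * ?A 2 + l 3 * ?A 3 = 0" and Bz: "l 1 * ?B 1 + l 2 * ?B 2 + l 3 * ?B 3 = 0"
      using A B 3 by simp_all
    have "slice_value n \<Psi> s 2 * l 1 - slice_value n \<Psi> s 1 * l 2 =
       ?A 3 * (l 1 * ?B 1 + l 2 * ?B 2 + l 3 * ?B 3) - ?B 3 * (l 1 * ?A 1 + l 2 * ?A 2 + l 3 * ?A 3)"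
      unfolding v by (simp add: algebra_simps)
    then have p2: "slice_value n \<Psi> s 2 * l 1 = slice_value n \<Psi> s 1 * l 2" using Az Bz by simp
    have "slice_value n \<Psi> s 3 * l 1 - slice_value n \<Psi> s 1 * l 3 =
       ?B 2 * (l 1 * ?A 1 + l 2 * ?A 2 + l 3 * ?A 3) - ?A 2 * (l 1 * ?B 1 + l 2 * ?B 2 + l 3 * ?B 3)"
      unfolding v by (simp add: algebra_simps)
    then have p3: "slice_value n \<Psi> s 3 * l 1 = slice_value n \<Psi> s 1 * l 3" using Az Bz by simp
    have "slice_value n \<Psi> s 1 \<noteq> 0"
    proof
      assume "slice_value n \<Psi> s 1 = 0"
      then have "slice_value n \<Psi> s 3 = 0" using p3 l123 by simp
      then have par: "?A 1 * ?B 2 - ?A 2 * ?B 1 = 0" unfolding v .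
      define m where "m j = (if j = 1 then ?A 2 else if j = 2 then - ?A 1 else 0)" for j :: nat
      let ?w = "\<lambda>j. frame t (\<Psi> j)"
      have mA: "br (quadratic_pair (interp m ?w) (frame t 4)) (frame t (\<Psi> 4)) = 0"
        unfolding br_interp_frame[OF order_refl] m_def by simp
      have mB: "br (quadratic_pair (interp m ?w) (frame t 5)) (frame t (\<Psi> 5)) = 0"
        using br_interp_frame[of 5 m t \<Psi>] par unfolding m_def by (simp add: algebra_simps)
      have z: "br (quadratic_pair (interp l ?w) (frame t i)) (quadratic_pair (interp m ?w) (frame t i)) = 0"
        if i: "i \<in> {1..n}" for i
        using i
      proof (rule index_cases)
        have small: "br (quadratic_pair (interp l ?w) (frame t j)) (quadratic_pair (interp m ?w) (frame t j)) = 0"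
          if "j \<in> {1, 2, 3}" for j
          using interp_frame_value[OF that, of ?w] by (simp add: br_def)
        show ?thesis if "i = 1" using small[of i] that by simp
        show ?thesis if "i = 2" using small[of i] that by simp
        show ?thesis if "i = 3" using small[of i] that by simp
        show ?thesis if "i = 4" "4 \<le> n"
          using br_parallel_trans[of "frame t (\<Psi> 4)", OF _ _ mA] cond[of 4] that by simp
        show ?thesis if "i = 5" "n = 5"
          using br_parallel_trans[of "frame t (\<Psi> 5)", OF _ _ mB] cond[of 5] that by simp
      qed
      have t4: "t 4 \<noteq> 0" "t 4 \<noteq> 1" "t 5 \<noteq> 0" "t 5 \<noteq> 1"
        using frame_distinct(1,2)[OF br, of 4] frame_distinct(1,2)[OF br, of 5] 3 by simp_all
      have "br (frame t 4) (frame t 5) \<noteq> 0" by (rule br) (use 3 in simp_all)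
      then have t45: "t 4 \<noteq> t 5" by (simp add: br_def)
      have "\<exists>c. \<forall>i<6. interp m ?w i = c * interp l ?w i"
      proof (rule quadratic_maps_agree_at_five[OF R t4 t45])
        fix v assume "v \<in> {pairvec 1 0, pairvec 0 1, pairvec 1 1, pairvec (t 4) 1, pairvec (t 5) 1}"
        then have "v \<in> {frame t 1, frame t 2, frame t 3, frame t 4, frame t 5}" by simp
        then show "br (quadratic_pair (interp l ?w) v) (quadratic_pair (interp m ?w) v) = 0"
          using z[of 1] z[of 2] z[of 3] z[of 4] z[of 5] 3 by auto
      qed
      then obtain c where c: "\<forall>i<6. interp m ?w i = c * interp l ?w i" by blast
      have qc: "quadratic_pair (interp m ?w) v k = c * quadratic_pair (interp l ?w) v k" for v k
        using c by (simp add: quadratic_pair_def algebra_simps)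
      have q: "m j * ?w j k = c * (l j * ?w j k)" if "j \<in> {1, 2, 3}" for j k
        using qc[of "frame t j" k] interp_frame_value[OF that, of ?w] by simp
      have nz: "\<exists>k. ?w j k \<noteq> 0" for j
        using frame_simps(7)[of t "\<Psi> j"] unfolding nzvec_iff by blast
      have q': "m j = c * l j" if "j \<in> {1, 2, 3}" for j
        using q[OF that] nz[of j] by auto
      have "c = 0" using q'[of 3] l123 by (simp add: m_def)
      then have "?A 2 = 0" using q'[of 1] by (simp add: m_def)
      then show False using frame_distinct(3)[OF br, of 4 2] 3 by simp
    qed
    then show ?thesis using p2 p3 l123
      by (intro exI[of _ "slice_value n \<Psi> s 1 / l 1"]) (simp add: field_simps)
  qed
qed

end

section \<open>Quadratic maps with a portrait\<close>

lemma form_resultant_scale: "form_resultant (\<lambda>i. d * a i) = d ^ 4 * form_resultant a"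
  unfolding form_resultant_formula by (simp add: algebra_simps eval_nat_numeral)

lemma quadratic_pair_scale_vector: "quadratic_pair a (\<lambda>i. c * v i) = (\<lambda>i. c\<^sup>2 * quadratic_pair a v i)"
  using quadratic_pair_scale[of 1 a c v] by simp

lemma quadratic_pair_scale_map: "quadratic_pair (\<lambda>i. d * a i) v = (\<lambda>i. d * quadratic_pair a v i)"
  using quadratic_pair_scale[of d a 1 v] by simp

lemma nzvec_scale: "v \<in> nzvec \<Longrightarrow> c \<noteq> 0 \<Longrightarrow> (\<lambda>i. c * v i) \<in> nzvec"
  by (auto simp: nzvec_iff vectors_def)

lemma pt_scale: "v \<in> nzvec \<Longrightarrow> c \<noteq> 0 \<Longrightarrow> pt (\<lambda>i. c * v i) = pt v"
  using pt_eq_scale_iff[of v "\<lambda>i. c * v i"] nzvec_scale[of v c] by blast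

lemma pt_in_P1: "v \<in> nzvec \<Longrightarrow> pt v \<in> points P1"
  unfolding points_P1 by (rule imageI)

lemma Rat2D:
  assumes "q \<in> Rat2" "a \<in> q"
  shows "a \<in> punctured 5" "q = proj_point 5 a" "form_resultant a \<noteq> 0"
proof -
  have q: "q \<in> points (projective_space 5)" and R: "\<forall>a\<in>q. form_resultant a \<noteq> 0"
    using assms(1) by (simp_all add: Rat2_def)
  show "a \<in> punctured 5" "q = proj_point 5 a" using in_projective_pointD[OF q assms(2)] by simp_all
  show "form_resultant a \<noteq> 0" using R assms(2) by blast
qed

lemma proj_point_in_Rat2:
  assumes a: "a \<in> punctured 5" and R: "form_resultant a \<noteq> 0"
  shows "proj_point 5 a \<in> Rat2"
proof -
  have "form_resultant b \<noteq> 0" if b: "b \<in> proj_point 5 a" for b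
  proof -
    obtain d where "d \<noteq> 0" "b = (\<lambda>i. d * a i)" using b in_proj_point_iff[OF a] by blast
    then show ?thesis using R by (simp add: form_resultant_scale)
  qed
  then show ?thesis using proj_pointI[OF a] by (simp add: Rat2_def)
qed

lemma Rat2_nonempty: "q \<in> Rat2 \<Longrightarrow> \<exists>a. a \<in> q"
  using projective_point_nonempty[of q 5] by (simp add: Rat2_def)

lemma rat_map_pt:
  assumes a: "a \<in> punctured 5" and v: "v \<in> nzvec" and R: "form_resultant a \<noteq> 0"
  shows "rat_map (proj_point 5 a) (pt v) = pt (quadratic_pair a v)"
proof -
  note q = quadratic_pair_nonzero[OF R v]
  show ?thesis
  proof (rule equalityI; rule subsetI)
    fix w assume "w \<in> rat_map (proj_point 5 a) (pt v)"
    then obtain b u where bu: "b \<in> proj_point 5 a" "u \<in> pt v" "w = quadratic_pair b u"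
      unfolding rat_map_def by blast
    obtain d where d: "d \<noteq> 0" "b = (\<lambda>i. d * a i)" using bu(1) in_proj_point_iff[OF a] by blast
    obtain c where c: "c \<noteq> 0" "u = (\<lambda>i. c * v i)" using bu(2) in_pt_iff[OF v] by blast
    have "w = (\<lambda>i. d * c\<^sup>2 * quadratic_pair a v i)" unfolding bu(3) d(2) c(2) by (rule quadratic_pair_scale)
    moreover have "d * c\<^sup>2 \<noteq> 0" using c d by simp
    ultimately show "w \<in> pt (quadratic_pair a v)" using in_pt_iff[OF q] by blast
  next
    fix w assume "w \<in> pt (quadratic_pair a v)"
    then obtain d where d: "d \<noteq> 0" "w = (\<lambda>i. d * quadratic_pair a v i)" using in_pt_iff[OF q] by blast
    have "w = quadratic_pair (\<lambda>i. d * a i) v" unfolding d(2) quadratic_pair_scale_map ..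
    moreover have "(\<lambda>i. d * a i) \<in> proj_point 5 a" using in_proj_point_iff[OF a] d(1) by blast
    ultimately show "w \<in> rat_map (proj_point 5 a) (pt v)" unfolding rat_map_def using pt_self[OF v] by blast
  qed
qed

lemma rat_map_points:
  assumes q: "q \<in> Rat2" and z: "z \<in> points P1"
  shows "rat_map q z \<in> points P1"
proof -
  obtain a where a: "a \<in> q" using Rat2_nonempty[OF q] by blast
  obtain v where v: "v \<in> nzvec" "z = pt v" using z unfolding points_P1 by blast
  show ?thesis
    using rat_map_pt[OF Rat2D(1)[OF q a] v(1) Rat2D(3)[OF q a]] Rat2D(2)[OF q a] v(2)
      pt_in_P1[OF quadratic_pair_nonzero[OF Rat2D(3)[OF q a] v(1)]] by simp
qed

definition factor :: "nat \<Rightarrow> (nat \<Rightarrow> complex) set fspace" where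
  "factor i = (if i = 0 then projective_space 5 else P1)"

lemma factor_simps [simp]: "factor 0 = projective_space 5" "i \<noteq> 0 \<Longrightarrow> factor i = P1"
  by (simp_all add: factor_def)

lemma space_with_functions_factor: "space_with_functions (factor i)"
  unfolding factor_def using space_with_functions_projective_space by simp

lemma End_ambient_product: "End_ambient n = product_space {0..n} factor"
proof -
  have "(\<lambda>i. if i = 0 then projective_space 5 else projective_space 1) = factor"
    by (rule ext) (simp add: factor_def)
  then show ?thesis unfolding End_ambient_def by simp
qed

lemma finite_index: "finite {0..n}" "{0..n::nat} \<noteq> {}"
  by simp_all

lemma space_with_functions_End_ambient: "space_with_functions (End_ambient n)"
  unfolding End_ambient_product
  by (rule space_with_functions_product[OF finite_index space_with_functions_factor])

lemma points_End_ambient: "points (End_ambient n) = Pi\<^sub>E {0..n} (\<lambda>i. points (factor i))"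
  unfolding End_ambient_product
  by (rule points_product_space[OF finite_index space_with_functions_factor])

lemma space_with_functions_End_portrait: "space_with_functions (End_portrait n \<Psi>)"
  unfolding End_portrait_def by (rule space_with_functions_induced[OF space_with_functions_End_ambient])

lemma End_portrait_iff:
  "x \<in> points (End_portrait n \<Psi>) \<longleftrightarrow> x \<in> points (End_ambient n) \<and> x 0 \<in> Rat2 \<and>
    (\<forall>i\<in>{1..n}. rat_map (x 0) (x i) = x (\<Psi> i)) \<and> inj_on x {1..n}"
  by (auto simp: End_portrait_def)

lemma End_portrait_component:
  assumes "x \<in> points (End_portrait n \<Psi>)" "i \<in> {1..n}"
  shows "x i \<in> points P1"
proof -
  have "x \<in> Pi\<^sub>E {0..n} (\<lambda>i. points (factor i))"
    using assms(1) unfolding End_portrait_iff points_End_ambient by blast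
  then have "x i \<in> points (factor i)" by (rule PiE_mem) (use assms(2) in simp)
  then show ?thesis using assms(2) by simp
qed

lemma morphism_End_component:
  assumes "i \<in> {0..n}" shows "morphism (End_portrait n \<Psi>) (factor i) (\<lambda>x. x i)"
proof -
  have "morphism (End_ambient n) (factor i) (\<lambda>x. x i)"
    unfolding End_ambient_product
    by (rule morphism_projection[OF finite_index space_with_functions_factor assms])
  from morphism_compose[OF morphism_inclusion[OF space_with_functions_End_ambient] this]
  show ?thesis unfolding End_portrait_def .
qed

subsection \<open>Orbits\<close>

lemma orbit_relationI:
  assumes "x \<in> points (End_portrait n \<Psi>)" "y \<in> points (End_portrait n \<Psi>)" "isomorphism P1 P1 \<phi> \<psi>"
    and "\<And>z. z \<in> points P1 \<Longrightarrow> rat_map (y 0) z = \<psi> (rat_map (x 0) (\<phi> z))"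
    and "\<And>i. i \<in> {1..n} \<Longrightarrow> y i = \<psi> (x i)"
  shows "(x, y) \<in> orbit_relation n \<Psi>"
  unfolding orbit_relation_def using assms by auto

lemma orbit_relationD:
  assumes "(x, y) \<in> orbit_relation n \<Psi>"
  shows "x \<in> points (End_portrait n \<Psi>)" "y \<in> points (End_portrait n \<Psi>)"
    "\<exists>\<phi> \<psi>. isomorphism P1 P1 \<phi> \<psi> \<and> (\<forall>z \<in> points P1. rat_map (y 0) z = \<psi> (rat_map (x 0) (\<phi> z))) \<and>
      (\<forall>i\<in>{1..n}. y i = \<psi> (x i))"
  using assms unfolding orbit_relation_def by auto

lemma equiv_orbit_relation: "equiv (points (End_portrait n \<Psi>)) (orbit_relation n \<Psi>)"
proof (rule equivI)
  let ?E = "points (End_portrait n \<Psi>)" and ?R = "orbit_relation n \<Psi>"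
  have P: "space_with_functions P1" by (rule space_with_functions_projective_space)
  have rat: "rat_map (x 0) z \<in> points P1" if "x \<in> ?E" "z \<in> points P1" for x z
    using rat_map_points that End_portrait_iff by blast
  show "?R \<subseteq> ?E \<times> ?E" unfolding orbit_relation_def by auto
  show "refl_on ?E ?R"
  proof (rule refl_onI)
    fix x assume x: "x \<in> ?E"
    show "(x, x) \<in> ?R" by (rule orbit_relationI[OF x x isomorphism_id[OF P]]) simp_all
  qed
  show "sym ?R"
  proof (rule symI)
    fix x y assume xy: "(x, y) \<in> ?R"
    note E = orbit_relationD(1,2)[OF xy]
    obtain \<phi> \<psi> where iso: "isomorphism P1 P1 \<phi> \<psi>"
      and m: "\<forall>z \<in> points P1. rat_map (y 0) z = \<psi> (rat_map (x 0) (\<phi> z))" and p: "\<forall>i\<in>{1..n}. y i = \<psi> (x i)"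
      using orbit_relationD(3)[OF xy] by (elim exE conjE) (rule that)
    show "(y, x) \<in> ?R"
    proof (rule orbit_relationI[OF E(2,1) isomorphism_sym[OF iso]])
      fix z assume z: "z \<in> points P1"
      have pz: "\<psi> z \<in> points P1" by (rule morphism_maps[OF isomorphismD(2)[OF iso] z])
      have "\<phi> (rat_map (y 0) (\<psi> z)) = \<phi> (\<psi> (rat_map (x 0) (\<phi> (\<psi> z))))" using m pz by simp
      also have "\<phi> (\<psi> z) = z" by (rule isomorphismD(4)[OF iso z])
      also have "\<phi> (\<psi> (rat_map (x 0) z)) = rat_map (x 0) z" by (rule isomorphismD(4)[OF iso rat[OF E(1) z]])
      finally show "rat_map (x 0) z = \<phi> (rat_map (y 0) (\<psi> z))" by (rule sym)
    next
      fix i assume i: "i \<in> {1..n}"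
      show "x i = \<phi> (y i)"
        using p i isomorphismD(4)[OF iso End_portrait_component[OF E(1) i]] by simp
    qed
  qed
  show "trans ?R"
  proof (rule transI)
    fix x y w assume xy: "(x, y) \<in> ?R" and yw: "(y, w) \<in> ?R"
    note E = orbit_relationD(1,2)[OF xy] orbit_relationD(2)[OF yw]
    obtain \<phi> \<psi> where iso: "isomorphism P1 P1 \<phi> \<psi>"
      and m: "\<forall>z \<in> points P1. rat_map (y 0) z = \<psi> (rat_map (x 0) (\<phi> z))" and p: "\<forall>i\<in>{1..n}. y i = \<psi> (x i)"
      using orbit_relationD(3)[OF xy] by (elim exE conjE) (rule that)
    obtain \<phi>' \<psi>' where iso': "isomorphism P1 P1 \<phi>' \<psi>'"
      and m': "\<forall>z \<in> points P1. rat_map (w 0) z = \<psi>' (rat_map (y 0) (\<phi>' z))" and p': "\<forall>i\<in>{1..n}. w i = \<psi>' (y i)"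
      using orbit_relationD(3)[OF yw] by (elim exE conjE) (rule that)
    show "(x, w) \<in> ?R"
    proof (rule orbit_relationI[OF E(1,3) isomorphism_compose[OF iso' iso]])
      fix z assume z: "z \<in> points P1"
      have "\<phi>' z \<in> points P1" by (rule morphism_maps[OF isomorphismD(1)[OF iso'] z])
      then show "rat_map (w 0) z = \<psi>' (\<psi> (rat_map (x 0) (\<phi> (\<phi>' z))))" using m m' z by simp
    next
      fix i assume "i \<in> {1..n}"
      then show "w i = \<psi>' (\<psi> (x i))" using p p' by simp
    qed
  qed
qed

subsection \<open>Moving three points to infinity, zero and one\<close>

text \<open>All quantities below are rational in homogeneous coordinates \<open>a\<close> of the map and \<open>v i\<close> of the
  points, with brackets of distinct points as denominators: this makes the parameters regular. The
  multiplier is the factor between the value of the map at \<open>v i\<close> and the vector \<open>v (\<Psi> i)\<close>, found by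
  comparing their brackets with one of the other points. The frame scale is the factor between
  the image of \<open>v i\<close> under the linear map to the frame and the \<open>i\<close>-th vector of the frame. The frame
  value is the multiplier of the conjugated map at the vectors of the frame.\<close>

definition multiplier :: "(nat \<Rightarrow> nat) \<Rightarrow> (nat \<Rightarrow> complex) \<Rightarrow> (nat \<Rightarrow> nat \<Rightarrow> complex) \<Rightarrow> nat \<Rightarrow> complex" where
  "multiplier \<Psi> a v i = (let u = v (if \<Psi> i = 1 then 2 else 1)
     in br (quadratic_pair a (v i)) u / br (v (\<Psi> i)) u)"

definition frame_scale :: "(nat \<Rightarrow> nat \<Rightarrow> complex) \<Rightarrow> nat \<Rightarrow> complex" where
  "frame_scale v i = (if i = 1 then br (v 1) (v 2) * br (v 3) (v 1) else br (v i) (v 1) * br (v 3) (v 2))"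

definition cross_ratio :: "(nat \<Rightarrow> nat \<Rightarrow> complex) \<Rightarrow> nat \<Rightarrow> complex" where
  "cross_ratio v i = br (v i) (v 2) * br (v 3) (v 1) / (br (v i) (v 1) * br (v 3) (v 2))"

definition frame_value :: "(nat \<Rightarrow> nat) \<Rightarrow> (nat \<Rightarrow> complex) \<Rightarrow> (nat \<Rightarrow> nat \<Rightarrow> complex) \<Rightarrow> nat \<Rightarrow> complex" where
  "frame_value \<Psi> a v i = multiplier \<Psi> a v i * frame_scale v (\<Psi> i) / (frame_scale v i)\<^sup>2"

definition invariants :: "nat \<Rightarrow> (nat \<Rightarrow> nat) \<Rightarrow> (nat \<Rightarrow> complex) \<Rightarrow> (nat \<Rightarrow> nat \<Rightarrow> complex) \<Rightarrow> nat \<Rightarrow> complex" where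
  "invariants n \<Psi> a v = coords n (frame_value \<Psi> a v) (cross_ratio v)"

definition section_point :: "nat \<Rightarrow> (nat \<Rightarrow> nat) \<Rightarrow> (nat \<Rightarrow> complex) \<Rightarrow> nat \<Rightarrow> (nat \<Rightarrow> complex) set" where
  "section_point n \<Psi> s = (\<lambda>i\<in>{0..n}. if i = 0 then proj_point 5 (slice_map n \<Psi> s) else pt (slice_frame n s i))"

lemma section_point_simps [simp]:
  "section_point n \<Psi> s 0 = proj_point 5 (slice_map n \<Psi> s)"
  "i \<in> {1..n} \<Longrightarrow> section_point n \<Psi> s i = pt (slice_frame n s i)"
  by (simp_all add: section_point_def)

lemma slice_frame_nzvec [simp]: "slice_frame n s i \<in> nzvec" "slice_frame n s i \<in> vectors 2"
  by (simp_all add: slice_frame_def)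

lemma interp_punctured:
  assumes "form_resultant (interp l w) \<noteq> 0" shows "interp l w \<in> punctured 5"
proof -
  have "interp l w \<in> vectors (Suc 5)" by (auto simp: vectors_def interp_def)
  moreover have "interp l w \<noteq> (\<lambda>_. 0)"
  proof
    assume "interp l w = (\<lambda>_. 0)"
    then show False using assms by (simp add: form_resultant_formula)
  qed
  ultimately show ?thesis by blast
qed

definition lifts :: "nat \<Rightarrow> (nat \<Rightarrow> nat) \<Rightarrow> (nat \<Rightarrow> (nat \<Rightarrow> complex) set) \<Rightarrow>
    (nat \<Rightarrow> complex) \<Rightarrow> (nat \<Rightarrow> nat \<Rightarrow> complex) \<Rightarrow> bool" where
  "lifts n \<Psi> x a v \<longleftrightarrow> x \<in> points (End_portrait n \<Psi>) \<and> a \<in> x 0 \<and> (\<forall>i\<in>{1..n}. v i \<in> x i)"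

context
  fixes n :: nat and \<Psi> :: "nat \<Rightarrow> nat"
  assumes n: "n \<in> {3, 4, 5}" and Psi: "bij_betw \<Psi> {1..n} {1..n}"
begin

lemma portrait_range: "i \<in> {1..n} \<Longrightarrow> \<Psi> i \<in> {1..n}"
  by (rule Psi_range[OF n Psi])

lemma first_three: "1 \<in> {1..n}" "2 \<in> {1..n}" "3 \<in> {1..n}"
  by (rule three_in[OF n Psi])+

lemma section_point_in_End:
  assumes s: "s \<in> principal_open (discriminant n \<Psi>)"
  shows "section_point n \<Psi> s \<in> points (End_portrait n \<Psi>)"
proof -
  let ?a = "slice_map n \<Psi> s" and ?f = "slice_frame n s"
  have R: "form_resultant ?a \<noteq> 0"
    and br: "\<And>i j. i \<in> {1..n} \<Longrightarrow> j \<in> {1..n} \<Longrightarrow> i \<noteq> j \<Longrightarrow> br (?f i) (?f j) \<noteq> 0"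
    using s discriminant_nonzero_iff[of n \<Psi> s] by (simp_all add: principal_open_def)
  have a: "?a \<in> punctured 5" unfolding slice_map_def by (rule interp_punctured) (use R in \<open>simp add: slice_map_def\<close>)
  have "section_point n \<Psi> s \<in> points (End_ambient n)"
    unfolding points_End_ambient
  proof (rule PiE_I)
    fix i assume "i \<in> {0..n}"
    then show "section_point n \<Psi> s i \<in> points (factor i)"
      using proj_pointI[OF a] pt_in_P1 by (cases "i = 0") simp_all
  next
    fix i assume "i \<notin> {0..n}"
    then show "section_point n \<Psi> s i = undefined" by (simp add: section_point_def)
  qed
  moreover have "rat_map (section_point n \<Psi> s 0) (section_point n \<Psi> s i) = section_point n \<Psi> s (\<Psi> i)"
    if i: "i \<in> {1..n}" for i
  proof -
    have "br (quadratic_pair ?a (?f i)) (?f (\<Psi> i)) = 0"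
    proof -
      have small: "br (quadratic_pair ?a (?f j)) (?f (\<Psi> j)) = 0" if "j \<in> {1, 2, 3}" for j
        using interp_frame_value[OF that, of "\<lambda>j. slice_frame n s (\<Psi> j)" "slice_value n \<Psi> s" "param n s"]
        by (simp add: slice_map_def slice_frame_def br_def)
      note big = br_interp_frame[of _ "slice_value n \<Psi> s" "param n s" \<Psi>]
      show ?thesis using i
      proof (rule index_cases[OF n Psi])
        show ?thesis if "i = 1" using small[of i] that by simp
        show ?thesis if "i = 2" using small[of i] that by simp
        show ?thesis if "i = 3" using small[of i] that by simp
        show ?thesis if "i = 4" "4 \<le> n"
          using big[of 4] that n by (auto simp: slice_map_def slice_frame_def slice_value_def Let_def algebra_simps)
        show ?thesis if "i = 5" "n = 5"
          using big[of 5] that by (simp add: slice_map_def slice_frame_def slice_value_def Let_def algebra_simps)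
      qed
    qed
    then have "pt (quadratic_pair ?a (?f i)) = pt (?f (\<Psi> i))"
      using pt_eq_iff[OF quadratic_pair_nonzero[OF R, of "?f i"], of "?f (\<Psi> i)"] by simp
    then show ?thesis using rat_map_pt[OF a _ R, of "?f i"] i portrait_range[OF i] by simp
  qed
  moreover have "inj_on (section_point n \<Psi> s) {1..n}"
  proof (rule inj_onI, rule ccontr)
    fix i j assume ij: "i \<in> {1..n}" "j \<in> {1..n}" "section_point n \<Psi> s i = section_point n \<Psi> s j" "i \<noteq> j"
    then have "pt (?f i) = pt (?f j)" by simp
    then have "br (?f i) (?f j) = 0" using pt_eq_iff[of "?f i" "?f j"] by simp
    then show False using br ij by blast
  qed
  ultimately show ?thesis unfolding End_portrait_iff using proj_point_in_Rat2[OF a R] by simp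
qed

lemma lifts_map:
  assumes "lifts n \<Psi> x a v"
  shows "a \<in> punctured 5" "x 0 = proj_point 5 a" "form_resultant a \<noteq> 0"
  using assms Rat2D[of "x 0" a] unfolding lifts_def End_portrait_iff by auto

lemma lifts_point:
  assumes "lifts n \<Psi> x a v" "i \<in> {1..n}"
  shows "v i \<in> nzvec" "x i = pt (v i)"
  using assms in_P1D[OF End_portrait_component[of x n \<Psi> i], of "v i"] unfolding lifts_def by blast+

lemma lifts_br:
  assumes L: "lifts n \<Psi> x a v" and ij: "i \<in> {1..n}" "j \<in> {1..n}" "i \<noteq> j"
  shows "br (v i) (v j) \<noteq> 0"
proof
  assume "br (v i) (v j) = 0"
  then have eq: "x i = x j"
    using lifts_point[OF L ij(1)] lifts_point[OF L ij(2)] pt_eq_iff[of "v i" "v j"] by simp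
  have "inj_on x {1..n}" using L unfolding lifts_def End_portrait_iff by blast
  from inj_onD[OF this eq ij(1,2)] ij(3) show False by simp
qed

lemma lifts_multiplier:
  assumes L: "lifts n \<Psi> x a v" and i: "i \<in> {1..n}"
  shows "quadratic_pair a (v i) = (\<lambda>k. multiplier \<Psi> a v i * v (\<Psi> i) k)" and "multiplier \<Psi> a v i \<noteq> 0"
proof -
  note j = portrait_range[OF i]
  have "pt (quadratic_pair a (v i)) = rat_map (x 0) (x i)"
    using rat_map_pt[OF lifts_map(1)[OF L] lifts_point(1)[OF L i] lifts_map(3)[OF L]]
      lifts_map(2)[OF L] lifts_point(2)[OF L i] by simp
  also have "\<dots> = pt (v (\<Psi> i))"
    using L i lifts_point(2)[OF L j] unfolding lifts_def End_portrait_iff by simp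
  finally have "pt (v (\<Psi> i)) = pt (quadratic_pair a (v i))" by (rule sym)
  then obtain m where m: "m \<noteq> 0" "quadratic_pair a (v i) = (\<lambda>k. m * v (\<Psi> i) k)"
    using pt_eq_scale_iff[OF lifts_point(1)[OF L j] quadratic_pair_nonzero[OF lifts_map(3)[OF L] lifts_point(1)[OF L i]]]
    by blast
  let ?u = "v (if \<Psi> i = 1 then 2 else 1)"
  have "br (v (\<Psi> i)) ?u \<noteq> 0" by (rule lifts_br[OF L j]) (use first_three in simp_all)
  moreover have "br (\<lambda>k. m * v (\<Psi> i) k) ?u = m * br (v (\<Psi> i)) ?u" by (simp add: br_def algebra_simps)
  ultimately have "multiplier \<Psi> a v i = m" unfolding multiplier_def Let_def m(2) by simp
  then show "quadratic_pair a (v i) = (\<lambda>k. multiplier \<Psi> a v i * v (\<Psi> i) k)" "multiplier \<Psi> a v i \<noteq> 0"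
    using m by simp_all
qed

lemma lifts_frame_scale:
  assumes L: "lifts n \<Psi> x a v" and i: "i \<in> {1..n}"
  shows "frame_scale v i \<noteq> 0"
proof (cases "i = 1")
  case True
  then show ?thesis
    using lifts_br[OF L first_three(1,2)] lifts_br[OF L first_three(3,1)] unfolding frame_scale_def by simp
next
  case False
  then show ?thesis
    using lifts_br[OF L i first_three(1)] lifts_br[OF L first_three(3,2)] unfolding frame_scale_def by simp
qed

lemma lifts_frame_value:
  assumes L: "lifts n \<Psi> x a v" and i: "i \<in> {1..n}"
  shows "frame_value \<Psi> a v i \<noteq> 0"
  unfolding frame_value_def
  using lifts_multiplier(2)[OF L i] lifts_frame_scale[OF L portrait_range[OF i]] lifts_frame_scale[OF L i] by simp

text \<open>The linear map that carries the first three points to the frame conjugates the quadratic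
  map to the one with the prescribed values on the frame.\<close>

lemma normal_form:
  assumes L: "lifts n \<Psi> x a v"
  defines "s \<equiv> invariants n \<Psi> a v"
  shows "s \<in> principal_open (discriminant n \<Psi>)" and "(x, section_point n \<Psi> s) \<in> orbit_relation n \<Psi>"
proof -
  define t where "t = cross_ratio v"
  define l where "l = frame_value \<Psi> a v"
  define A where "A = interp l (\<lambda>j. frame t (\<Psi> j))"
  \<comment> \<open>The entries are chosen such that the coordinates of the image of \<open>u\<close> are multiples of \<open>br u (v 2)\<close> and \<open>br u (v 1)\<close>, and such that these are equal for \<open>u = v 3\<close>.\<close>
  define b1 where "b1 = v 2 1 * br (v 3) (v 1)"
  define b2 where "b2 = - v 2 0 * br (v 3) (v 1)"
  define b3 where "b3 = v 1 1 * br (v 3) (v 2)"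
  define b4 where "b4 = - v 1 0 * br (v 3) (v 2)"
  let ?g = "lin b1 b2 b3 b4" and ?g' = "lin b4 (- b2) (- b3) b1" and ?d = "b1 * b4 - b2 * b3"
  note br = lifts_br[OF L]
  note b_defs = b1_def b2_def b3_def b4_def
  have "?d = br (v 3) (v 1) * br (v 3) (v 2) * br (v 2) (v 1)"
    by (simp add: b_defs br_def algebra_simps)
  then have d: "?d \<noteq> 0" using br first_three by simp
  have g: "?g u = pairvec (br u (v 2) * br (v 3) (v 1)) (br u (v 1) * br (v 3) (v 2))" for u
    by (simp add: lin_def b_defs br_def algebra_simps)
  have gv: "?g (v i) = (\<lambda>k. frame_scale v i * frame t i k)" if i: "i \<in> {1..n}" for i
  proof (rule vectors2_eqI)
    show "?g (v i) \<in> vectors 2" by (simp add: lin_def)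
    show "(\<lambda>k. frame_scale v i * frame t i k) \<in> vectors 2"
      using frame_simps(8)[of t i] by (simp add: vectors_def)
    have sc: "br (v j) (v j) = 0" for j by (simp add: br_def)
    have "br (v i) (v 1) * br (v 3) (v 2) \<noteq> 0" if "i \<noteq> 1" using br i first_three that by simp
    then show "?g (v i) 0 = frame_scale v i * frame t i 0" "?g (v i) 1 = frame_scale v i * frame t i 1"
      unfolding g by (auto simp: frame_scale_def frame_def t_def cross_ratio_def sc)
  qed
  note ks = lifts_frame_scale[OF L]
  have conj_at: "?g (quadratic_pair a (v i)) = (\<lambda>k. (frame_scale v i)\<^sup>2 * (l i * frame t (\<Psi> i) k))"
    if i: "i \<in> {1..n}" for i
  proof -
    have "?g (quadratic_pair a (v i)) = (\<lambda>k. multiplier \<Psi> a v i * ?g (v (\<Psi> i)) k)"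
      unfolding lifts_multiplier(1)[OF L i] by (rule lin_scale)
    also have "\<dots> = (\<lambda>k. (frame_scale v i)\<^sup>2 * (l i * frame t (\<Psi> i) k))"
      unfolding gv[OF portrait_range[OF i]] l_def frame_value_def using ks[OF i] by (simp add: field_simps)
    finally show ?thesis .
  qed
  have small: "quadratic_pair A (?g (v j)) = ?g (quadratic_pair a (v j))" if j: "j \<in> {1, 2, 3}" for j
  proof -
    have jn: "j \<in> {1..n}" using j first_three by auto
    have "quadratic_pair A (?g (v j)) = (\<lambda>k. (frame_scale v j)\<^sup>2 * quadratic_pair A (frame t j) k)"
      unfolding gv[OF jn] by (rule quadratic_pair_scale_vector)
    also have "quadratic_pair A (frame t j) = (\<lambda>k. l j * frame t (\<Psi> j) k)"
      unfolding A_def by (rule interp_frame_value[OF j]) simp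
    finally show ?thesis unfolding conj_at[OF jn] .
  qed
  have conj: "quadratic_pair A (?g u) = ?g (quadratic_pair a u)" for u
  proof (rule conjugate_quadratic_eqI[of "v 1" "v 2" "v 3"])
    show "br (v 1) (v 2) \<noteq> 0" "br (v 1) (v 3) \<noteq> 0" "br (v 2) (v 3) \<noteq> 0" using br first_three by simp_all
    fix w assume "w \<in> {v 1, v 2, v 3}"
    then show "quadratic_pair A (?g w) = ?g (quadratic_pair a w)"
      using small[of 1] small[of 2] small[of 3] by auto
  qed
  have d': "b4 * b1 - (- b2) * (- b3) \<noteq> 0" using d by (simp add: mult.commute)
  have gg': "?g (?g' w) = (\<lambda>k. ?d * w k)" if "w \<in> vectors 2" for w
    using lin_adjugate[OF that, of b1 "- b2" "- b3" b4] by (simp add: mult.commute)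
  have conj': "(\<lambda>k. ?d\<^sup>2 * quadratic_pair A w k) = ?g (quadratic_pair a (?g' w))" if "w \<in> nzvec" for w
  proof -
    have "w \<in> vectors 2" using that by (simp add: nzvec_def)
    then have "quadratic_pair A (\<lambda>k. ?d * w k) = ?g (quadratic_pair a (?g' w))"
      using conj[of "?g' w"] gg'[of w] by simp
    then show ?thesis unfolding quadratic_pair_scale_vector .
  qed
  have R: "form_resultant A \<noteq> 0"
  proof (rule form_resultant_nonzeroI)
    fix w assume w: "w \<in> nzvec"
    have "?g (quadratic_pair a (?g' w)) \<in> nzvec"
      by (rule lin_nzvec[OF d quadratic_pair_nonzero[OF lifts_map(3)[OF L] lin_nzvec[OF d' w]]])
    then show "quadratic_pair A w \<in> nzvec"
      using quadratic_pair_simps(3)[of A w] unfolding conj'[OF w, symmetric] nzvec_iff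
      by (auto simp del: quadratic_pair_simps)
  qed
  have brf: "br (frame t i) (frame t j) \<noteq> 0" if ij: "i \<in> {1..n}" "j \<in> {1..n}" "i \<noteq> j" for i j
  proof
    assume "br (frame t i) (frame t j) = 0"
    moreover have "br (?g (v i)) (?g (v j)) = frame_scale v i * frame_scale v j * br (frame t i) (frame t j)"
      unfolding gv[OF ij(1)] gv[OF ij(2)] by (simp add: br_def algebra_simps)
    ultimately have "?d * br (v i) (v j) = 0" unfolding br_lin by simp
    then show False using d br[OF ij] by simp
  qed
  have cond: "br (quadratic_pair A (frame t i)) (frame t (\<Psi> i)) = 0" if i: "i \<in> {4..n}" for i
  proof -
    have i1: "i \<in> {1..n}" using i by simp
    have "(\<lambda>k. (frame_scale v i)\<^sup>2 * quadratic_pair A (frame t i) k) = (\<lambda>k. (frame_scale v i)\<^sup>2 * (l i * frame t (\<Psi> i) k))"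
      using conj[of "v i"] unfolding gv[OF i1] quadratic_pair_scale_vector conj_at[OF i1] .
    from fun_cong[OF this] have "quadratic_pair A (frame t i) k = l i * frame t (\<Psi> i) k" for k
      using ks[OF i1] by simp
    then show ?thesis by (simp add: br_def del: quadratic_pair_simps)
  qed
  have s: "s = coords n l t" by (simp add: s_def invariants_def l_def t_def)
  have fr: "slice_frame n s i = frame t i" if "i \<in> {1..n}" for i
    unfolding s by (rule slice_parameters(1)[OF n Psi R[unfolded A_def] brf cond[unfolded A_def] that])
  obtain k where k: "k \<noteq> 0" "\<forall>j\<in>{1, 2, 3}. slice_value n \<Psi> s j = k * l j"
    using slice_parameters(2)[OF n Psi R[unfolded A_def] brf cond[unfolded A_def]] unfolding s by blast
  have sm: "slice_map n \<Psi> s = (\<lambda>i. k * A i)"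
    unfolding slice_map_def A_def interp_def
    using k(2) fr[OF portrait_range[OF first_three(1)]] fr[OF portrait_range[OF first_three(2)]] fr[OF portrait_range[OF first_three(3)]]
    by (simp add: fun_eq_iff algebra_simps)
  have R': "form_resultant (slice_map n \<Psi> s) \<noteq> 0" unfolding sm form_resultant_scale using k(1) R by simp
  have "s \<in> vectors 2" unfolding s coords_def by simp
  moreover have "discriminant n \<Psi> s \<noteq> 0" unfolding discriminant_nonzero_iff using R' brf fr by simp
  ultimately show S: "s \<in> principal_open (discriminant n \<Psi>)" by (simp add: principal_open_def)
  have iso: "isomorphism P1 P1 (mob b4 (- b2) (- b3) b1) (mob b1 b2 b3 b4)"
    by (rule isomorphism_sym[OF mob_isomorphism[OF d]])
  show "(x, section_point n \<Psi> s) \<in> orbit_relation n \<Psi>"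
  proof (rule orbit_relationI[OF _ section_point_in_End[OF S] iso])
    show "x \<in> points (End_portrait n \<Psi>)" using L by (simp add: lifts_def)
    fix z assume "z \<in> points P1"
    then obtain w where w: "w \<in> nzvec" "z = pt w" unfolding points_P1 by blast
    have qA: "quadratic_pair A w \<in> nzvec" by (rule quadratic_pair_nonzero[OF R w(1)])
    have pun: "slice_map n \<Psi> s \<in> punctured 5" unfolding slice_map_def
      by (rule interp_punctured) (use R' in \<open>simp add: slice_map_def\<close>)
    have "rat_map (section_point n \<Psi> s 0) z = pt (quadratic_pair (slice_map n \<Psi> s) w)"
      using rat_map_pt[OF pun w(1) R'] w(2) by simp
    also have "\<dots> = pt (quadratic_pair A w)"
      unfolding sm quadratic_pair_scale_map by (rule pt_scale[OF qA k(1)])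
    finally have 1: "rat_map (section_point n \<Psi> s 0) z = pt (quadratic_pair A w)" .
    have w': "?g' w \<in> nzvec" by (rule lin_nzvec[OF d' w(1)])
    have "rat_map (x 0) (mob b4 (- b2) (- b3) b1 z) = pt (quadratic_pair a (?g' w))"
      unfolding w(2) mob_pt[OF d' w(1)] lifts_map(2)[OF L]
      by (rule rat_map_pt[OF lifts_map(1)[OF L] w' lifts_map(3)[OF L]])
    then have "mob b1 b2 b3 b4 (rat_map (x 0) (mob b4 (- b2) (- b3) b1 z)) = pt (?g (quadratic_pair a (?g' w)))"
      using mob_pt[OF d quadratic_pair_nonzero[OF lifts_map(3)[OF L] w']] by simp
    also have "\<dots> = pt (quadratic_pair A w)"
      unfolding conj'[OF w(1), symmetric] by (rule pt_scale[OF qA]) (use d in simp)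
    finally show "rat_map (section_point n \<Psi> s 0) z = mob b1 b2 b3 b4 (rat_map (x 0) (mob b4 (- b2) (- b3) b1 z))"
      using 1 by simp
  next
    fix i assume i: "i \<in> {1..n}"
    have "mob b1 b2 b3 b4 (x i) = pt (?g (v i))"
      unfolding lifts_point(2)[OF L i] by (rule mob_pt[OF d lifts_point(1)[OF L i]])
    also have "\<dots> = pt (frame t i)" unfolding gv[OF i] by (rule pt_scale[OF _ ks[OF i]]) simp
    finally show "section_point n \<Psi> s i = mob b1 b2 b3 b4 (x i)" using i fr[OF i] by simp
  qed
qed

text \<open>An automorphism between two normal forms fixes infinity, zero and one, so it is the
  identity. The two maps then agree everywhere, hence have proportional coefficients.\<close>

lemma normal_form_unique:
  assumes s: "s \<in> principal_open (discriminant n \<Psi>)" and s': "s' \<in> principal_open (discriminant n \<Psi>)"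
    and rel: "(section_point n \<Psi> s, section_point n \<Psi> s') \<in> orbit_relation n \<Psi>"
  shows "s = s'"
proof -
  let ?x = "section_point n \<Psi> s" and ?y = "section_point n \<Psi> s'"
  let ?a = "slice_map n \<Psi> s" and ?b = "slice_map n \<Psi> s'"
  obtain \<phi> \<psi> where iso: "isomorphism P1 P1 \<phi> \<psi>"
    and m: "\<forall>z \<in> points P1. rat_map (?y 0) z = \<psi> (rat_map (?x 0) (\<phi> z))" and p: "\<forall>i\<in>{1..n}. ?y i = \<psi> (?x i)"
    using orbit_relationD(3)[OF rel] by (elim exE conjE) (rule that)
  have R: "form_resultant ?a \<noteq> 0" "form_resultant ?b \<noteq> 0"
    using s s' discriminant_nonzero_iff[of n \<Psi>] by (simp_all add: principal_open_def)
  have "slice_map n \<Psi> u \<in> punctured 5" if "form_resultant (slice_map n \<Psi> u) \<noteq> 0" for u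
    using that unfolding slice_map_def by (rule interp_punctured)
  note pun = this[OF R(1)] this[OF R(2)]
  have E: "?x \<in> points (End_portrait n \<Psi>)" by (rule section_point_in_End[OF s])
  have fix3: "\<psi> (pt (frame t j)) = pt (frame t j)" if "j \<in> {1, 2, 3}" for j t
  proof -
    have j: "j \<in> {1..n}" using that first_three by auto
    have e: "slice_frame n s j = frame t j" "slice_frame n s' j = frame t j"
      using that by (auto simp: slice_frame_def)
    from bspec[OF p j] show ?thesis unfolding section_point_simps(2)[OF j] e by (rule sym)
  qed
  have psi: "\<psi> z = z" if "z \<in> points P1" for z
    by (rule automorphism_fixing_three_points[OF isomorphism_sym[OF iso] _ _ _ that])
       (use fix3[of 1] fix3[of 2] fix3[of 3] in simp_all)
  have phi: "\<phi> z = z" if "z \<in> points P1" for z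
    using isomorphismD(4)[OF iso that] psi[OF that] by (metis isomorphismD(1) iso morphism_maps psi that)
  have points: "slice_frame n s' i = slice_frame n s i" if i: "i \<in> {1..n}" for i
  proof -
    have "?y i = ?x i" using p i psi[OF End_portrait_component[OF E i]] by simp
    then have e: "pt (slice_frame n s' i) = pt (slice_frame n s i)" using i by simp
    show ?thesis
    proof (cases "i \<in> {1, 2, 3}")
      case True then show ?thesis by (auto simp: slice_frame_def)
    next
      case False
      then have "slice_frame n s' i = pairvec (param n s' i) 1" "slice_frame n s i = pairvec (param n s i) 1"
        by (simp_all add: slice_frame_def frame_def)
      then show ?thesis using e pt_affine_eq_iff by simp
    qed
  qed
  have maps: "pt (quadratic_pair ?b v) = pt (quadratic_pair ?a v)" if v: "v \<in> nzvec" for v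
  proof -
    have z: "pt v \<in> points P1" by (rule pt_in_P1[OF v])
    have x0: "?x 0 \<in> Rat2" using E unfolding End_portrait_iff by blast
    have "rat_map (?y 0) (pt v) = rat_map (?x 0) (pt v)"
      using m z phi[OF z] psi[OF rat_map_points[OF x0 z]] by simp
    then show ?thesis using rat_map_pt[OF pun(1) v R(1)] rat_map_pt[OF pun(2) v R(2)] by simp
  qed
  \<comment> \<open>Any five distinct points serve: infinity, 0, 1, -1 and 2.\<close>
  have "\<exists>c. \<forall>i<6. ?b i = c * ?a i"
  proof (rule quadratic_maps_agree_at_five[OF R(1), of "- 1" 2])
    fix v assume "v \<in> {pairvec 1 0, pairvec 0 1, pairvec 1 1, pairvec (- 1) 1, pairvec 2 1 :: nat \<Rightarrow> complex}"
    then have v: "v \<in> nzvec" by auto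
    show "br (quadratic_pair ?a v) (quadratic_pair ?b v) = 0"
      using maps[OF v] pt_eq_iff[OF quadratic_pair_nonzero[OF R(1) v] quadratic_pair_nonzero[OF R(2) v]] by simp
  qed simp_all
  then obtain c where c: "\<forall>i<6. ?b i = c * ?a i" by blast
  have q: "quadratic_pair ?b v k = c * quadratic_pair ?a v k" for v k
    using c by (simp add: quadratic_pair_def algebra_simps)
  have val: "slice_value n \<Psi> s' j = c * slice_value n \<Psi> s j" if j: "j \<in> {1, 2, 3}" for j
  proof -
    have jn: "\<Psi> j \<in> {1..n}" using j first_three portrait_range by auto
    let ?w = "slice_frame n s (\<Psi> j)"
    have "slice_value n \<Psi> s' j * ?w k = c * (slice_value n \<Psi> s j * ?w k)" for k
      using q[of "frame undefined j" k]
        interp_frame_value[OF j, of "\<lambda>j. slice_frame n s (\<Psi> j)" "slice_value n \<Psi> s" undefined]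
        interp_frame_value[OF j, of "\<lambda>j. slice_frame n s' (\<Psi> j)" "slice_value n \<Psi> s'" undefined]
        points[OF jn] unfolding slice_map_def by simp
    moreover obtain k where "?w k \<noteq> 0" using slice_frame_nzvec(1)[of n s "\<Psi> j"] unfolding nzvec_iff by blast
    ultimately show ?thesis by (metis mult.assoc mult_right_cancel)
  qed
  have s2: "s \<in> vectors 2" "s' \<in> vectors 2" using s s' by (simp_all add: principal_open_def)
  have param: "param n s' i = param n s i" if "i \<in> {4..n}" for i
  proof -
    have "i \<in> {1..n}" "i \<notin> {1, 2, 3}" using that by auto
    then show ?thesis using points[of i] by (simp add: slice_frame_def frame_def)
  qed
  consider "n = 3" | "n = 4" | "n = 5" using n by blast
  then show ?thesis
  proof cases
    case 1
    then have "c = 1" using val[of 1] by (simp add: slice_value_def)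
    then show ?thesis using val[of 2] val[of 3] 1 by (intro vectors2_eqI[OF s2]) (simp_all add: slice_value_def)
  next
    case 2
    have s0: "s' 0 = s 0" using param[of 4] 2 by (simp add: param_def)
    have "param n s' = param n s" using s0 2 by (simp add: param_def fun_eq_iff)
    then have A: "portrait_coeff \<Psi> (param n s') 4 j = portrait_coeff \<Psi> (param n s) 4 j" for j by simp
    have nz: "slice_value n \<Psi> s 1 \<noteq> 0"
      using interp_value_nonzero[OF n Psi R(1)[unfolded slice_map_def], of 1] by simp
    have v: "slice_value n \<Psi> u 1 = portrait_coeff \<Psi> (param n u) 4 3"
      "slice_value n \<Psi> u 2 = u 1 * slice_value n \<Psi> u 1" for u using 2 by (simp_all add: slice_value_def)
    have e: "slice_value n \<Psi> s' 1 = slice_value n \<Psi> s 1" unfolding v(1) A ..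
    then have "c = 1" using val[of 1] nz by simp
    then have "slice_value n \<Psi> s' 2 = slice_value n \<Psi> s 2" using val[of 2] by simp
    then have "s' 1 = s 1" unfolding v(2) e using nz by simp
    then show ?thesis using s0 by (intro vectors2_eqI[OF s2]) simp_all
  next
    case 3
    then show ?thesis using param[of 4] param[of 5]
      by (intro vectors2_eqI[OF s2]) (simp_all add: param_def)
  qed
qed

end

section \<open>The moduli space is a principal open set of the plane\<close>

lemma regular_pairvec:
  assumes Z: "space_with_functions Z" and "a \<in> regular Z W" "b \<in> regular Z W"
  shows "(\<lambda>x. pairvec (a x) (b x) k) \<in> regular Z W"
proof -
  have "openin (zariski Z) W" by (rule regular_open[OF Z assms(2)])
  then have zero: "(\<lambda>_. 0) \<in> regular Z W" by (rule regular_const[OF Z])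
  consider "k = 0" | "k = 1" | "k \<noteq> 0" "k \<noteq> 1" by blast
  then show ?thesis using zero assms(2,3) by cases (simp_all add: pairvec_def)
qed

lemma regular_br:
  assumes Z: "space_with_functions Z"
    and "\<And>k. (\<lambda>x. v x k) \<in> regular Z W" "\<And>k. (\<lambda>x. w x k) \<in> regular Z W"
  shows "(\<lambda>x. br (v x) (w x)) \<in> regular Z W"
  unfolding br_def by (intro regular_diff[OF Z] regular_mult[OF Z] assms(2,3))

lemma regular_quadratic_pair:
  assumes Z: "space_with_functions Z"
    and a: "\<And>k. (\<lambda>x. a x k) \<in> regular Z W" and v: "\<And>k. (\<lambda>x. v x k) \<in> regular Z W"
  shows "(\<lambda>x. quadratic_pair (a x) (v x) k) \<in> regular Z W"
proof -
  have "(\<lambda>x. a x i * (v x 0)\<^sup>2 + a x j * v x 0 * v x 1 + a x m * (v x 1)\<^sup>2) \<in> regular Z W" for i j m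
    by (intro regular_add[OF Z] regular_mult[OF Z] regular_power[OF Z] a v)
  from regular_pairvec[OF Z this this, of 0 1 2 3 4 5 k]
  show ?thesis unfolding quadratic_pair_def pairvec_def .
qed

text \<open>The parameters of the normal form of a map with marked points, read off from arbitrary
  homogeneous coordinates.\<close>

definition classifying :: "nat \<Rightarrow> (nat \<Rightarrow> nat) \<Rightarrow> (nat \<Rightarrow> (nat \<Rightarrow> complex) set) \<Rightarrow> nat \<Rightarrow> complex" where
  "classifying n \<Psi> x = invariants n \<Psi> (SOME a. a \<in> x 0) (\<lambda>i. SOME v. v \<in> x i)"

context
  fixes n :: nat and \<Psi> :: "nat \<Rightarrow> nat"
  assumes n: "n \<in> {3, 4, 5}" and Psi: "bij_betw \<Psi> {1..n} {1..n}"
begin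

lemma lifts_exist:
  assumes x: "x \<in> points (End_portrait n \<Psi>)"
  shows "lifts n \<Psi> x (SOME a. a \<in> x 0) (\<lambda>i. SOME v. v \<in> x i)"
proof -
  have "x 0 \<in> Rat2" using x unfolding End_portrait_iff by blast
  then have "(SOME a. a \<in> x 0) \<in> x 0" by (rule someI_ex[OF Rat2_nonempty])
  moreover have "(SOME v. v \<in> x i) \<in> x i" if i: "i \<in> {1..n}" for i
    by (rule someI_ex[OF projective_point_nonempty[OF End_portrait_component[OF x i]]])
  ultimately show ?thesis unfolding lifts_def using x by blast
qed

lemma classifying_normal_form:
  assumes x: "x \<in> points (End_portrait n \<Psi>)"
  shows "classifying n \<Psi> x \<in> principal_open (discriminant n \<Psi>)"
    and "(x, section_point n \<Psi> (classifying n \<Psi> x)) \<in> orbit_relation n \<Psi>"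
  unfolding classifying_def
  by (rule normal_form[OF n Psi lifts_exist[OF x]])+

text \<open>The normal forms that belong to two choices of coordinates lie in the same orbit, so they are
  equal. Hence the classifying map depends neither on the choice of coordinates nor on the point
  of the orbit.\<close>

lemma classifying_unique:
  assumes s: "s \<in> principal_open (discriminant n \<Psi>)" and r: "(x, section_point n \<Psi> s) \<in> orbit_relation n \<Psi>"
  shows "classifying n \<Psi> x = s"
proof -
  note x = orbit_relationD(1)[OF r]
  have sym: "sym (orbit_relation n \<Psi>)" and trans: "trans (orbit_relation n \<Psi>)"
    using equiv_orbit_relation[of n \<Psi>] by (simp_all add: equiv_def)
  have "(section_point n \<Psi> (classifying n \<Psi> x), section_point n \<Psi> s) \<in> orbit_relation n \<Psi>"
    by (rule transD[OF trans symD[OF sym classifying_normal_form(2)[OF x]] r])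
  then show ?thesis by (rule normal_form_unique[OF n Psi classifying_normal_form(1)[OF x] s])
qed

lemma classifying_lifts: "lifts n \<Psi> x a v \<Longrightarrow> classifying n \<Psi> x = invariants n \<Psi> a v"
  by (rule classifying_unique) (rule normal_form[OF n Psi], assumption)+

lemma classifying_section:
  assumes s: "s \<in> principal_open (discriminant n \<Psi>)"
  shows "classifying n \<Psi> (section_point n \<Psi> s) = s"
proof (rule classifying_unique[OF s])
  have "refl_on (points (End_portrait n \<Psi>)) (orbit_relation n \<Psi>)"
    using equiv_orbit_relation[of n \<Psi>] by (simp add: equiv_def)
  then show "(section_point n \<Psi> s, section_point n \<Psi> s) \<in> orbit_relation n \<Psi>"
    by (rule refl_onD[OF _ section_point_in_End[OF n Psi s]])
qed

lemma classifying_orbit: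
  assumes xy: "(x, y) \<in> orbit_relation n \<Psi>" shows "classifying n \<Psi> x = classifying n \<Psi> y"
proof -
  note y = orbit_relationD(2)[OF xy]
  have trans: "trans (orbit_relation n \<Psi>)"
    using equiv_orbit_relation[of n \<Psi>] by (simp add: equiv_def)
  show ?thesis
    by (rule classifying_unique[OF classifying_normal_form(1)[OF y] transD[OF trans xy classifying_normal_form(2)[OF y]]])
qed

text \<open>The parameters are built from brackets of coordinates by sums, products and quotients, and the
  denominators do not vanish because the marked points are distinct and the map has degree two.\<close>

lemma regular_invariants:
  assumes Z: "space_with_functions Z" and oW: "openin (zariski Z) W"
    and a: "\<And>k. (\<lambda>x. a x k) \<in> regular Z W"
    and v: "\<And>i k. i \<in> {1..n} \<Longrightarrow> (\<lambda>x. v x i k) \<in> regular Z W"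
    and L: "\<And>x. x \<in> W \<Longrightarrow> lifts n \<Psi> (f x) (a x) (v x)"
  shows "(\<lambda>x. invariants n \<Psi> (a x) (v x) j) \<in> regular Z W"
proof -
  have three: "1 \<in> {1..n}" "2 \<in> {1..n}" "3 \<in> {1..n}" using n by auto
  have br: "(\<lambda>x. br (v x i) (v x k)) \<in> regular Z W" if "i \<in> {1..n}" "k \<in> {1..n}" for i k
    by (rule regular_br[OF Z v v]) (fact that)+
  have scale: "(\<lambda>x. frame_scale (v x) i) \<in> regular Z W" if i: "i \<in> {1..n}" for i
  proof (cases "i = 1")
    case True
    have "(\<lambda>x. br (v x 1) (v x 2) * br (v x 3) (v x 1)) \<in> regular Z W"
      by (intro regular_mult[OF Z] br three)
    then show ?thesis unfolding frame_scale_def using True by simp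
  next
    case False
    have "(\<lambda>x. br (v x i) (v x 1) * br (v x 3) (v x 2)) \<in> regular Z W"
      by (intro regular_mult[OF Z] br three i)
    then show ?thesis unfolding frame_scale_def using False by simp
  qed
  have ratio: "(\<lambda>x. cross_ratio (v x) i) \<in> regular Z W" if i: "i \<in> {1..n}" "i \<noteq> 1" for i
    unfolding cross_ratio_def
  proof (rule regular_divide[OF Z])
    show "(\<lambda>x. br (v x i) (v x 2) * br (v x 3) (v x 1)) \<in> regular Z W"
      by (intro regular_mult[OF Z] br three i)
    show "(\<lambda>x. br (v x i) (v x 1) * br (v x 3) (v x 2)) \<in> regular Z W"
      by (intro regular_mult[OF Z] br three i)
    show "br (v x i) (v x 1) * br (v x 3) (v x 2) \<noteq> 0" if "x \<in> W" for x
      using lifts_br[OF n Psi L[OF that] i(1) three(1) i(2)] lifts_br[OF n Psi L[OF that] three(3,2)] by simp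
  qed
  have mult: "(\<lambda>x. multiplier \<Psi> (a x) (v x) i) \<in> regular Z W" if i: "i \<in> {1..n}" for i
  proof -
    define u :: nat where "u = (if \<Psi> i = 1 then 2 else 1)"
    have u: "u \<in> {1..n}" "\<Psi> i \<noteq> u" and j: "\<Psi> i \<in> {1..n}"
      using three Psi_range[OF n Psi i] by (auto simp: u_def)
    have "(\<lambda>x. br (quadratic_pair (a x) (v x i)) (v x u) / br (v x (\<Psi> i)) (v x u)) \<in> regular Z W"
    proof (rule regular_divide[OF Z])
      show "(\<lambda>x. br (quadratic_pair (a x) (v x i)) (v x u)) \<in> regular Z W"
        by (rule regular_br[OF Z regular_quadratic_pair[OF Z a v[OF i]] v[OF u(1)]])
      show "(\<lambda>x. br (v x (\<Psi> i)) (v x u)) \<in> regular Z W" by (rule br[OF j u(1)])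
      show "br (v x (\<Psi> i)) (v x u) \<noteq> 0" if "x \<in> W" for x
        by (rule lifts_br[OF n Psi L[OF that] j u])
    qed
    then show ?thesis unfolding multiplier_def Let_def u_def .
  qed
  have fvalue: "(\<lambda>x. frame_value \<Psi> (a x) (v x) i) \<in> regular Z W" if i: "i \<in> {1..n}" for i
    unfolding frame_value_def
  proof (rule regular_divide[OF Z])
    show "(\<lambda>x. multiplier \<Psi> (a x) (v x) i * frame_scale (v x) (\<Psi> i)) \<in> regular Z W"
      by (intro regular_mult[OF Z] mult scale i Psi_range[OF n Psi])
    show "(\<lambda>x. (frame_scale (v x) i)\<^sup>2) \<in> regular Z W" by (intro regular_power[OF Z] scale i)
    show "(frame_scale (v x) i)\<^sup>2 \<noteq> 0" if "x \<in> W" for x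
      using lifts_frame_scale[OF n Psi L[OF that] i] by simp
  qed
  have quot: "(\<lambda>x. frame_value \<Psi> (a x) (v x) i / frame_value \<Psi> (a x) (v x) 1) \<in> regular Z W"
    if i: "i \<in> {1..n}" for i
    by (rule regular_divide[OF Z fvalue[OF i] fvalue[OF three(1)] lifts_frame_value[OF n Psi L three(1)]])
  consider "n = 3" | "n = 4" | "n = 5" using n by blast
  then show ?thesis
  proof cases
    case 1
    then show ?thesis
      using regular_pairvec[OF Z quot[OF three(2)] quot[OF three(3)]] by (simp add: invariants_def coords_def)
  next
    case 2
    then show ?thesis
      using regular_pairvec[OF Z ratio[of 4] quot[OF three(2)]] by (simp add: invariants_def coords_def)
  next
    case 3
    then show ?thesis
      using regular_pairvec[OF Z ratio[of 4] ratio[of 5]] by (simp add: invariants_def coords_def)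
  qed
qed

lemma End_portrait_local_lifts:
  assumes x0: "x0 \<in> points (End_portrait n \<Psi>)"
  shows "\<exists>W a v. openin (zariski (End_portrait n \<Psi>)) W \<and> x0 \<in> W \<and>
    (\<forall>k. (\<lambda>x. a x k) \<in> regular (End_portrait n \<Psi>) W) \<and>
    (\<forall>i\<in>{1..n}. \<forall>k. (\<lambda>x. v x i k) \<in> regular (End_portrait n \<Psi>) W) \<and>
    (\<forall>x\<in>W. lifts n \<Psi> x (a x) (v x))"
proof -
  let ?Z = "End_portrait n \<Psi>"
  note Z = space_with_functions_End_portrait[of n \<Psi>]
  let ?Q = "\<lambda>i U u. openin (zariski ?Z) U \<and> x0 \<in> U \<and> (\<forall>k. (\<lambda>x. u x k) \<in> regular ?Z U) \<and> (\<forall>x\<in>U. u x \<in> x i)"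
  have "\<forall>i\<in>{0..n}. \<exists>U u. ?Q i U u"
  proof
    fix i assume i: "i \<in> {0..n}"
    have "\<exists>N. factor i = projective_space N" unfolding factor_def by (cases "i = 0") auto
    then obtain N where N: "factor i = projective_space N" by (elim exE)
    have mor: "morphism ?Z (projective_space N) (\<lambda>x. x i)"
      using morphism_End_component[OF i, of \<Psi>] unfolding N .
    show "\<exists>U u. ?Q i U u"
    proof (rule morphism_local_lift[OF Z mor x0])
      fix U u assume "openin (zariski ?Z) U" "x0 \<in> U"
        "\<And>k. (\<lambda>x. u x k) \<in> regular ?Z U" "\<And>x. x \<in> U \<Longrightarrow> u x \<in> x i"
      then show "\<exists>U u. ?Q i U u" by (intro exI[of _ U] exI[of _ u] conjI allI ballI)
    qed
  qed
  from bchoice[OF this] obtain U where "\<forall>i\<in>{0..n}. \<exists>u. ?Q i (U i) u" by (elim exE)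
  from bchoice[OF this] obtain u where Q: "\<forall>i\<in>{0..n}. ?Q i (U i) (u i)" by (elim exE)
  define W where "W = (\<Inter>i\<in>{0..n}. U i)"
  have oW: "openin (zariski ?Z) W" unfolding W_def by (rule openin_INT2[OF finite_index]) (use Q in blast)
  have sub: "W \<subseteq> U i" if "i \<in> {0..n}" for i using that unfolding W_def by blast
  have reg: "(\<lambda>x. u i x k) \<in> regular ?Z W" if i: "i \<in> {0..n}" for i k
  proof (rule regular_restrict[OF Z _ oW sub[OF i]])
    show "(\<lambda>x. u i x k) \<in> regular ?Z (U i)" using Q[rule_format, OF i] by (elim conjE) (rule spec)
  qed
  have mem: "u i x \<in> x i" if "x \<in> W" "i \<in> {0..n}" for x i
    using Q[rule_format, OF that(2)] sub[OF that(2)] that(1) by (elim conjE) (blast dest: bspec)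
  show ?thesis
  proof (intro exI[of _ W] exI[of _ "u 0"] exI[of _ "\<lambda>x i. u i x"] conjI allI ballI)
    show "openin (zariski ?Z) W" by (rule oW)
    show "x0 \<in> W" unfolding W_def by (rule INT_I) (use Q in blast)
    show "(\<lambda>x. u 0 x k) \<in> regular ?Z W" for k by (rule reg) simp
    show "(\<lambda>x. u i x k) \<in> regular ?Z W" if "i \<in> {1..n}" for i k by (rule reg) (use that in simp)
    show "lifts n \<Psi> x (u 0 x) (\<lambda>i. u i x)" if x: "x \<in> W" for x
    proof -
      have "x \<in> points ?Z" using openin_subset[OF oW] x by blast
      then show ?thesis unfolding lifts_def using mem[OF x] by simp
    qed
  qed
qed

lemma morphism_classifying:
  "morphism (End_portrait n \<Psi>) (plane_open (discriminant n \<Psi>)) (classifying n \<Psi>)"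
  unfolding plane_open_def
proof (rule morphism_into_induced_space[OF _ morphism_into_affine_space])
  let ?Z = "End_portrait n \<Psi>"
  show Z: "space_with_functions ?Z" "space_with_functions ?Z" by (rule space_with_functions_End_portrait)+
  show D: "classifying n \<Psi> x \<in> principal_open (discriminant n \<Psi>)" if "x \<in> points ?Z" for x
    by (rule classifying_normal_form(1)[OF that])
  show "classifying n \<Psi> x \<in> vectors 2" if "x \<in> points ?Z" for x
    using D[OF that] by (simp add: principal_open_def)
  fix i :: nat assume "i < 2"
  show "(\<lambda>x. classifying n \<Psi> x i) \<in> regular ?Z (points ?Z)"
  proof (rule regular_local[OF Z(1) openin_topspace])
    fix x0 assume x0: "x0 \<in> points ?Z"
    obtain W a v where W: "openin (zariski ?Z) W" "x0 \<in> W"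
      and a: "\<forall>k. (\<lambda>x. a x k) \<in> regular ?Z W" and v: "\<forall>i\<in>{1..n}. \<forall>k. (\<lambda>x. v x i k) \<in> regular ?Z W"
      and L: "\<forall>x\<in>W. lifts n \<Psi> x (a x) (v x)"
      using End_portrait_local_lifts[OF x0] by (elim exE conjE) (rule that)
    have "(\<lambda>x. invariants n \<Psi> (a x) (v x) i) \<in> regular ?Z W"
    proof (rule regular_invariants[OF Z(1) W(1)])
      show "(\<lambda>x. a x k) \<in> regular ?Z W" for k by (rule a[rule_format])
      show "(\<lambda>x. v x i k) \<in> regular ?Z W" if "i \<in> {1..n}" for i k by (rule v[rule_format, OF that])
      show "lifts n \<Psi> x (a x) (v x)" if "x \<in> W" for x by (rule L[rule_format, OF that])
    qed
    then have "(\<lambda>x. classifying n \<Psi> x i) \<in> regular ?Z W"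
    proof (rule regular_cong[OF Z(1)])
      fix x assume "x \<in> W"
      then show "classifying n \<Psi> x i = invariants n \<Psi> (a x) (v x) i"
        by (intro fun_cong[OF classifying_lifts] L[rule_format])
    qed
    then show "\<exists>V. x0 \<in> V \<and> V \<subseteq> points ?Z \<and> (\<lambda>x. classifying n \<Psi> x i) \<in> regular ?Z V"
      by (intro exI[of _ W] conjI W(2) openin_subset[OF W(1)])
  qed
qed

lemma morphism_section_point:
  "morphism (plane_open (discriminant n \<Psi>)) (End_portrait n \<Psi>) (section_point n \<Psi>)"
proof -
  let ?D = "plane_open (discriminant n \<Psi>)"
  note D = space_with_functions_plane_open[of "discriminant n \<Psi>"]
  have poly: "p \<in> regular ?D (points ?D)" if "p \<in> polynomial_functions" for p
    using regular_polynomial[OF D openin_topspace that, of "\<lambda>x. x"] regular_plane_open_coordinate by simp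
  have "morphism ?D (End_ambient n) (section_point n \<Psi>)"
    unfolding End_ambient_product
  proof (rule morphism_into_product_space[OF finite_index space_with_functions_factor D])
    fix i assume i: "i \<in> {0..n}"
    show "morphism ?D (factor i) (\<lambda>s. section_point n \<Psi> s i)"
    proof (cases "i = 0")
      case True
      have "morphism ?D (projective_space 5) (\<lambda>s. proj_point 5 (slice_map n \<Psi> s))"
      proof (rule morphism_proj_point[OF D poly[OF polynomial_slice_map]])
        fix s assume "s \<in> points ?D"
        then have "form_resultant (slice_map n \<Psi> s) \<noteq> 0"
          using discriminant_nonzero_iff[of n \<Psi> s] by (simp add: principal_open_def)
        then show "slice_map n \<Psi> s \<in> punctured 5" unfolding slice_map_def by (rule interp_punctured)
      qed
      then show ?thesis unfolding True section_point_simps(1) factor_simps(1) .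
    next
      case False
      have "morphism ?D P1 (\<lambda>s. proj_point (Suc 0) (slice_frame n s i))"
      proof (rule morphism_proj_point[OF D poly[OF polynomial_frame]])
        show "slice_frame n s i \<in> punctured (Suc 0)" for s unfolding punctured_line by (rule slice_frame_nzvec(1))
      qed
      moreover have "(\<lambda>s. section_point n \<Psi> s i) = (\<lambda>s. proj_point (Suc 0) (slice_frame n s i))"
        using i False by (intro ext) (simp add: pt_def)
      ultimately show ?thesis unfolding factor_simps(2)[OF False] by (simp only:)
    qed
  next
    fix s show "section_point n \<Psi> s \<in> extensional {0..n}" unfolding section_point_def by (rule restrict_extensional)
  qed
  then show ?thesis
    unfolding End_portrait_def
  proof (rule morphism_into_induced_space[OF D], goal_cases)
    case (1 s)
    then have "s \<in> principal_open (discriminant n \<Psi>)" by simp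
    from section_point_in_End[OF n Psi this] show ?case
      unfolding End_portrait_def points_induced_space by (rule IntD2)
  qed
qed

text \<open>The classifying map is constant on orbits, so it descends to the quotient; sending parameters to
  the orbit of their normal form is its inverse.\<close>

lemma isomorphism_moduli_space:
  "isomorphism (moduli_space n \<Psi>) (plane_open (discriminant n \<Psi>))
    (\<lambda>C. classifying n \<Psi> (SOME x. x \<in> C)) (\<lambda>s. orbit_relation n \<Psi> `` {section_point n \<Psi> s})"
    (is "isomorphism _ ?D ?f ?g")
proof -
  let ?E = "End_portrait n \<Psi>" and ?R = "orbit_relation n \<Psi>"
  note E = space_with_functions_End_portrait[of n \<Psi>] and R = equiv_orbit_relation[of n \<Psi>]
  have f: "?f (?R `` {x}) = classifying n \<Psi> x" if x: "x \<in> points ?E" for x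
  proof -
    have "(SOME y. y \<in> ?R `` {x}) \<in> ?R `` {x}" by (rule someI[of "\<lambda>y. y \<in> ?R `` {x}", OF equiv_class_self[OF R x]])
    then have "(x, SOME y. y \<in> ?R `` {x}) \<in> ?R" by simp
    from classifying_orbit[OF this] show ?thesis by (rule sym)
  qed
  show ?thesis
    unfolding isomorphism_def moduli_space_def
  proof (intro conjI ballI)
    show "morphism (quotient_space ?E ?R) ?D ?f"
      by (rule morphism_from_quotient_space[OF E R morphism_classifying f])
    show "morphism ?D (quotient_space ?E ?R) ?g"
      by (rule morphism_compose[OF morphism_section_point morphism_quotient_map[OF E R]])
    fix C assume "C \<in> points (quotient_space ?E ?R)"
    then obtain x where x: "x \<in> points ?E" "C = ?R `` {x}"
      unfolding points_quotient_space[OF R] by (rule quotientE)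
    show "?g (?f C) = C"
      unfolding x(2) f[OF x(1)] by (rule equiv_class_eq[OF R classifying_normal_form(2)[OF x(1)], symmetric])
  next
    fix s assume "s \<in> points ?D"
    then have s: "s \<in> principal_open (discriminant n \<Psi>)" by simp
    show "?f (?g s) = s"
      unfolding f[OF section_point_in_End[OF n Psi s]] by (rule classifying_section[OF s])
  qed
qed

end

theorem theorem3p4:
  fixes n :: nat and \<Psi> :: "nat \<Rightarrow> nat"
  assumes "n \<in> {3, 4, 5}"
    and "portrait n \<Psi>"
    and "disjoint_union_of_cycles n \<Psi>"
  shows "points (moduli_space n \<Psi>) = {} \<or> smooth_rational_surface (moduli_space n \<Psi>)"
proof -
  have Psi: "bij_betw \<Psi> {1..n} {1..n}" using assms(3) by (simp add: disjoint_union_of_cycles_def)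
  have M: "space_with_functions (moduli_space n \<Psi>)"
    unfolding moduli_space_def
    by (rule space_with_functions_quotient[OF space_with_functions_End_portrait equiv_orbit_relation])
  show ?thesis
    using smooth_rational_surface_plane_open[OF M polynomial_discriminant isomorphism_moduli_space[OF assms(1) Psi]]
    by blast
qed

end
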